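(* For every integer $r\ge 0$, the parabolic $$\mathfrak p_r=\mathfrak q\bigl((60+4r)\mid(24,5,2^{[r]},1,2^{[r]},30)\bigr)\subseteq\mathfrak{sl}_{60+4r}$$ is Frobenius, has dimension $8r^2+244r+2550$, and its principal multiplicities $h_j(r)$ satisfy $$h_3(r)=237+16r,\qquad h_4(r)=181+19r,\qquad h_3(r)-h_4(r)=56-3r.$$ Its Ooms spectrum is strictly unimodal for $0\le r\le 18$ and is not unimodal for every $r\ge 19$. At $r=19$ the algebra lies in $\mathfrak{sl}_{136}$, has dimension $10074$, and its positive-degree multiplicities $(h_1,\ldots,h_{10})$ are $$(1659,\,891,\,541,\,542,\,485,\,379,\,268,\,170,\,82,\,20),$$ with $h_j=0$ for $j>10$.
   Context: All Lie algebras are finite-dimensional over $\mathbb C$. A Lie algebra $\mathfrak g$ is Frobenius if there is $F\in\mathfrak g^*$ (a Frobenius functional) whose Kirillov form $B_F(x,y)=F([x,y])$ is nondegenerate. For such $F$ the principal element $H=\widehat F\in\mathfrak g$ is the unique element with $F([H,x])=F(x)$ for all $x\in\mathfrak g$. For the algebras considered here $\operatorname{ad}H$ is semisimple with integral eigenvalues; the principal grading is $\mathfrak g=\bigoplus_{j\in\mathbb Z}\mathfrak g_j$ with $\mathfrak g_j=\{x:[H,x]=jx\}$. The principal multiplicities $h_j=\dim\mathfrak g_j$ do not depend on the choice of $F$; the resulting multiset of eigenvalues is the Ooms spectrum. One always has $h_{1-j}=h_j$. The Ooms spectrum is unimodal if $h_j\ge h_{j+1}$ for all $j\ge1$, and strictly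 unimodal if $h_1>h_2>\cdots>h_N>0$ where $N$ is the largest eigenvalue with $h_N\neq0$ (the equality $h_0=h_1$ forced by symmetry is allowed). For compositions $A=(a_1,\ldots,a_u)$ and $B=(b_1,\ldots,b_v)$ of $n$ (which cut $1,\ldots,n$ into consecutive blocks), let $\alpha(i)$ and $\beta(i)$ be the $A$-block and $B$-block containing $i$. The seaweed is $$\mathfrak q(A\mid B)=\mathfrak h\oplus\bigoplus_{i>j,\ \alpha(i)=\alpha(j)}\mathbb C E_{ij}\oplus\bigoplus_{i<j,\ \beta(i)=\beta(j)}\mathbb C E_{ij}\subseteq\mathfrak{sl}_n,$$ where $\mathfrak h$ is the trace-zero diagonal subalgebra. It is a parabolic when $A=(n)$. The notation $2^{[r]}$ means a list of $r$ parts equal to $2$. *)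

theory Defs
  imports "Jordan_Normal_Form.VS_Connect"
begin

section \<open>Matrix Lie algebras\<close>

text \<open>
  A finite-dimensional Lie algebra is represented as a Lie subalgebra of \<open>gl\<^sub>n\<close>, that is, as a
  subset \<open>g\<close> of \<^term>\<open>carrier_mat n n :: complex mat set\<close>. Matrix rows and columns are
  indexed by \<open>0, \<dots>, n - 1\<close>.
\<close>

abbreviation gl_space :: "nat \<Rightarrow> (complex, complex mat) module" where
  "gl_space n \<equiv> module_mat TYPE(complex) n n"

definition lie_bracket :: "complex mat \<Rightarrow> complex mat \<Rightarrow> complex mat" where
  "lie_bracket x y = x * y - y * x"

definition lie_subalgebra :: "nat \<Rightarrow> complex mat set \<Rightarrow> bool" where
  "lie_subalgebra n g \<longleftrightarrow>
     VectorSpace.subspace class_ring g (gl_space n) \<and> (\<forall>x\<in>g. \<forall>y\<in>g. lie_bracket x y \<in> g)"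

text \<open>Only meaningful when \<open>g\<close> is a linear subspace of the \<open>n \<times> n\<close> matrices.\<close>

definition cdim :: "nat \<Rightarrow> complex mat set \<Rightarrow> nat" where
  "cdim n g = vectorspace.dim class_ring (gl_space n\<lparr>carrier := g\<rparr>)"

definition sl :: "nat \<Rightarrow> complex mat set" where
  "sl n = {x \<in> carrier_mat n n. (\<Sum>i<n. x $$ (i, i)) = 0}"


section \<open>Frobenius functionals and principal multiplicities\<close>

text \<open>
  Elements of the dual space of \<open>g\<close> are functions on all matrices that are linear on \<open>g\<close>;
  every notion below depends only on the restriction of the function to \<open>g\<close>.
\<close>

definition functional_on :: "complex mat set \<Rightarrow> (complex mat \<Rightarrow> complex) \<Rightarrow> bool" where
  "functional_on g F \<longleftrightarrow>
     (\<forall>x\<in>g. \<forall>y\<in>g. F (x + y) = F x + F y) \<and> (\<forall>c. \<forall>x\<in>g. F (c \<cdot>\<^sub>m x) = c * F x)"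

definition kirillov_form ::
    "(complex mat \<Rightarrow> complex) \<Rightarrow> complex mat \<Rightarrow> complex mat \<Rightarrow> complex" where
  "kirillov_form F x y = F (lie_bracket x y)"

text \<open>The form is alternating, so nondegeneracy in the first argument suffices.\<close>

definition frobenius_functional ::
    "nat \<Rightarrow> complex mat set \<Rightarrow> (complex mat \<Rightarrow> complex) \<Rightarrow> bool" where
  "frobenius_functional n g F \<longleftrightarrow>
     functional_on g F \<and> (\<forall>x\<in>g. (\<forall>y\<in>g. kirillov_form F x y = 0) \<longrightarrow> x = 0\<^sub>m n n)"

definition frobenius :: "nat \<Rightarrow> complex mat set \<Rightarrow> bool" where
  "frobenius n g \<longleftrightarrow> lie_subalgebra n g \<and> (\<exists>F. frobenius_functional n g F)"

definition principal_element ::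
    "complex mat set \<Rightarrow> (complex mat \<Rightarrow> complex) \<Rightarrow> complex mat" where
  "principal_element g F = (THE H. H \<in> g \<and> (\<forall>x\<in>g. F (lie_bracket H x) = F x))"

definition principal_component ::
    "complex mat set \<Rightarrow> (complex mat \<Rightarrow> complex) \<Rightarrow> int \<Rightarrow> complex mat set" where
  "principal_component g F j =
     {x \<in> g. lie_bracket (principal_element g F) x = of_int j \<cdot>\<^sub>m x}"

definition principal_mult ::
    "nat \<Rightarrow> complex mat set \<Rightarrow> (complex mat \<Rightarrow> complex) \<Rightarrow> int \<Rightarrow> nat" where
  "principal_mult n g F j = cdim n (principal_component g F j)"

text \<open>
  A spectrum is given by its multiplicity function \<open>h\<close>. In the strict version \<open>N\<close> is the largest
  degree of nonzero multiplicity; positive degrees only are compared, so \<open>h 0 = h 1\<close> is allowed.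
\<close>

definition unimodal :: "(int \<Rightarrow> nat) \<Rightarrow> bool" where
  "unimodal h \<longleftrightarrow> (\<forall>j\<ge>1. h j \<ge> h (j + 1))"

definition strictly_unimodal :: "(int \<Rightarrow> nat) \<Rightarrow> bool" where
  "strictly_unimodal h \<longleftrightarrow>
     (\<exists>N\<ge>1. h N > 0 \<and> (\<forall>j>N. h j = 0) \<and> (\<forall>j. 1 \<le> j \<and> j < N \<longrightarrow> h j > h (j + 1)))"


section \<open>Seaweed algebras\<close>

definition composition :: "nat \<Rightarrow> nat list \<Rightarrow> bool" where
  "composition n C \<longleftrightarrow> sum_list C = n \<and> (\<forall>c\<in>set C. 0 < c)"

text \<open>The block containing the index \<open>i < sum_list C\<close>; blocks are numbered from \<open>0\<close>.\<close>

definition block :: "nat list \<Rightarrow> nat \<Rightarrow> nat" where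
  "block C i = (LEAST k. i < sum_list (take (Suc k) C))"

definition elem_mat :: "nat \<Rightarrow> nat \<Rightarrow> nat \<Rightarrow> complex mat" where
  "elem_mat n i j = mat n n (\<lambda>(k, l). if k = i \<and> l = j then 1 else 0)"

definition cartan :: "nat \<Rightarrow> complex mat set" where
  "cartan n = {x \<in> sl n. diagonal_mat x}"

text \<open>Intended for compositions \<open>A\<close> and \<open>B\<close> of \<open>n\<close>.\<close>

definition seaweed :: "nat \<Rightarrow> nat list \<Rightarrow> nat list \<Rightarrow> complex mat set" where
  "seaweed n A B = LinearCombinations.module.span class_ring (gl_space n)
     (cartan n
      \<union> {elem_mat n i j | i j. i < n \<and> j < n \<and> i > j \<and> block A i = block A j}
      \<union> {elem_mat n i j | i j. i < n \<and> j < n \<and> i < j \<and> block B i = block B j})"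

definition top_parts :: "nat \<Rightarrow> nat list" where
  "top_parts r = [60 + 4 * r]"

definition bottom_parts :: "nat \<Rightarrow> nat list" where
  "bottom_parts r = [24, 5] @ replicate r 2 @ [1] @ replicate r 2 @ [30]"

definition p_alg :: "nat \<Rightarrow> complex mat set" where
  "p_alg r = seaweed (60 + 4 * r) (top_parts r) (bottom_parts r)"

lemma composition_parts:
  "composition (60 + 4 * r) (top_parts r)" "composition (60 + 4 * r) (bottom_parts r)"
  by (auto simp: composition_def top_parts_def bottom_parts_def sum_list_replicate)

end

theory Submission
  imports "HOL-Complex_Analysis.Complex_Analysis" Defs
begin

text \<open>
  The algebra \<open>p_alg r\<close> consists of the trace-zero matrices of size \<open>n = 60 + 4 r\<close> that are block lower
  triangular for the composition \<open>B = (24, 5, 2, \<dots>, 2, 1, 2, \<dots>, 2, 30)\<close>. Three facts give the theorem.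

  \<^emph>\<open>A Frobenius functional.\<close> The meander graph joins \<open>i\<close> to its mirror image in the whole interval and
  to its mirror image in its block of \<open>B\<close>. The functional \<open>meander\<close> adds up the entries \<open>x\<^sub>i\<^sub>j\<close> of \<open>x\<close> over the
  arcs of this graph. A matrix \<open>x\<close> lies in the kernel of its Kirillov form iff its entries satisfy a
  linear system whose equations have at most four terms (\<open>kernel_eq\<close>); \<open>rigid A B\<close> says that for the
  seaweed \<open>(A | B)\<close> only scalar matrices solve the system. If the first part \<open>b\<close> of \<open>B\<close> is at most half of
  the first part \<open>a\<close> of \<open>A\<close>, then the equations at the first \<open>b\<close> indices express the entries in these rows
  and columns by the others, and what is left is the system of the smaller seaweed with
  \<open>a - 2 b, b\<close> in place of \<open>a\<close> and with \<open>b\<close> deleted (\<open>rigid_contract\<close>). Together with the symmetries of the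
  system, such contractions reduce \<open>(60 + 4 r | B)\<close> to \<open>(1 | 1)\<close>: induction on \<open>r\<close> removes the parts \<open>2\<close>
  and leaves \<open>(1, 5, 24 | 30)\<close>, which is reduced in thirteen further steps (\<open>rigid_core\<close>).

  \<^emph>\<open>Independence of the functional.\<close> Two Frobenius functionals are joined by a complex line. Away from
  countably many parameters \<open>t\<close>, Cramer's rule gives a principal element \<open>H t\<close> that is holomorphic in \<open>t\<close>,
  and differentiating its defining equation gives the Lax equation \<open>H' = [H, y]\<close> for some \<open>y\<close> in the
  algebra (\<open>exists_lax_path\<close>). Every polynomial in \<open>H\<close> satisfies the same linear equation. Hence a
  polynomial in \<open>H\<close> that vanishes at one parameter vanishes at all of them (\<open>lax_zero\<close>), and the traces of
  the diagonal blocks of a polynomial in \<open>H\<close> are constant (\<open>lax_block_trace\<close>). If the principal element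
  is a diagonal matrix with entries \<open>e\<^sub>i\<close> for one functional, then for every functional it is
  diagonalizable, with spectral projections \<open>P v\<close> whose block traces are known (\<open>spectral_family\<close>). The map
  that sends \<open>x\<close> to the sum of the \<open>P v x P u\<close> with \<open>v - u = j\<close> projects the algebra onto the principal
  component of degree \<open>j \<noteq> 0\<close>. Its trace, which is the multiplicity of \<open>j\<close>, depends only on the block traces
  and so equals the number of positions \<open>(i, k)\<close> of the algebra with \<open>e\<^sub>i - e\<^sub>k = j\<close>
  (\<open>principal_mult_eq_card\<close>).

  \<^emph>\<open>Counting.\<close> For \<open>meander\<close> the principal element is diagonal, because the vertices
  \<open>i\<close> of the meander graph carry integer labels \<open>d\<^sub>i\<close> such that \<open>d\<^sub>i - d\<^sub>j = 1\<close> for every entry \<open>x\<^sub>i\<^sub>j\<close> in the functional. The labelling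
  \<open>weights r\<close> is \<open>(1, 0)\<close> on each part \<open>2\<close> to the left of the part \<open>1\<close> and \<open>(2, 1)\<close> on each part \<open>2\<close> to the right,
  while the other parts carry labels that do not depend on \<open>r\<close>. So every multiplicity is a polynomial in \<open>r\<close> of degree at
  most two, determined by finitely many counts in fixed lists (\<open>block_hits_weights\<close>, \<open>weight_counts\<close>), and
  since all labels lie between \<open>-8\<close> and \<open>2\<close> no degree exceeds \<open>10\<close>. The parts \<open>2\<close> add \<open>19 r\<close> to the
  multiplicity of \<open>4\<close> but only \<open>16 r\<close> to that of \<open>3\<close>; their difference \<open>56 - 3 r\<close>
  is negative from \<open>r = 19\<close> on.
\<close>

section \<open>Dimensions as traces of projections\<close>

abbreviation gl :: "nat \<Rightarrow> complex mat set" where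
  "gl n \<equiv> carrier_mat n n"

lemma elem_mat_carrier [simp]: "elem_mat n i k \<in> gl n"
  by (simp add: elem_mat_def)

lemma elem_mat_index [simp]:
  "a < n \<Longrightarrow> b < n \<Longrightarrow> elem_mat n i k $$ (a, b) = (if a = i \<and> b = k then 1 else 0)"
  by (simp add: elem_mat_def)

lemma elem_mat_dim [simp]: "dim_row (elem_mat n i k) = n" "dim_col (elem_mat n i k) = n"
  by (simp_all add: elem_mat_def)

text \<open>Matrices of all dimensions share one type, which is therefore not an additive monoid; instead of being written as
  a sum of matrix units, a matrix is built up entry by entry inside a given support.\<close>

lemma mat_support_induct [consumes 3, case_names zero add]:
  assumes "x \<in> gl n" "S \<subseteq> {..<n} \<times> {..<n}"
    and "\<forall>i<n. \<forall>k<n. (i, k) \<notin> S \<longrightarrow> x $$ (i, k) = 0"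
    and "P (0\<^sub>m n n)"
    and "\<And>y c i k. y \<in> gl n \<Longrightarrow> (\<And>a b. a < n \<Longrightarrow> b < n \<Longrightarrow> (a, b) \<notin> S \<Longrightarrow> y $$ (a, b) = 0)
           \<Longrightarrow> (i, k) \<in> S \<Longrightarrow> P y \<Longrightarrow> P (y + c \<cdot>\<^sub>m elem_mat n i k)"
  shows "P (x :: complex mat)"
proof -
  have finS: "finite S" using assms(2) finite_subset by blast
  have *: "P z" if "finite T" "T \<subseteq> S" "z \<in> gl n"
    "\<And>i k. i < n \<Longrightarrow> k < n \<Longrightarrow> (i, k) \<notin> T \<Longrightarrow> z $$ (i, k) = 0" for T z
    using that
  proof (induction T arbitrary: z rule: finite_induct)
    case empty
    then have "z = 0\<^sub>m n n" by (intro eq_matI) auto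
    then show ?case using assms(4) by simp
  next
    case (insert p T)
    obtain i k where p: "p = (i, k)" by force
    have ik: "i < n" "k < n" "(i,k) \<in> S" using insert.prems p assms(2) by auto
    define y where "y = mat n n (\<lambda>q. if q = p then 0 else z $$ q)"
    have y: "y \<in> gl n" by (simp add: y_def)
    have ys: "y $$ (a, b) = 0" if "a < n" "b < n" "(a, b) \<notin> T" for a b
      using that insert.prems(3)[of a b] by (auto simp: y_def)
    have "P y" using insert.IH[of y] insert.prems y ys by auto
    moreover have "z = y + z $$ p \<cdot>\<^sub>m elem_mat n i k"
      using insert.prems(2) ik by (intro eq_matI) (auto simp: y_def p)
    ultimately show ?case
      using assms(5)[of y i k "z $$ p"] y ys ik insert.prems(1) by auto
  qed
  show ?thesis using *[OF finS order_refl assms(1)] assms(3) by blast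
qed

lemma sum_sum_delta:
  assumes "i < (n :: nat)" "k < n"
  shows "(\<Sum>a<n. \<Sum>b<n. if a = i then if b = k then c else 0 else 0) = (c :: 'a :: comm_monoid_add)"
proof -
  have "(\<Sum>b<n. if a = i then if b = k then c else 0 else 0) = (if a = i then c else 0)" for a
    using assms by (simp add: sum.delta)
  then show ?thesis using assms by (simp add: sum.delta)
qed

definition linear_on_mats :: "nat \<Rightarrow> (complex mat \<Rightarrow> complex) \<Rightarrow> bool" where
  "linear_on_mats n f \<longleftrightarrow>
     (\<forall>x\<in>gl n. \<forall>y\<in>gl n. f (x + y) = f x + f y) \<and>
     (\<forall>c. \<forall>x\<in>gl n. f (c \<cdot>\<^sub>m x) = c * f x)"

lemma linear_on_mats_expand:
  assumes "linear_on_mats n f" "x \<in> gl n"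
  shows "f x = (\<Sum>i<n. \<Sum>k<n. x $$ (i, k) * f (elem_mat n i k))"
proof -
  have "\<forall>i<n. \<forall>k<n. (i, k) \<notin> {..<n} \<times> {..<n} \<longrightarrow> x $$ (i, k) = 0" by simp
  from assms(2) order_refl this show ?thesis
  proof (induction x rule: mat_support_induct)
    case zero
    have "f (0 \<cdot>\<^sub>m 0\<^sub>m n n) = 0 * f (0\<^sub>m n n)"
      using assms(1) unfolding linear_on_mats_def by (metis zero_carrier_mat)
    then show ?case by simp
  next
    case (add y c i k)
    have ik: "i < n" "k < n" using add by auto
    have "(\<Sum>a<n. \<Sum>b<n. (y + c \<cdot>\<^sub>m elem_mat n i k) $$ (a, b) * f (elem_mat n a b))
        = (\<Sum>a<n. \<Sum>b<n. y $$ (a,b) * f (elem_mat n a b)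
             + (if a = i then if b = k then c * f (elem_mat n i k) else 0 else 0))"
      using add(1) by (intro sum.cong) (auto simp: algebra_simps)
    also have "\<dots> = f y + c * f (elem_mat n i k)"
      using add ik by (simp add: sum.distrib sum_sum_delta)
    finally show ?case using assms(1) add(1)
      unfolding linear_on_mats_def by simp
  qed
qed

lemma finsum_gl_index:
  assumes "finite S" "f \<in> S \<rightarrow> W" "W \<subseteq> gl n" "i < n" "k < n"
    and sub: "LinearCombinations.submodule class_ring W (gl_space n)"
  shows "finsum (gl_space n\<lparr>carrier := W\<rparr>) f S \<in> W \<and>
         finsum (gl_space n\<lparr>carrier := W\<rparr>) f S $$ (i, k) = (\<Sum>b\<in>S. f b $$ (i, k))"
proof -
  interpret gl: matrix_vs n n "TYPE(complex)" .
  interpret w: Module.module class_ring "gl_space n\<lparr>carrier := W\<rparr>"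
    by (rule gl.submodule_is_module[OF sub])
  show ?thesis using assms(1,2)
  proof (induction S rule: finite_induct)
    case empty
    then show ?case using w.M.zero_closed assms by (auto simp: module_mat_simps)
  next
    case (insert b S)
    have "finsum (gl_space n\<lparr>carrier := W\<rparr>) f (insert b S)
       = f b + finsum (gl_space n\<lparr>carrier := W\<rparr>) f S"
      using insert by (subst w.M.finsum_insert) (auto simp: module_mat_simps)
    moreover have "f b + finsum (gl_space n\<lparr>carrier := W\<rparr>) f S \<in> W"
      using w.M.a_closed[of "f b" "finsum (gl_space n\<lparr>carrier := W\<rparr>) f S"] insert
      by (auto simp: module_mat_simps)
    moreover have "f b \<in> gl n" "finsum (gl_space n\<lparr>carrier := W\<rparr>) f S \<in> gl n"
      using insert assms(3) by auto
    ultimately show ?case using insert assms(4,5) by auto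
  qed
qed

lemma submodule_glI:
  assumes "W \<subseteq> gl n" "0\<^sub>m n n \<in> W" "\<And>x y. x \<in> W \<Longrightarrow> y \<in> W \<Longrightarrow> x + y \<in> W"
    "\<And>c x. x \<in> W \<Longrightarrow> c \<cdot>\<^sub>m x \<in> W"
  shows "LinearCombinations.submodule class_ring W (gl_space n)"
proof -
  interpret gl: matrix_vs n n "TYPE(complex)" .
  have "Module.module class_ring (gl_space n)" ..
  then show ?thesis
    using assms by (intro LinearCombinations.submodule.intro) (auto simp: module_mat_simps)
qed

text \<open>In coordinates with respect to a basis of \<open>W\<close>, the projection is the coordinate map \<open>\<kappa> \<circ> \<pi>\<close> followed by
  the inclusion of \<open>W\<close>. The trace of a product of two linear maps does not depend on their order, and the
  product in the other order is the identity of the coordinate space, whose trace is the dimension.\<close>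

lemma cdim_eq_trace_projection:
  assumes carr: "\<And>x. x \<in> gl n \<Longrightarrow> \<pi> x \<in> W" and W: "W \<subseteq> gl n"
    and add: "\<And>x y. x \<in> gl n \<Longrightarrow> y \<in> gl n \<Longrightarrow> \<pi> (x + y) = \<pi> x + \<pi> y"
    and smult: "\<And>c x. x \<in> gl n \<Longrightarrow> \<pi> (c \<cdot>\<^sub>m x) = c \<cdot>\<^sub>m \<pi> x"
    and fixd: "\<And>x. x \<in> W \<Longrightarrow> \<pi> x = x"
  shows "of_nat (cdim n W) = (\<Sum>i<n. \<Sum>k<n. \<pi> (elem_mat n i k) $$ (i, k))"
proof -
  interpret gl: matrix_vs n n "TYPE(complex)" .
  have pi0: "\<pi> (0\<^sub>m n n) = 0\<^sub>m n n"
    using smult[of "0\<^sub>m n n" 0] carr[of "0\<^sub>m n n"] W by (auto intro!: eq_matI)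
  have Wadd: "x + y \<in> W" if "x \<in> W" "y \<in> W" for x y
    using that W add[of x y] fixd[of x] fixd[of y] carr[of "x + y"] by (metis add_carrier_mat subsetD)
  have Wsm: "c \<cdot>\<^sub>m x \<in> W" if "x \<in> W" for x c
    using that W smult[of x c] fixd[of x] carr[of "c \<cdot>\<^sub>m x"] by (metis smult_carrier_mat subsetD)
  have sub: "LinearCombinations.submodule class_ring W (gl_space n)"
    using W carr[of "0\<^sub>m n n"] pi0 Wadd Wsm by (intro submodule_glI) auto
  let ?W = "gl_space n\<lparr>carrier := W\<rparr>"
  have "VectorSpace.subspace class_ring W (gl_space n)"
    using sub gl.vectorspace_axioms by (simp add: VectorSpace.subspace_def)
  then have vs: "vectorspace class_ring ?W" by (rule gl.subspace_is_vs)
  interpret w: vectorspace class_ring ?W by (rule vs)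
  define S where "S = (\<lambda>(i, k). \<pi> (elem_mat n i k)) ` ({..<n} \<times> {..<n})"
  have SW: "S \<subseteq> W" "finite S" unfolding S_def using carr by auto
  have subS: "LinearCombinations.submodule class_ring (w.span S) ?W"
    using w.span_is_submodule[of S] SW by simp
  have pis: "\<pi> x \<in> w.span S" if "x \<in> gl n" for x
  proof -
    have "\<forall>i<n. \<forall>k<n. (i, k) \<notin> {..<n} \<times> {..<n} \<longrightarrow> x $$ (i, k) = 0" by simp
    from that order_refl this show ?thesis
    proof (induction x rule: mat_support_induct)
      case zero
      then show ?case using LinearCombinations.submodule.zero_closed[OF subS] pi0
        by (simp add: module_mat_simps)
    next
      case (add y c i k)
      have "\<pi> (elem_mat n i k) \<in> w.span S"
        using w.in_own_span[of S] SW add by (force simp: S_def)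
      then show ?case
        using LinearCombinations.submodule.m_closed[OF subS, of "\<pi> y" "c \<cdot>\<^sub>m \<pi> (elem_mat n i k)"]
          LinearCombinations.submodule.smult_closed[OF subS, of c "\<pi> (elem_mat n i k)"] add
        by (simp add: module_mat_simps assms(3) smult)
    qed
  qed
  have "W \<subseteq> w.span S"
  proof
    fix x assume "x \<in> W"
    then show "x \<in> w.span S" using pis[of x] fixd[of x] W by auto
  qed
  moreover have "w.span S \<subseteq> W" using w.span_is_subset2[of S] SW by simp
  ultimately have "w.fin_dim" unfolding w.fin_dim_def using SW by (intro exI[of _ S]) auto
  then obtain B where B: "finite B" "w.basis B" using w.finite_basis_exists by blast
  have BW: "B \<subseteq> W" using B(2) by (simp add: w.basis_def)
  have dim: "cdim n W = card B" unfolding cdim_def using w.dim_basis[OF B] .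
  have crit: "\<exists>!a. a \<in> B \<rightarrow>\<^sub>E (UNIV :: complex set) \<and> w.lincomb a B = v" if "v \<in> W" for v
    using w.basis_criterion[OF B(1)] B(2) BW that by simp
  define \<kappa> where "\<kappa> v = (THE a. a \<in> B \<rightarrow>\<^sub>E (UNIV :: complex set) \<and> w.lincomb a B = v)" for v
  have kap: "\<kappa> v \<in> B \<rightarrow>\<^sub>E UNIV" "w.lincomb (\<kappa> v) B = v" if "v \<in> W" for v
    using theI'[OF crit[OF that]] by (auto simp: \<kappa>_def)
  have kapI: "\<kappa> v = a" if "v \<in> W" "a \<in> B \<rightarrow>\<^sub>E UNIV" "w.lincomb a B = v" for v a
    unfolding \<kappa>_def using crit[OF that(1)] that by (intro the1_equality) auto
  have lc_index: "w.lincomb a B $$ (i, k) = (\<Sum>b\<in>B. a b * b $$ (i, k))"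
    if "i < n" "k < n" for a i k
  proof -
    have "w.lincomb a B $$ (i, k) = (\<Sum>b\<in>B. (a b \<cdot>\<^sub>m b) $$ (i, k))"
      unfolding w.lincomb_def
      using finsum_gl_index[OF B(1), of "\<lambda>b. a b \<cdot>\<^sub>m b" W n i k] that BW W Wsm sub
      by (auto simp: module_mat_simps)
    also have "\<dots> = (\<Sum>b\<in>B. a b * b $$ (i, k))"
      using BW W that by (intro sum.cong) auto
    finally show ?thesis .
  qed
  have lc_W: "w.lincomb a B \<in> W" for a
    using w.lincomb_closed[of B a] BW by auto
  have lc_eqI: "w.lincomb a B = v"
    if "v \<in> W" "\<And>i k. i < n \<Longrightarrow> k < n \<Longrightarrow> (\<Sum>b\<in>B. a b * b $$ (i, k)) = v $$ (i, k)" for a v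
  proof -
    have "v \<in> gl n" "w.lincomb a B \<in> gl n"
      using that(1) lc_W[of a] W by blast+
    then show ?thesis using that(2) lc_index by (intro eq_matI) auto
  qed
  have kap_add: "\<kappa> (u + v) b = \<kappa> u b + \<kappa> v b" if "u \<in> W" "v \<in> W" "b \<in> B" for u v b
  proof -
    have "\<kappa> (u + v) = restrict (\<lambda>b. \<kappa> u b + \<kappa> v b) B"
    proof (rule kapI)
      show "w.lincomb (restrict (\<lambda>b. \<kappa> u b + \<kappa> v b) B) B = u + v"
      proof (rule lc_eqI)
        fix i k assume ik: "i < n" "k < n"
        then show "(\<Sum>b\<in>B. restrict (\<lambda>b. \<kappa> u b + \<kappa> v b) B b * b $$ (i, k)) = (u + v) $$ (i, k)"
          using lc_index[OF ik, of "\<kappa> u"] lc_index[OF ik, of "\<kappa> v"] kap that(1,2) W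
          by (auto simp: algebra_simps sum.distrib)
      qed (use that Wadd in auto)
    qed (use that Wadd in auto)
    then show ?thesis using that by simp
  qed
  have kap_sm: "\<kappa> (c \<cdot>\<^sub>m v) b = c * \<kappa> v b" if "v \<in> W" "b \<in> B" for c v b
  proof -
    have "\<kappa> (c \<cdot>\<^sub>m v) = restrict (\<lambda>b. c * \<kappa> v b) B"
    proof (rule kapI)
      show "w.lincomb (restrict (\<lambda>b. c * \<kappa> v b) B) B = c \<cdot>\<^sub>m v"
      proof (rule lc_eqI)
        fix i k assume ik: "i < n" "k < n"
        then show "(\<Sum>b\<in>B. restrict (\<lambda>b. c * \<kappa> v b) B b * b $$ (i, k)) = (c \<cdot>\<^sub>m v) $$ (i, k)"
          using lc_index[OF ik, of "\<kappa> v"] kap that(1) W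
          by (auto simp: algebra_simps sum_distrib_left)
      qed (use that Wsm in auto)
    qed (use that Wsm in auto)
    then show ?thesis using that by simp
  qed
  have kap_base: "\<kappa> b b = 1" if "b \<in> B" for b
  proof -
    have "\<kappa> b = restrict (\<lambda>b'. if b' = b then 1 else 0) B"
    proof (rule kapI)
      show "w.lincomb (restrict (\<lambda>b'. if b' = b then 1 else 0) B) B = b"
        using that BW B(1) by (intro lc_eqI) (auto simp: if_distrib[where f = "\<lambda>x. x * _"] cong: if_cong)
    qed (use that BW in auto)
    then show ?thesis using that by simp
  qed
  have lin: "linear_on_mats n (\<lambda>x. \<kappa> (\<pi> x) b)" if "b \<in> B" for b
    unfolding linear_on_mats_def using that add smult carr kap_add kap_sm by simp
  have "(\<Sum>i<n. \<Sum>k<n. \<pi> (elem_mat n i k) $$ (i, k))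
      = (\<Sum>i<n. \<Sum>k<n. \<Sum>b\<in>B. b $$ (i, k) * \<kappa> (\<pi> (elem_mat n i k)) b)"
  proof (intro sum.cong refl)
    fix i k assume "i \<in> {..<n}" "k \<in> {..<n}"
    then show "\<pi> (elem_mat n i k) $$ (i, k) = (\<Sum>b\<in>B. b $$ (i, k) * \<kappa> (\<pi> (elem_mat n i k)) b)"
      using lc_index[of i k "\<kappa> (\<pi> (elem_mat n i k))"] kap(2)[OF carr[OF elem_mat_carrier]]
      by (simp add: mult.commute)
  qed
  also have "\<dots> = (\<Sum>b\<in>B. \<Sum>i<n. \<Sum>k<n. b $$ (i, k) * \<kappa> (\<pi> (elem_mat n i k)) b)"
    by (subst sum.swap[of _ B], subst sum.swap[of _ B]) simp
  also have "\<dots> = (\<Sum>b\<in>B. \<kappa> (\<pi> b) b)"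
  proof (intro sum.cong refl)
    fix b assume b: "b \<in> B"
    then have "b \<in> gl n" using BW W by blast
    from linear_on_mats_expand[OF lin[OF b] this]
    show "(\<Sum>i<n. \<Sum>k<n. b $$ (i, k) * \<kappa> (\<pi> (elem_mat n i k)) b) = \<kappa> (\<pi> b) b" by (rule sym)
  qed
  also have "\<dots> = (\<Sum>b\<in>B. 1)"
    using kap_base fixd BW by (intro sum.cong) auto
  finally show ?thesis using dim by simp
qed

section \<open>Linear systems and differential equations with holomorphic coefficients\<close>

lemma holomorphic_det:
  assumes "\<And>t. G t \<in> carrier_mat N N"
    and "\<And>i k. i < N \<Longrightarrow> k < N \<Longrightarrow> (\<lambda>t. G t $$ (i, k)) holomorphic_on UNIV"
  shows "(\<lambda>t. Determinant.det (G t)) holomorphic_on UNIV"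
proof -
  have "Determinant.det (G t) = (\<Sum>p | p permutes {0..<N}. signof p * (\<Prod>i = 0..<N. G t $$ (i, p i)))" for t
    using det_def'[OF assms(1)] .
  moreover have "(\<lambda>t. \<Sum>p | p permutes {0..<N}. signof p * (\<Prod>i = 0..<N. G t $$ (i, p i))) holomorphic_on UNIV"
    by (intro holomorphic_intros assms(2)) (auto simp: permutes_in_image dest: permutes_in_image[THEN iffD2])
  ultimately show ?thesis by simp
qed

text \<open>Cramer's rule: on the set \<open>D\<close> where the system is nonsingular, the solution is the adjugate applied to
  the right-hand side, divided by the determinant \<open>\<delta>\<close>. The complement of \<open>D\<close> is the zero set of the entire function
  \<open>\<delta>\<close>, hence countable, and removing it leaves the plane connected.\<close>

lemma holomorphic_linear_system:
  fixes M :: "'i \<Rightarrow> 'i \<Rightarrow> complex \<Rightarrow> complex"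
  assumes I: "finite I" and M: "\<And>p q. p \<in> I \<Longrightarrow> q \<in> I \<Longrightarrow> M p q holomorphic_on UNIV"
    and D: "D = {t. \<forall>v. (\<forall>p\<in>I. (\<Sum>q\<in>I. M p q t * v q) = 0) \<longrightarrow> (\<forall>q\<in>I. v q = 0)}"
    and "t0 \<in> D"
  shows "open D" "connected D"
    and "\<And>b. (\<And>p. p \<in> I \<Longrightarrow> b p holomorphic_on UNIV) \<Longrightarrow>
      \<exists>u. (\<forall>q\<in>I. u q holomorphic_on D) \<and> (\<forall>t\<in>D. \<forall>p\<in>I. (\<Sum>q\<in>I. M p q t * u q t) = b p t)"
proof -
  obtain h where h: "bij_betw h {0..<card I} I" using ex_bij_betw_nat_finite[OF I] by blast
  define N where "N = card I"
  have hI: "h i \<in> I" if "i < N" for i using h that unfolding bij_betw_def N_def by auto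
  have sumI: "(\<Sum>q\<in>I. f q) = (\<Sum>j=0..<N. f (h j))" for f :: "'i \<Rightarrow> complex"
    using sum.reindex_bij_betw[OF h, of f] by (simp add: N_def)
  have exI': "\<exists>j<N. q = h j" if "q \<in> I" for q
    proof -
    have "q \<in> h ` {0..<N}" using h that unfolding bij_betw_def N_def by simp
    then show ?thesis by auto
  qed
  define G where "G t = mat N N (\<lambda>(i, j). M (h i) (h j) t)" for t
  have G: "G t \<in> carrier_mat N N" for t by (simp add: G_def)
  have Gh: "(\<lambda>t. G t $$ (i, k)) holomorphic_on UNIV" if "i < N" "k < N" for i k
    using that M[OF hI hI, of i k] by (simp add: G_def)
  define \<delta> where "\<delta> t = Determinant.det (G t)" for t
  have dh: "\<delta> holomorphic_on UNIV" using holomorphic_det[OF G Gh] by (simp add: \<delta>_def[abs_def])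
  have mv: "vec_index (G t *\<^sub>v v) i = (\<Sum>j=0..<N. M (h i) (h j) t * vec_index v j)" if "i < N" "v \<in> carrier_vec N" for i v t
    using that by (auto simp: G_def scalar_prod_def)
  have D': "t \<in> D \<longleftrightarrow> \<delta> t \<noteq> 0" for t
  proof
    assume t: "t \<in> D"
    show "\<delta> t \<noteq> 0"
    proof
      assume "\<delta> t = 0"
      then obtain v where v: "v \<in> carrier_vec N" "v \<noteq> 0\<^sub>v N" "G t *\<^sub>v v = 0\<^sub>v N"
        using det_0_iff_vec_prod_zero[OF G] unfolding \<delta>_def by blast
      define w where "w q = vec_index v (inv_into {0..<N} h q)" for q
      have hinj: "inj_on h {0..<N}" using h by (simp add: bij_betw_def N_def)
      have w: "w (h j) = vec_index v j" if "j < N" for j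
        using inv_into_f_f[OF hinj, of j] that by (simp add: w_def)
      have "(\<Sum>q\<in>I. M p q t * w q) = 0" if p: "p \<in> I" for p
      proof -
        obtain i where i: "i < N" "p = h i" using exI'[OF p] by blast
        have "(\<Sum>q\<in>I. M p q t * w q) = (\<Sum>j=0..<N. M (h i) (h j) t * vec_index v j)"
          unfolding sumI i(2) by (intro sum.cong) (auto simp: w)
        also have "\<dots> = vec_index (G t *\<^sub>v v) i" using mv[OF i(1) v(1)] by simp
        finally show ?thesis using v(3) i by simp
      qed
      then have "\<forall>q\<in>I. w q = 0" using t unfolding D by blast
      then have "vec_index v j = 0" if "j < N" for j using w[OF that] hI[OF that] by simp
      then have "v = 0\<^sub>v N" using v(1) by (intro eq_vecI) auto
      then show False using v(2) by simp
    qed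
  next
    assume d: "\<delta> t \<noteq> 0"
    have "v q = 0" if v: "\<forall>p\<in>I. (\<Sum>q\<in>I. M p q t * v q) = 0" "q \<in> I" for v q
    proof -
      define w where "w = vec N (\<lambda>j. v (h j))"
      have w: "w \<in> carrier_vec N" by (simp add: w_def)
      have "G t *\<^sub>v w = 0\<^sub>v N"
      proof (rule eq_vecI)
        fix i assume "i < dim_vec (0\<^sub>v N :: complex Matrix.vec)"
        then have i: "i < N" by simp
        have "vec_index (G t *\<^sub>v w) i = (\<Sum>j=0..<N. M (h i) (h j) t * v (h j))"
          unfolding mv[OF i w] by (intro sum.cong) (auto simp: w_def)
        also have "\<dots> = 0" using v(1) hI[OF i] unfolding sumI by simp
        finally show "vec_index (G t *\<^sub>v w) i = vec_index (0\<^sub>v N) i" using i by simp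
      qed (simp add: G_def)
      then have "w = 0\<^sub>v N" using det_0_iff_vec_prod_zero[OF G] d w unfolding \<delta>_def by blast
      moreover obtain j where "j < N" "q = h j" using exI'[OF v(2)] by blast
      ultimately show "v q = 0" by (metis w_def index_vec index_zero_vec(1))
    qed
    then show "t \<in> D" unfolding D by blast
  qed
  have Deq: "D = UNIV - {t. \<delta> t = 0}" using D' by auto
  have cont: "continuous_on UNIV \<delta>" using dh by (rule holomorphic_on_imp_continuous_on)
  have cl: "closed {t. \<delta> t = 0}"
    by (rule closed_Collect_eq[OF cont continuous_on_const])
  show "open D" unfolding Deq using cl by (simp add: open_Diff)
  have "countable {t. \<delta> t = 0}"
  proof (cases "\<delta> constant_on UNIV")
    case True
    then have "{t. \<delta> t = 0} = {}" using D' assms(4) by (auto simp: constant_on_def)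
    then show ?thesis by simp
  next
    case False
    then show ?thesis using holomorphic_countable_zeros[OF dh] by (simp add: connected_UNIV)
  qed
  then show "connected D"
    unfolding Deq by (intro connected_open_diff_countable) auto
  fix b :: "'i \<Rightarrow> complex \<Rightarrow> complex"
  assume b: "\<And>p. p \<in> I \<Longrightarrow> b p holomorphic_on UNIV"
  define u where "u q t = (\<Sum>k=0..<N. adj_mat (G t) $$ (inv_into {0..<N} h q, k) * b (h k) t) / \<delta> t" for q t
  have hinj: "inj_on h {0..<N}" using h by (simp add: bij_betw_def N_def)
  have inv: "inv_into {0..<N} h (h j) = j" if "j < N" for j
    using inv_into_f_f[OF hinj, of j] that by simp
  have cof: "(\<lambda>t. adj_mat (G t) $$ (j, k)) holomorphic_on UNIV" if jk: "j < N" "k < N" for j k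
  proof -
    have e: "adj_mat (G t) $$ (j, k) = (-1) ^ (k + j) * Determinant.det (mat_delete (G t) k j)" for t
      using jk by (simp add: adj_mat_def cofactor_def G_def)
    have "(\<lambda>t. mat_delete (G t) k j $$ (i', k')) holomorphic_on UNIV"
      if "i' < N - 1" "k' < N - 1" for i' k'
    proof -
      have "mat_delete (G t) k j $$ (i', k') =
        G t $$ (if i' < k then i' else Suc i', if k' < j then k' else Suc k')" for t
        using that unfolding mat_delete_def by (simp add: G_def)
      then show ?thesis using Gh that by (auto simp: less_diff_conv)
    qed
    moreover have "mat_delete (G t) k j \<in> carrier_mat (N - 1) (N - 1)" for t
      by (simp add: mat_delete_def G_def)
    ultimately show ?thesis unfolding e
      by (intro holomorphic_intros holomorphic_det[where N = "N - 1"]) auto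
  qed
  have "u q holomorphic_on D" if qI: "q \<in> I" for q
  proof -
    obtain j where j: "j < N" "q = h j" using exI'[OF qI] by blast
    show ?thesis unfolding u_def[abs_def] j(2) inv[OF j(1)]
      by (intro holomorphic_intros holomorphic_on_subset[OF cof[OF j(1)]]
            holomorphic_on_subset[OF b] holomorphic_on_subset[OF dh]) (use D' hI in auto)
  qed
  moreover have "(\<Sum>q\<in>I. M p q t * u q t) = b p t" if t: "t \<in> D" and p: "p \<in> I" for p t
  proof -
    obtain i where i: "i < N" "p = h i" using exI'[OF p] by blast
    have dt: "\<delta> t \<noteq> 0" using D' t by blast
    have "(\<Sum>q\<in>I. M p q t * u q t) = (\<Sum>j=0..<N. M (h i) (h j) t *
        ((\<Sum>k=0..<N. adj_mat (G t) $$ (j, k) * b (h k) t) / \<delta> t))"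
      unfolding sumI i(2) by (intro sum.cong) (auto simp: u_def inv)
    also have "\<dots> = (\<Sum>k=0..<N. (\<Sum>j=0..<N. M (h i) (h j) t * adj_mat (G t) $$ (j, k)) * b (h k) t) / \<delta> t"
      unfolding sum_divide_distrib sum_distrib_left sum_distrib_right
      by (subst sum.swap) (simp add: mult_ac)
    also have "\<dots> = (\<Sum>k=0..<N. (if i = k then \<delta> t else 0) * b (h k) t) / \<delta> t"
    proof -
      have "(\<Sum>j=0..<N. M (h i) (h j) t * adj_mat (G t) $$ (j, k)) = (if i = k then \<delta> t else 0)"
        if k: "k < N" for k
      proof -
        have "(G t * adj_mat (G t)) $$ (i, k) = (\<delta> t \<cdot>\<^sub>m 1\<^sub>m N) $$ (i, k)"
          using adj_mat(2)[OF G] by (simp add: \<delta>_def)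
        then show ?thesis using i k adj_mat(1)[OF G, of t]
          by (auto simp: G_def scalar_prod_def)
      qed
      then show ?thesis by simp
    qed
    also have "\<dots> = b p t" using i dt
      by (simp add: if_distrib[where f = "\<lambda>x. x * _"] cong: if_cong)
    finally show ?thesis .
  qed
  ultimately show "\<exists>u. (\<forall>q\<in>I. u q holomorphic_on D) \<and>
      (\<forall>t\<in>D. \<forall>p\<in>I. (\<Sum>q\<in>I. M p q t * u q t) = b p t)" by blast
qed

text \<open>Differentiating the equation repeatedly shows that every derivative of \<open>v i\<close> is a combination of the
  functions \<open>v k\<close> themselves, so all derivatives vanish at \<open>t0\<close> and the identity theorem applies.\<close>

lemma linear_ode_zero:
  fixes v :: "'i \<Rightarrow> complex \<Rightarrow> complex"
  assumes "finite I" and D: "open D" "connected D"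
    and a: "\<And>i k. i \<in> I \<Longrightarrow> k \<in> I \<Longrightarrow> a i k holomorphic_on D"
    and ode: "\<And>i t. i \<in> I \<Longrightarrow> t \<in> D \<Longrightarrow> (v i has_field_derivative (\<Sum>k\<in>I. a i k t * v k t)) (at t)"
    and t0: "t0 \<in> D" "\<And>i. i \<in> I \<Longrightarrow> v i t0 = 0"
    and "i \<in> I" "t \<in> D"
  shows "v i t = 0"
proof -
  have vh: "v i holomorphic_on D" if "i \<in> I" for i
    using ode[OF that] D(1) unfolding holomorphic_on_open[OF D(1)] by blast
  \<comment> \<open>The coefficients arise by differentiating under the sum and substituting the equation.\<close>
  have derivs: "\<exists>c. (\<forall>k\<in>I. c k holomorphic_on D) \<and> (\<forall>t\<in>D. (deriv ^^ m) (v i) t = (\<Sum>k\<in>I. c k t * v k t))" for m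
  proof (induction m)
    case 0
    show ?case
      by (rule exI[of _ "\<lambda>k t. if k = i then 1 else 0"])
         (use assms(1,8) in \<open>auto simp: if_distrib[where f = "\<lambda>x. x * _"] cong: if_cong\<close>)
  next
    case (Suc m)
    then obtain c where c: "\<And>k. k \<in> I \<Longrightarrow> c k holomorphic_on D"
      "\<And>t. t \<in> D \<Longrightarrow> (deriv ^^ m) (v i) t = (\<Sum>k\<in>I. c k t * v k t)" by blast
    define c' where "c' l t = deriv (c l) t + (\<Sum>k\<in>I. c k t * a k l t)" for l t
    have "c' l holomorphic_on D" if "l \<in> I" for l
      unfolding c'_def[abs_def] using that c(1) a D(1) by (intro holomorphic_intros) auto
    moreover have "(deriv ^^ Suc m) (v i) t = (\<Sum>l\<in>I. c' l t * v l t)" if t: "t \<in> D" for t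
    proof -
      have d: "((\<lambda>t. \<Sum>k\<in>I. c k t * v k t) has_field_derivative
          (\<Sum>k\<in>I. deriv (c k) t * v k t + (\<Sum>l\<in>I. a k l t * v l t) * c k t)) (at t)"
        using c(1) ode t by (intro DERIV_sum DERIV_mult holomorphic_derivI[OF _ D(1)]) auto
      have ev: "eventually (\<lambda>s. (\<Sum>k\<in>I. c k s * v k s) = (deriv ^^ m) (v i) s) (nhds t)"
        using eventually_nhds_in_open[OF D(1) t] by eventually_elim (use c(2) in auto)
      have "((deriv ^^ m) (v i) has_field_derivative
          (\<Sum>k\<in>I. deriv (c k) t * v k t + (\<Sum>l\<in>I. a k l t * v l t) * c k t)) (at t)"
        by (rule DERIV_cong_ev[OF refl ev refl, THEN iffD1, OF d])
      then have "(deriv ^^ Suc m) (v i) t =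
          (\<Sum>k\<in>I. deriv (c k) t * v k t + (\<Sum>l\<in>I. a k l t * v l t) * c k t)"
        by (simp add: DERIV_imp_deriv)
      also have "\<dots> = (\<Sum>l\<in>I. c' l t * v l t)"
      proof -
        have "(\<Sum>k\<in>I. (\<Sum>l\<in>I. a k l t * v l t) * c k t) = (\<Sum>l\<in>I. (\<Sum>k\<in>I. c k t * a k l t) * v l t)"
          unfolding sum_distrib_right by (subst sum.swap) (simp add: mult_ac)
        then show ?thesis by (simp add: c'_def sum.distrib distrib_right)
      qed
      finally show ?thesis .
    qed
    ultimately show ?case by (intro exI[of _ c']) auto
  qed
  have "(deriv ^^ m) (v i) t0 = 0" for m
  proof -
    from derivs[of m] obtain c where "(\<forall>k\<in>I. c k holomorphic_on D) \<and>
        (\<forall>t\<in>D. (deriv ^^ m) (v i) t = (\<Sum>k\<in>I. c k t * v k t))" by (rule exE)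
    then show ?thesis using t0 by simp
  qed
  then show ?thesis
    using holomorphic_fun_eq_0_on_connected[OF vh[OF assms(8)] D _ t0(1) assms(9)] by blast
qed

section \<open>Brackets and block triangular matrices\<close>

lemma mult_index_sum:
  assumes "x \<in> gl n" "y \<in> gl n" "i < n" "k < n"
  shows "(x * y) $$ (i, k) = (\<Sum>l<n. x $$ (i, l) * y $$ (l, k))"
  using assms by (auto simp: scalar_prod_def atLeast0LessThan)

lemma eq_mat_carrierI:
  assumes "a \<in> gl n" "b \<in> gl n"
    "\<And>i k. i < n \<Longrightarrow> k < n \<Longrightarrow> a $$ (i, k) = b $$ (i, k)"
  shows "a = b"
  using assms by (intro eq_matI) auto

lemma linear_on_mats_add:
  assumes "linear_on_mats n f" "x \<in> gl n" "y \<in> gl n"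
  shows "f (x + y) = f x + f y"
  using assms unfolding linear_on_mats_def by blast

lemma linear_on_mats_smult:
  assumes "linear_on_mats n f" "x \<in> gl n"
  shows "f (c \<cdot>\<^sub>m x) = c * f x"
  using assms unfolding linear_on_mats_def by blast

lemma linear_on_mats_minus:
  assumes "linear_on_mats n f" "x \<in> gl n" "y \<in> gl n"
  shows "f (x - y) = f x - f y"
proof -
  have "x - y = x + (- 1) \<cdot>\<^sub>m y" using assms by (intro eq_mat_carrierI[of _ n]) auto
  then show ?thesis
    using assms by (simp add: linear_on_mats_add linear_on_mats_smult)
qed

lemma linear_on_mats_zero: "linear_on_mats n f \<Longrightarrow> f (0\<^sub>m n n) = 0"
  using linear_on_mats_smult[of n f "0\<^sub>m n n" 0] by simp

lemma lie_bracket_carrier [simp]: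
  "x \<in> gl n \<Longrightarrow> y \<in> gl n \<Longrightarrow> lie_bracket x y \<in> gl n"
  unfolding lie_bracket_def by (metis minus_carrier_mat mult_carrier_mat)

lemma lie_bracket_index:
  assumes "x \<in> gl n" "y \<in> gl n" "i < n" "k < n"
  shows "lie_bracket x y $$ (i, k) = (\<Sum>l<n. x $$ (i, l) * y $$ (l, k)) - (\<Sum>l<n. y $$ (i, l) * x $$ (l, k))"
proof -
  have "y * x \<in> gl n" using assms by auto
  then have "lie_bracket x y $$ (i, k) = (x * y) $$ (i, k) - (y * x) $$ (i, k)"
    using assms unfolding lie_bracket_def by (intro index_minus_mat) auto
  then show ?thesis
    unfolding mult_index_sum[OF assms(1,2,3,4)] mult_index_sum[OF assms(2,1,3,4)] .
qed

lemma lie_bracket_add_left: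
  assumes "x \<in> gl n" "x' \<in> gl n" "y \<in> gl n"
  shows "lie_bracket (x + x') y = lie_bracket x y + lie_bracket x' y"
  using assms by (intro eq_mat_carrierI[of _ n])
    (simp_all add: lie_bracket_index[where n = n] sum.distrib algebra_simps
       carrier_matD[OF lie_bracket_carrier])

lemma lie_bracket_smult_left:
  assumes "x \<in> gl n" "y \<in> gl n"
  shows "lie_bracket (c \<cdot>\<^sub>m x) y = c \<cdot>\<^sub>m lie_bracket x y"
  using assms by (intro eq_mat_carrierI[of _ n])
    (simp_all add: lie_bracket_index[where n = n] sum_distrib_left algebra_simps
       carrier_matD[OF lie_bracket_carrier])

lemma lie_bracket_minus_left:
  assumes "x \<in> gl n" "x' \<in> gl n" "y \<in> gl n"
  shows "lie_bracket (x - x') y = lie_bracket x y - lie_bracket x' y"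
proof -
  have minus: "a - b = a + (- 1) \<cdot>\<^sub>m b" if "a \<in> gl n" "b \<in> gl n" for a b :: "complex mat"
    using that by (intro eq_mat_carrierI[of _ n]) auto
  show ?thesis
    using assms by (simp add: minus lie_bracket_add_left[where n = n] lie_bracket_smult_left[where n = n])
qed

lemma lie_bracket_add_right:
  assumes "x \<in> gl n" "y \<in> gl n" "y' \<in> gl n"
  shows "lie_bracket x (y + y') = lie_bracket x y + lie_bracket x y'"
  using assms by (intro eq_mat_carrierI[of _ n])
    (simp_all add: lie_bracket_index[where n = n] sum.distrib algebra_simps
       carrier_matD[OF lie_bracket_carrier])

lemma lie_bracket_smult_right:
  assumes "x \<in> gl n" "y \<in> gl n"
  shows "lie_bracket x (c \<cdot>\<^sub>m y) = c \<cdot>\<^sub>m lie_bracket x y"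
  using assms by (intro eq_mat_carrierI[of _ n])
    (simp_all add: lie_bracket_index[where n = n] sum_distrib_left algebra_simps
       carrier_matD[OF lie_bracket_carrier])

lemma lie_bracket_one [simp]:
  assumes "x \<in> gl n"
  shows "lie_bracket x (1\<^sub>m n) = 0\<^sub>m n n" "lie_bracket (1\<^sub>m n) x = 0\<^sub>m n n"
  using assms unfolding lie_bracket_def by (auto intro!: eq_matI)

lemma lie_bracket_jacobi:
  assumes "h \<in> gl n" "y \<in> gl n" "x \<in> gl n"
  shows "lie_bracket (lie_bracket h y) x = lie_bracket h (lie_bracket y x) - lie_bracket y (lie_bracket h x)"
proof -
  have d: "(p - q) * r = p * r - q * r" "r * (p - q) = r * p - r * q"
    if "p \<in> gl n" "q \<in> gl n" "r \<in> gl n" for p q r :: "complex mat"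
    using that by (auto intro: minus_mult_distrib_mat mult_minus_distrib_mat)
  have a: "(p * q) * r = p * (q * r)"
    if "p \<in> gl n" "q \<in> gl n" "r \<in> gl n" for p q r :: "complex mat"
    using that by (rule assoc_mult_mat)
  have c: "p * q \<in> gl n"
    if "p \<in> gl n" "q \<in> gl n" for p q :: "complex mat"
    using that by (rule mult_carrier_mat)
  have cancel: "(A - B) - (C - D) = ((A - E) - (G - D)) - ((B - G) - (E - C))"
    if "A \<in> gl n" "B \<in> gl n" "C \<in> gl n"
      "D \<in> gl n" "E \<in> gl n" "G \<in> gl n" for A B C D E G :: "complex mat"
    using that by (intro eq_mat_carrierI[of _ n]) auto
  show ?thesis unfolding lie_bracket_def
    using cancel[of "h * (y * x)" "y * (h * x)" "x * (h * y)" "x * (y * h)" "h * (x * y)" "y * (x * h)"] assms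
    by (simp add: d c a)
qed

text \<open>The associative algebra of matrices that are block lower triangular with respect to a numbering \<open>blk\<close>
  of the blocks, and its trace-zero part.\<close>

locale block_triangular =
  fixes n :: nat and blk :: "nat \<Rightarrow> nat"
  assumes n_pos: "0 < n"
begin

definition pos :: "(nat \<times> nat) set" where
  "pos = {(i, k). i < n \<and> k < n \<and> blk k \<le> blk i}"

definition alg :: "complex mat set" where
  "alg = {x \<in> gl n. \<forall>i<n. \<forall>k<n. (i, k) \<notin> pos \<longrightarrow> x $$ (i, k) = 0}"

definition tr :: "complex mat \<Rightarrow> complex" where
  "tr x = (\<Sum>i<n. x $$ (i, i))"

definition salg :: "complex mat set" where
  "salg = {x \<in> alg. tr x = 0}"

definition block_trace :: "nat \<Rightarrow> complex mat \<Rightarrow> complex" where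
  "block_trace p x = (\<Sum>i | i < n \<and> blk i = p. x $$ (i, i))"

lemma finite_pos [simp]: "finite pos"
  by (rule finite_subset[of _ "{..<n} \<times> {..<n}"]) (auto simp: pos_def)

lemma alg_carrier: "x \<in> alg \<Longrightarrow> x \<in> gl n"
  and salg_alg: "x \<in> salg \<Longrightarrow> x \<in> alg"
  by (auto simp: alg_def salg_def)

lemma alg_zero: "x \<in> alg \<Longrightarrow> i < n \<Longrightarrow> k < n \<Longrightarrow> (i, k) \<notin> pos \<Longrightarrow> x $$ (i, k) = 0"
  by (auto simp: alg_def)

lemma alg_add: "x \<in> alg \<Longrightarrow> y \<in> alg \<Longrightarrow> x + y \<in> alg"
  and alg_minus: "x \<in> alg \<Longrightarrow> y \<in> alg \<Longrightarrow> x - y \<in> alg"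
  and alg_smult: "x \<in> alg \<Longrightarrow> c \<cdot>\<^sub>m x \<in> alg"
  and alg_one: "1\<^sub>m n \<in> alg"
  and alg_zero_mat: "0\<^sub>m n n \<in> alg"
  by (auto simp: alg_def pos_def)

lemma alg_mult:
  assumes "x \<in> alg" "y \<in> alg" shows "x * y \<in> alg"
proof -
  have "(x * y) $$ (i, k) = 0" if ik: "i < n" "k < n" "(i, k) \<notin> pos" for i k
  proof -
    have "x $$ (i, l) * y $$ (l, k) = 0" if "l < n" for l
    proof (cases "(i, l) \<in> pos")
      case True
      then have "(l, k) \<notin> pos" using ik by (auto simp: pos_def)
      then show ?thesis using alg_zero[OF assms(2) that ik(2)] by simp
    next
      case False
      then show ?thesis using alg_zero[OF assms(1) ik(1) that] by simp
    qed
    then have "(\<Sum>l<n. x $$ (i, l) * y $$ (l, k)) = 0" by (intro sum.neutral) auto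
    then show ?thesis
      using mult_index_sum[OF alg_carrier[OF assms(1)] alg_carrier[OF assms(2)] ik(1,2)] by metis
  qed
  then show ?thesis using mult_carrier_mat[OF alg_carrier[OF assms(1)] alg_carrier[OF assms(2)]]
    by (auto simp: alg_def)
qed

lemma elem_mat_alg: "(i, k) \<in> pos \<Longrightarrow> elem_mat n i k \<in> alg"
  by (auto simp: alg_def)

lemma tr_add: "x \<in> gl n \<Longrightarrow> y \<in> gl n \<Longrightarrow> tr (x + y) = tr x + tr y"
  and tr_minus: "x \<in> gl n \<Longrightarrow> y \<in> gl n \<Longrightarrow> tr (x - y) = tr x - tr y"
  and tr_smult: "x \<in> gl n \<Longrightarrow> tr (c \<cdot>\<^sub>m x) = c * tr x"
  by (auto simp: tr_def sum.distrib sum_subtractf sum_distrib_left)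

lemma tr_one: "tr (1\<^sub>m n) = of_nat n"
  by (simp add: tr_def)

text \<open>Taking a diagonal block is an algebra homomorphism on block triangular matrices, so the trace of a
  diagonal block inherits the symmetry of the trace.\<close>

lemma block_trace_mult_commute:
  assumes "x \<in> alg" "y \<in> alg"
  shows "block_trace p (x * y) = block_trace p (y * x)"
proof -
  note c = alg_carrier[OF assms(1)] alg_carrier[OF assms(2)]
  let ?S = "{i. i < n \<and> blk i = p}"
  have *: "block_trace p (u * v) = (\<Sum>i\<in>?S. \<Sum>l\<in>?S. u $$ (i, l) * v $$ (l, i))"
    if u: "u \<in> alg" and v: "v \<in> alg" for u v
    unfolding block_trace_def
  proof (intro sum.cong refl)
    fix i assume "i \<in> ?S"
    then have i: "i < n" "blk i = p" by auto
    have z: "u $$ (i, l) * v $$ (l, i) = 0" if "l < n" "blk l \<noteq> p" for l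
    proof -
      have "(i, l) \<notin> pos \<or> (l, i) \<notin> pos" using that i by (auto simp: pos_def)
      then show ?thesis using alg_zero[OF u i(1) that(1)] alg_zero[OF v that(1) i(1)] by auto
    qed
    have "(u * v) $$ (i, i) = (\<Sum>l<n. u $$ (i, l) * v $$ (l, i))"
      using mult_index_sum[OF alg_carrier[OF u] alg_carrier[OF v] i(1) i(1)] .
    also have "\<dots> = (\<Sum>l\<in>?S. u $$ (i, l) * v $$ (l, i))"
      using z by (intro sum.mono_neutral_right) auto
    finally show "(u * v) $$ (i, i) = (\<Sum>l\<in>?S. u $$ (i, l) * v $$ (l, i))" .
  qed
  show ?thesis unfolding *[OF assms] *[OF assms(2,1)]
    by (subst sum.swap) (simp add: mult.commute)
qed

lemma tr_mult_commute:
  assumes "x \<in> gl n" "y \<in> gl n"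
  shows "tr (x * y) = tr (y * x)"
proof -
  have *: "tr (u * v) = (\<Sum>i<n. \<Sum>l<n. u $$ (i, l) * v $$ (l, i))"
    if "u \<in> gl n" "v \<in> gl n" for u v
    unfolding tr_def using that by (intro sum.cong refl mult_index_sum) auto
  show ?thesis unfolding *[OF assms] *[OF assms(2,1)]
    by (subst sum.swap) (simp add: mult.commute)
qed

lemma bracket_salg:
  assumes "x \<in> alg" "y \<in> alg" shows "lie_bracket x y \<in> salg"
proof -
  have c: "x * y \<in> gl n" "y * x \<in> gl n"
    using assms alg_mult alg_carrier by blast+
  show ?thesis
    using tr_minus[OF c] tr_mult_commute[OF alg_carrier[OF assms(1)] alg_carrier[OF assms(2)]]
      alg_minus alg_mult assms by (simp add: salg_def lie_bracket_def)
qed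

lemma bracket_alg: "x \<in> alg \<Longrightarrow> y \<in> alg \<Longrightarrow> lie_bracket x y \<in> alg"
  using bracket_salg salg_alg by blast

lemma sum_pos:
  assumes "\<And>i k. i < n \<Longrightarrow> k < n \<Longrightarrow> (i, k) \<notin> pos \<Longrightarrow> g (i, k) = 0"
  shows "(\<Sum>i<n. \<Sum>k<n. g (i, k)) = (\<Sum>q\<in>pos. g q :: complex)"
proof -
  have "(\<Sum>i<n. \<Sum>k<n. g (i, k)) = (\<Sum>q\<in>{..<n} \<times> {..<n}. g q)"
    by (simp add: sum.cartesian_product)
  also have "\<dots> = (\<Sum>q\<in>pos. g q)"
    using assms by (intro sum.mono_neutral_right) (auto simp: pos_def)
  finally show ?thesis .
qed

lemma linear_expand_alg:
  assumes "linear_on_mats n f" "x \<in> alg"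
  shows "f x = (\<Sum>q\<in>pos. x $$ q * f (elem_mat n (fst q) (snd q)))"
  using linear_on_mats_expand[OF assms(1) alg_carrier[OF assms(2)]]
    sum_pos[of "\<lambda>q. x $$ q * f (elem_mat n (fst q) (snd q))"] alg_zero[OF assms(2)] by simp

definition of_coeffs :: "(nat \<times> nat \<Rightarrow> complex) \<Rightarrow> complex mat" where
  "of_coeffs u = mat n n (\<lambda>q. if q \<in> pos then u q else 0)"

lemma of_coeffs_alg: "of_coeffs u \<in> alg"
  by (auto simp: of_coeffs_def alg_def)

lemma of_coeffs_index: "q \<in> pos \<Longrightarrow> of_coeffs u $$ q = u q"
  by (auto simp: of_coeffs_def pos_def)

definition nondegenerate :: "(complex mat \<Rightarrow> complex) \<Rightarrow> bool" where
  "nondegenerate f \<longleftrightarrow> (\<forall>x\<in>salg. (\<forall>y\<in>alg. f (lie_bracket x y) = 0) \<longrightarrow> x = 0\<^sub>m n n)"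

text \<open>The Kirillov form of a functional that kills the identity is degenerate on the full block
  triangular algebra, the identity being in its kernel. The trace term repairs this, so that linear systems can be written in
  the basis of all matrix units of the algebra.\<close>

definition form :: "(complex mat \<Rightarrow> complex) \<Rightarrow> complex mat \<Rightarrow> complex mat \<Rightarrow> complex" where
  "form f x y = f (lie_bracket x y) + tr x * tr y"

lemma form_linear_left:
  assumes "linear_on_mats n f" "y \<in> gl n"
  shows "linear_on_mats n (\<lambda>x. form f x y)"
  unfolding linear_on_mats_def form_def using assms
  by (auto simp: lie_bracket_add_left[where n = n] lie_bracket_smult_left[where n = n]
      linear_on_mats_add[OF assms(1)] linear_on_mats_smult[OF assms(1)] tr_add tr_smult algebra_simps)

lemma form_linear_right:
  assumes "linear_on_mats n f" "x \<in> gl n"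
  shows "linear_on_mats n (\<lambda>y. form f x y)"
  unfolding linear_on_mats_def form_def using assms
  by (auto simp: lie_bracket_add_right[where n = n] lie_bracket_smult_right[where n = n]
      linear_on_mats_add[OF assms(1)] linear_on_mats_smult[OF assms(1)] tr_add tr_smult algebra_simps)

lemma form_one:
  assumes "linear_on_mats n f" "x \<in> alg"
  shows "form f x (1\<^sub>m n) = of_nat n * tr x"
proof -
  show ?thesis using alg_carrier[OF assms(2)] linear_on_mats_zero[OF assms(1)]
    by (simp add: form_def tr_one)
qed

lemma form_nondegenerate:
  assumes "linear_on_mats n f" "nondegenerate f" "x \<in> alg" "\<And>y. y \<in> alg \<Longrightarrow> form f x y = 0"
  shows "x = 0\<^sub>m n n"
proof -
  have "tr x = 0" using form_one[OF assms(1,3)] assms(4)[OF alg_one] n_pos by simp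
  moreover from this have "\<forall>y\<in>alg. f (lie_bracket x y) = 0" using assms(4) by (simp add: form_def)
  ultimately show ?thesis using assms(2,3) unfolding nondegenerate_def salg_def by blast
qed

text \<open>The matrix of the form in the basis of matrix units, with the argument of the form that is to be
  solved for indexed by columns.\<close>

definition gram :: "(complex mat \<Rightarrow> complex) \<Rightarrow> nat \<times> nat \<Rightarrow> nat \<times> nat \<Rightarrow> complex" where
  "gram f p q = form f (elem_mat n (fst q) (snd q)) (elem_mat n (fst p) (snd p))"

lemma gram_sum:
  assumes "linear_on_mats n f"
  shows "(\<Sum>q\<in>pos. gram f p q * u q) = form f (of_coeffs u) (elem_mat n (fst p) (snd p))"
  using linear_expand_alg[OF form_linear_left[OF assms, of "elem_mat n (fst p) (snd p)"] of_coeffs_alg, of u]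
  by (simp add: gram_def of_coeffs_index mult.commute)

lemma form_of_coeffs:
  assumes "linear_on_mats n f" "linear_on_mats n l"
    and "\<And>p. p \<in> pos \<Longrightarrow> (\<Sum>q\<in>pos. gram f p q * u q) = l (elem_mat n (fst p) (snd p))"
    and "y \<in> alg"
  shows "form f (of_coeffs u) y = l y"
  using linear_expand_alg[OF form_linear_right[OF assms(1) alg_carrier[OF of_coeffs_alg[of u]]] assms(4)]
    linear_expand_alg[OF assms(2,4)] assms(3) gram_sum[OF assms(1), of _ u] by simp

end

section \<open>The Lax equation along a line of functionals\<close>

context block_triangular begin

lemma nondegenerate_iff_gram:
  assumes f: "linear_on_mats n f"
  shows "nondegenerate f \<longleftrightarrow>
    (\<forall>v. (\<forall>p\<in>pos. (\<Sum>q\<in>pos. gram f p q * v q) = 0) \<longrightarrow> (\<forall>q\<in>pos. v q = 0))"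
proof
  assume nd: "nondegenerate f"
  show "\<forall>v. (\<forall>p\<in>pos. (\<Sum>q\<in>pos. gram f p q * v q) = 0) \<longrightarrow> (\<forall>q\<in>pos. v q = 0)"
  proof (intro allI impI ballI)
    fix v q assume v: "\<forall>p\<in>pos. (\<Sum>q\<in>pos. gram f p q * v q) = 0" and q: "q \<in> pos"
    have "form f (of_coeffs v) y = 0" if "y \<in> alg" for y
      using form_of_coeffs[OF f, of "\<lambda>_. 0" v y] v that by (simp add: linear_on_mats_def)
    then have "of_coeffs v = 0\<^sub>m n n" using form_nondegenerate[OF f nd of_coeffs_alg] by blast
    then show "v q = 0" using of_coeffs_index[OF q, of v] q by (auto simp: pos_def)
  qed
next
  assume v: "\<forall>v. (\<forall>p\<in>pos. (\<Sum>q\<in>pos. gram f p q * v q) = 0) \<longrightarrow> (\<forall>q\<in>pos. v q = 0)"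
  show "nondegenerate f"
    unfolding nondegenerate_def
  proof (intro ballI impI)
    fix x assume x: "x \<in> salg" and fx: "\<forall>y\<in>alg. f (lie_bracket x y) = 0"
    have xa: "x \<in> alg" using x by (rule salg_alg)
    have ox: "of_coeffs (\<lambda>q. x $$ q) = x"
    proof (rule eq_mat_carrierI[of _ n])
      fix i k assume "i < n" "k < n"
      then show "of_coeffs (\<lambda>q. x $$ q) $$ (i, k) = x $$ (i, k)"
        using alg_zero[OF xa] by (auto simp: of_coeffs_def)
    qed (use xa alg_carrier in \<open>auto simp: of_coeffs_def\<close>)
    have "(\<Sum>q\<in>pos. gram f p q * x $$ q) = 0" if "p \<in> pos" for p
    proof -
      have "elem_mat n (fst p) (snd p) \<in> alg" using elem_mat_alg[of "fst p" "snd p"] that by simp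
      then have "f (lie_bracket x (elem_mat n (fst p) (snd p))) = 0" using fx by blast
      moreover have "tr x = 0" using x by (simp add: salg_def)
      ultimately show ?thesis unfolding gram_sum[OF f] ox by (simp add: form_def)
    qed
    then have z: "\<forall>q\<in>pos. x $$ q = 0" using v by blast
    show "x = 0\<^sub>m n n"
      using z alg_zero[OF xa] alg_carrier[OF xa] by (intro eq_mat_carrierI[of _ n]) auto
  qed
qed

definition lax :: "complex set \<Rightarrow> (complex \<Rightarrow> complex mat) \<Rightarrow> (complex \<Rightarrow> complex mat) \<Rightarrow> bool" where
  "lax D y X \<longleftrightarrow> (\<forall>t. X t \<in> alg) \<and> (\<forall>t\<in>D. \<forall>i<n. \<forall>k<n.
     ((\<lambda>s. X s $$ (i, k)) has_field_derivative lie_bracket (X t) (y t) $$ (i, k)) (at t))"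

text \<open>With \<open>f\<^sub>t = f0 + t (f1 - f0)\<close>, let \<open>H t\<close> represent \<open>f\<^sub>t\<close> and let \<open>y t\<close> represent \<open>f1 - f0\<close> with respect to the
  form of \<open>f\<^sub>t\<close>. Differentiating \<open>f\<^sub>t [H, x] = f\<^sub>t x\<close> gives \<open>f\<^sub>t [H', x] = f\<^sub>t [y, x] - f\<^sub>t [y, [H, x]]\<close>, and by the Jacobi
  identity the right-hand side is \<open>f\<^sub>t [[H, y], x]\<close>. Nondegeneracy yields \<open>H' = [H, y]\<close>.\<close>

lemma exists_lax_path:
  assumes lin: "linear_on_mats n f0" "linear_on_mats n f1"
    and one: "f0 (1\<^sub>m n) = 0" "f1 (1\<^sub>m n) = 0"
    and nd: "nondegenerate f0" "nondegenerate f1"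
  obtains D H y where "open D" "connected D" "0 \<in> D" "1 \<in> D"
    "\<And>t. t \<in> D \<Longrightarrow> H t \<in> salg" "\<And>t. y t \<in> alg"
    "\<And>i k. i < n \<Longrightarrow> k < n \<Longrightarrow> (\<lambda>t. y t $$ (i, k)) holomorphic_on D"
    "\<And>x. x \<in> alg \<Longrightarrow> f0 (lie_bracket (H 0) x) = f0 x"
    "\<And>x. x \<in> alg \<Longrightarrow> f1 (lie_bracket (H 1) x) = f1 x"
    "lax D y H"
proof -
  define f where "f t x = f0 x + t * (f1 x - f0 x)" for t x
  have f01: "f 0 = f0" "f 1 = f1" by (auto simp: f_def)
  have flin: "linear_on_mats n (f t)" for t
    using lin unfolding linear_on_mats_def f_def by (auto simp: algebra_simps)
  have dlin: "linear_on_mats n (\<lambda>x. f1 x - f0 x)"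
    using lin unfolding linear_on_mats_def by (auto simp: algebra_simps)
  define D where "D = {t. \<forall>v. (\<forall>p\<in>pos. (\<Sum>q\<in>pos. gram (f t) p q * v q) = 0) \<longrightarrow> (\<forall>q\<in>pos. v q = 0)}"
  have Dnd: "t \<in> D \<longleftrightarrow> nondegenerate (f t)" for t
    unfolding D_def nondegenerate_iff_gram[OF flin] by simp
  have D01: "0 \<in> D" "1 \<in> D" using nd by (auto simp: Dnd f01)
  have gram_f: "gram (f t) p q = gram f0 p q + t * (gram f1 p q - gram f0 p q)" for t p q
    by (simp add: gram_def form_def f_def)
  have gh: "(\<lambda>t. gram (f t) p q) holomorphic_on UNIV" for p q
    unfolding gram_f by (intro holomorphic_intros)
  note sys = holomorphic_linear_system[OF finite_pos gh D_def D01(1)]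
  have openD: "open D" and conD: "connected D" using sys(1,2) by auto
  have "(\<lambda>t. f t (elem_mat n (fst p) (snd p))) holomorphic_on UNIV" for p
    unfolding f_def by (intro holomorphic_intros)
  from sys(3)[of "\<lambda>p t. f t (elem_mat n (fst p) (snd p))", OF this] obtain u where
    u: "\<And>q. q \<in> pos \<Longrightarrow> u q holomorphic_on D" and
    ueq: "\<And>t p. t \<in> D \<Longrightarrow> p \<in> pos \<Longrightarrow> (\<Sum>q\<in>pos. gram (f t) p q * u q t) = f t (elem_mat n (fst p) (snd p))"
    by blast
  have "(\<lambda>t. f1 (elem_mat n (fst p) (snd p)) - f0 (elem_mat n (fst p) (snd p))) holomorphic_on UNIV"
    for p :: "nat \<times> nat" by (intro holomorphic_intros)
  from sys(3)[of "\<lambda>p t. f1 (elem_mat n (fst p) (snd p)) - f0 (elem_mat n (fst p) (snd p))", OF this] obtain w where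
    w: "\<And>q. q \<in> pos \<Longrightarrow> w q holomorphic_on D" and
    weq: "\<And>t p. t \<in> D \<Longrightarrow> p \<in> pos \<Longrightarrow> (\<Sum>q\<in>pos. gram (f t) p q * w q t)
       = f1 (elem_mat n (fst p) (snd p)) - f0 (elem_mat n (fst p) (snd p))"
    by blast
  define H where "H t = of_coeffs (\<lambda>q. u q t)" for t
  define y where "y t = of_coeffs (\<lambda>q. w q t)" for t
  have Ha: "H t \<in> alg" and ya: "y t \<in> alg" for t by (simp_all add: H_def y_def of_coeffs_alg)
  note Hc = alg_carrier[OF Ha] and yc = alg_carrier[OF ya]
  have hol: "(\<lambda>t. of_coeffs (\<lambda>q. z q t) $$ (i, k)) holomorphic_on D"
    if "\<And>q. q \<in> pos \<Longrightarrow> z q holomorphic_on D" "i < n" "k < n" for z i k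
    using that by (cases "(i, k) \<in> pos") (auto simp: of_coeffs_def)
  have Hhol: "(\<lambda>t. H t $$ (i, k)) holomorphic_on D" if "i < n" "k < n" for i k
    unfolding H_def using hol[OF u that] .
  have yhol: "(\<lambda>t. y t $$ (i, k)) holomorphic_on D" if "i < n" "k < n" for i k
    unfolding y_def using hol[OF w that] .
  have formH: "form (f t) (H t) x = f t x" if "t \<in> D" "x \<in> alg" for t x
    unfolding H_def using form_of_coeffs[OF flin flin ueq[OF that(1)] that(2)] .
  have formy: "form (f t) (y t) x = f1 x - f0 x" if "t \<in> D" "x \<in> alg" for t x
    unfolding y_def using form_of_coeffs[OF flin dlin weq[OF that(1)] that(2)] .
  have fone: "f t (1\<^sub>m n) = 0" for t using one by (simp add: f_def)
  have trH: "tr (H t) = 0" if "t \<in> D" for t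
    using formH[OF that alg_one] form_one[OF flin Ha] fone n_pos by simp
  have trY: "tr (y t) = 0" if "t \<in> D" for t
    using formy[OF that alg_one] form_one[OF flin ya] one n_pos by simp
  have Heq: "f t (lie_bracket (H t) x) = f t x" if "t \<in> D" "x \<in> alg" for t x
    using formH[OF that] trH[OF that(1)] by (simp add: form_def)
  have yeq: "f t (lie_bracket (y t) x) = f1 x - f0 x" if "t \<in> D" "x \<in> alg" for t x
    using formy[OF that] trY[OF that(1)] by (simp add: form_def)
  have deriv_H: "((\<lambda>s. H s $$ (i, k)) has_field_derivative lie_bracket (H t) (y t) $$ (i, k)) (at t)"
    if t: "t \<in> D" and ik: "i < n" "k < n" for t i k
  proof -
    define H' where "H' = of_coeffs (\<lambda>q. deriv (u q) t)"
    have H'a: "H' \<in> alg" by (simp add: H'_def of_coeffs_alg)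
    note H'c = alg_carrier[OF H'a]
    have dH: "((\<lambda>s. H s $$ (a, b)) has_field_derivative H' $$ (a, b)) (at t)" if "a < n" "b < n" for a b
      using that holomorphic_derivI[OF u openD t]
      by (cases "(a, b) \<in> pos") (auto simp: H_def H'_def of_coeffs_def)
    have dl: "((\<lambda>s. l (H s)) has_field_derivative l H') (at t)" if l: "linear_on_mats n l" for l
      unfolding linear_on_mats_expand[OF l Hc] linear_on_mats_expand[OF l H'c]
      by (intro DERIV_sum DERIV_cmult_right dH) auto
    have br: "linear_on_mats n (\<lambda>z. l (lie_bracket z x))" if "linear_on_mats n l" "x \<in> alg" for l x
      using that alg_carrier[OF that(2)] unfolding linear_on_mats_def
      by (auto simp: lie_bracket_add_left[where n = n] lie_bracket_smult_left[where n = n])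
    have trH': "tr H' = 0"
    proof -
      have "linear_on_mats n tr" unfolding linear_on_mats_def using tr_add tr_smult by auto
      from dl[OF this] have "((\<lambda>s. tr (H s)) has_field_derivative tr H') (at t)" .
      moreover have "((\<lambda>s. tr (H s)) has_field_derivative 0) (at t)"
      proof (rule DERIV_cong_ev[OF refl _ refl, THEN iffD1])
        show "((\<lambda>s. 0 :: complex) has_field_derivative 0) (at t)" by (rule DERIV_const)
        show "eventually (\<lambda>s. 0 = tr (H s)) (nhds t)"
          using eventually_nhds_in_open[OF openD t] by eventually_elim (simp add: trH)
      qed
      ultimately show ?thesis by (rule DERIV_unique)
    qed
    \<comment> \<open>Both sides come from computing the derivative of \<open>f\<^sub>s [H s, x] = f\<^sub>s x\<close> at \<open>s = t\<close>.\<close>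
    have main: "f t (lie_bracket H' x) = (f1 x - f0 x) - (f1 (lie_bracket (H t) x) - f0 (lie_bracket (H t) x))"
      if x: "x \<in> alg" for x
    proof -
      let ?g = "\<lambda>s. f0 (lie_bracket (H s) x) + s * (f1 (lie_bracket (H s) x) - f0 (lie_bracket (H s) x))"
      have "(?g has_field_derivative f0 (lie_bracket H' x) +
          ((1 * (f1 (lie_bracket (H t) x) - f0 (lie_bracket (H t) x))) +
           (f1 (lie_bracket H' x) - f0 (lie_bracket H' x)) * t)) (at t)"
        by (intro DERIV_add DERIV_mult DERIV_ident DERIV_diff dl br lin x)
      moreover have "(?g has_field_derivative f1 x - f0 x) (at t)"
      proof (rule DERIV_cong_ev[OF refl _ refl, THEN iffD1])
        show "((\<lambda>s. f0 x + s * (f1 x - f0 x)) has_field_derivative f1 x - f0 x) (at t)"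
          by (auto intro!: derivative_eq_intros)
        show "eventually (\<lambda>s. f0 x + s * (f1 x - f0 x) = ?g s) (nhds t)"
          using eventually_nhds_in_open[OF openD t]
        proof eventually_elim
          case (elim s)
          show ?case using Heq[OF elim x] by (simp add: f_def)
        qed
      qed
      ultimately have "f0 (lie_bracket H' x) +
          ((1 * (f1 (lie_bracket (H t) x) - f0 (lie_bracket (H t) x))) +
           (f1 (lie_bracket H' x) - f0 (lie_bracket H' x)) * t) = f1 x - f0 x" by (rule DERIV_unique)
      then show ?thesis by (simp add: f_def algebra_simps)
    qed
    define E where "E = H' - lie_bracket (H t) (y t)"
    have Hy: "lie_bracket (H t) (y t) \<in> salg" by (rule bracket_salg[OF Ha ya])
    have Ea: "E \<in> salg" unfolding E_def salg_def
      using H'a Hy trH' tr_minus[OF H'c alg_carrier[OF salg_alg[OF Hy]]]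
      by (auto simp: salg_def intro: alg_minus)
    have "f t (lie_bracket E x) = 0" if x: "x \<in> alg" for x
    proof -
      note xc = alg_carrier[OF x]
      have yx: "lie_bracket (y t) x \<in> alg" and Hx: "lie_bracket (H t) x \<in> alg"
        using bracket_alg Ha ya x by blast+
      have "lie_bracket E x = lie_bracket H' x - lie_bracket (lie_bracket (H t) (y t)) x"
        unfolding E_def by (rule lie_bracket_minus_left[OF H'c lie_bracket_carrier[OF Hc yc] xc])
      then have "f t (lie_bracket E x) = f t (lie_bracket H' x) - f t (lie_bracket (lie_bracket (H t) (y t)) x)"
        using linear_on_mats_minus[OF flin] H'c Hc yc xc by simp
      also have "f t (lie_bracket (lie_bracket (H t) (y t)) x)
         = f t (lie_bracket (H t) (lie_bracket (y t) x)) - f t (lie_bracket (y t) (lie_bracket (H t) x))"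
        unfolding lie_bracket_jacobi[OF Hc yc xc]
        using linear_on_mats_minus[OF flin] Hc yc xc by simp
      also have "f t (lie_bracket (H t) (lie_bracket (y t) x)) = f1 x - f0 x"
        using Heq[OF t yx] yeq[OF t x] by simp
      also have "f t (lie_bracket (y t) (lie_bracket (H t) x))
          = f1 (lie_bracket (H t) x) - f0 (lie_bracket (H t) x)"
        using yeq[OF t Hx] .
      finally show ?thesis using main[OF x] by simp
    qed
    then have "E = 0\<^sub>m n n" using Dnd[of t] t Ea unfolding nondegenerate_def by blast
    moreover have "E $$ (i, k) = H' $$ (i, k) - lie_bracket (H t) (y t) $$ (i, k)"
      unfolding E_def using ik by (intro index_minus_mat) (simp_all add: carrier_matD[OF lie_bracket_carrier[OF Hc yc]])
    ultimately have "H' $$ (i, k) = lie_bracket (H t) (y t) $$ (i, k)" using ik by simp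
    then show ?thesis using dH[OF ik] by simp
  qed
  show thesis
  proof (rule that[of D H y])
    show "H t \<in> salg" if "t \<in> D" for t using Ha trH[OF that] by (simp add: salg_def)
    show "f0 (lie_bracket (H 0) x) = f0 x" if "x \<in> alg" for x using Heq[OF D01(1) that] f01 by simp
    show "f1 (lie_bracket (H 1) x) = f1 x" if "x \<in> alg" for x using Heq[OF D01(2) that] f01 by simp
    show "lax D y H" using Ha deriv_H by (simp add: lax_def)
  qed (use openD conD D01 ya yhol in auto)
qed

lemma lax_alg: "lax D y X \<Longrightarrow> X t \<in> alg"
  and lax_deriv: "lax D y X \<Longrightarrow> t \<in> D \<Longrightarrow> i < n \<Longrightarrow> k < n \<Longrightarrow>
     ((\<lambda>s. X s $$ (i, k)) has_field_derivative lie_bracket (X t) (y t) $$ (i, k)) (at t)"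
  by (auto simp: lax_def)

lemma lax_one:
  assumes "\<And>t. y t \<in> alg" shows "lax D y (\<lambda>t. 1\<^sub>m n)"
  unfolding lax_def using alg_one alg_carrier[OF assms] by simp

lemma lax_add:
  assumes "lax D y X" "lax D y Z" "\<And>t. y t \<in> alg"
  shows "lax D y (\<lambda>t. X t + Z t)"
proof -
  note c = alg_carrier[OF lax_alg[OF assms(1)]] alg_carrier[OF lax_alg[OF assms(2)]] alg_carrier[OF assms(3)]
  have "((\<lambda>s. (X s + Z s) $$ (i, k)) has_field_derivative lie_bracket (X t + Z t) (y t) $$ (i, k)) (at t)"
    if "t \<in> D" "i < n" "k < n" for t i k
  proof -
    have "(\<lambda>s. (X s + Z s) $$ (i, k)) = (\<lambda>s. X s $$ (i, k) + Z s $$ (i, k))"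
      using that carrier_matD[OF c(2)] by (intro ext) simp
    moreover have "lie_bracket (X t + Z t) (y t) $$ (i, k)
       = lie_bracket (X t) (y t) $$ (i, k) + lie_bracket (Z t) (y t) $$ (i, k)"
      using that carrier_matD[OF lie_bracket_carrier[OF c(2,3)]]
      by (subst lie_bracket_add_left[OF c]) simp
    ultimately show ?thesis using lax_deriv[OF assms(1) that] lax_deriv[OF assms(2) that]
      by (simp add: DERIV_add)
  qed
  then show ?thesis using alg_add[OF lax_alg[OF assms(1)] lax_alg[OF assms(2)]] by (simp add: lax_def)
qed

lemma lax_smult:
  assumes "lax D y X" "\<And>t. y t \<in> alg"
  shows "lax D y (\<lambda>t. c \<cdot>\<^sub>m X t)"
proof -
  note c = alg_carrier[OF lax_alg[OF assms(1)]] alg_carrier[OF assms(2)]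
  have "((\<lambda>s. (c \<cdot>\<^sub>m X s) $$ (i, k)) has_field_derivative lie_bracket (c \<cdot>\<^sub>m X t) (y t) $$ (i, k)) (at t)"
    if "t \<in> D" "i < n" "k < n" for t i k
  proof -
    have "(\<lambda>s. (c \<cdot>\<^sub>m X s) $$ (i, k)) = (\<lambda>s. c * X s $$ (i, k))"
      using that carrier_matD[OF c(1)] by (intro ext) simp
    moreover have "lie_bracket (c \<cdot>\<^sub>m X t) (y t) $$ (i, k) = c * lie_bracket (X t) (y t) $$ (i, k)"
      using that carrier_matD[OF lie_bracket_carrier[OF c]]
      by (subst lie_bracket_smult_left[OF c]) simp
    ultimately show ?thesis using lax_deriv[OF assms(1) that]
      by (simp add: DERIV_cmult)
  qed
  then show ?thesis using alg_smult[OF lax_alg[OF assms(1)]] by (simp add: lax_def)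
qed

lemma lax_minus:
  assumes "lax D y X" "lax D y Z" "\<And>t. y t \<in> alg"
  shows "lax D y (\<lambda>t. X t - Z t)"
proof -
  have "X t - Z t = X t + (- 1) \<cdot>\<^sub>m Z t" for t
    using alg_carrier[OF lax_alg[OF assms(1)], of t] alg_carrier[OF lax_alg[OF assms(2)], of t]
    by (intro eq_mat_carrierI[of _ n]) auto
  then show ?thesis using lax_add[OF assms(1) lax_smult[OF assms(2,3)] assms(3)] by simp
qed

text \<open>The bracket with \<open>y t\<close> is a derivation of the matrix product.\<close>

lemma lax_mult:
  assumes "lax D y X" "lax D y Z" "\<And>t. y t \<in> alg"
  shows "lax D y (\<lambda>t. X t * Z t)"
proof -
  note c = alg_carrier[OF lax_alg[OF assms(1)]] alg_carrier[OF lax_alg[OF assms(2)]] alg_carrier[OF assms(3)]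
  have "((\<lambda>s. (X s * Z s) $$ (i, k)) has_field_derivative lie_bracket (X t * Z t) (y t) $$ (i, k)) (at t)"
    if t: "t \<in> D" and ik: "i < n" "k < n" for t i k
  proof -
    have leibniz: "lie_bracket (X t * Z t) (y t) = lie_bracket (X t) (y t) * Z t + X t * lie_bracket (Z t) (y t)"
    proof -
      have cc: "X t * y t \<in> gl n" "y t * X t \<in> gl n"
        "Z t * y t \<in> gl n" "y t * Z t \<in> gl n"
        using mult_carrier_mat[OF c(1) c(3)] mult_carrier_mat[OF c(3) c(1)]
          mult_carrier_mat[OF c(2) c(3)] mult_carrier_mat[OF c(3) c(2)] by auto
      have "X t * Z t * y t - y t * (X t * Z t) =
        (X t * y t * Z t - y t * X t * Z t) + (X t * Z t * y t - X t * y t * Z t)"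
      proof -
        have "A - B = (C - B) + (A - C)" if "A \<in> gl n" "B \<in> gl n" "C \<in> gl n"
          for A B C :: "complex mat" using that by (intro eq_mat_carrierI[of _ n]) auto
        moreover have "X t * Z t * y t \<in> gl n" "y t * (X t * Z t) \<in> gl n"
          "X t * y t * Z t \<in> gl n"
          by (intro mult_carrier_mat[of _ n n] c)+
        moreover have "y t * X t * Z t = y t * (X t * Z t)" by (rule assoc_mult_mat[OF c(3,1,2)])
        ultimately show ?thesis by metis
      qed
      then show ?thesis unfolding lie_bracket_def
        minus_mult_distrib_mat[OF cc(1,2) c(2)] mult_minus_distrib_mat[OF c(1) cc(3,4)]
        using assoc_mult_mat[OF c(1,2,3), of t t t] assoc_mult_mat[OF c(1,3,2), of t t t] by simp
    qed
    have entries: "(lie_bracket (X t) (y t) * Z t + X t * lie_bracket (Z t) (y t)) $$ (i, k)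
       = (\<Sum>l<n. lie_bracket (X t) (y t) $$ (i, l) * Z t $$ (l, k) + lie_bracket (Z t) (y t) $$ (l, k) * X t $$ (i, l))"
    proof -
      have "(lie_bracket (X t) (y t) * Z t + X t * lie_bracket (Z t) (y t)) $$ (i, k)
        = (lie_bracket (X t) (y t) * Z t) $$ (i, k) + (X t * lie_bracket (Z t) (y t)) $$ (i, k)"
        using ik carrier_matD[OF mult_carrier_mat[OF c(1) lie_bracket_carrier[OF c(2,3)]]]
        by (intro index_add_mat) auto
      then show ?thesis
        unfolding mult_index_sum[OF lie_bracket_carrier[OF c(1,3)] c(2) ik]
          mult_index_sum[OF c(1) lie_bracket_carrier[OF c(2,3)] ik]
        by (simp add: sum.distrib mult.commute)
    qed
    show ?thesis
      unfolding leibniz entries mult_index_sum[OF c(1,2) ik]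
      by (intro DERIV_sum DERIV_mult lax_deriv[OF assms(1) t] lax_deriv[OF assms(2) t] ik) auto
  qed
  then show ?thesis using alg_mult[OF lax_alg[OF assms(1)] lax_alg[OF assms(2)]] by (simp add: lax_def)
qed

text \<open>The Lax equation is a linear system of differential equations for the entries of \<open>X\<close>.\<close>

lemma lax_zero:
  assumes X: "lax D y X" and D: "open D" "connected D" and ya: "\<And>t. y t \<in> alg"
    and yh: "\<And>i k. i < n \<Longrightarrow> k < n \<Longrightarrow> (\<lambda>t. y t $$ (i, k)) holomorphic_on D"
    and t0: "t0 \<in> D" "X t0 = 0\<^sub>m n n" and t: "t \<in> D"
  shows "X t = 0\<^sub>m n n"
proof -
  define I where "I = {..<n} \<times> {..<n}"
  define a where "a = (\<lambda>(i, k) (p, q) t. (if p = i then y t $$ (q, k) else 0) - (if q = k then y t $$ (i, p) else 0))"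
  note c = alg_carrier[OF lax_alg[OF X]] alg_carrier[OF ya]
  have "X t $$ q = 0" if "q \<in> I" for q
  proof (rule linear_ode_zero[where I = I and a = a and D = D and ?t0.0 = t0 and v = "\<lambda>q t. X t $$ q"])
    show "a q q' holomorphic_on D" if q: "q \<in> I" "q' \<in> I" for q q'
    proof -
      obtain i k where "q = (i, k)" "i < n" "k < n" using q(1) by (auto simp: I_def)
      moreover obtain p l where "q' = (p, l)" "p < n" "l < n" using q(2) by (auto simp: I_def)
      ultimately show ?thesis unfolding a_def
        by (cases "p = i"; cases "l = k") (auto intro!: holomorphic_intros yh)
    qed
    show "((\<lambda>t. X t $$ q) has_field_derivative (\<Sum>q'\<in>I. a q q' t * X t $$ q')) (at t)"
      if q: "q \<in> I" and t: "t \<in> D" for q t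
    proof -
      obtain i k where ik: "q = (i, k)" "i < n" "k < n" using q by (auto simp: I_def)
      have "(\<Sum>q'\<in>I. a q q' t * X t $$ q') = (\<Sum>p<n. \<Sum>l<n. a q (p, l) t * X t $$ (p, l))"
        unfolding I_def by (simp add: sum.cartesian_product)
      also have "\<dots> = (\<Sum>p<n. \<Sum>l<n. (if p = i then X t $$ (i, l) * y t $$ (l, k) else 0)
          - (if l = k then y t $$ (i, p) * X t $$ (p, k) else 0))"
        by (intro sum.cong) (auto simp: a_def ik algebra_simps)
      also have "\<dots> = (\<Sum>p<n. if p = i then (\<Sum>l<n. X t $$ (i, l) * y t $$ (l, k)) else 0)
          - (\<Sum>p<n. y t $$ (i, p) * X t $$ (p, k))"
        unfolding sum_subtractf using ik by (simp add: sum.delta' if_distrib sum.If_cases)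
      also have "\<dots> = lie_bracket (X t) (y t) $$ (i, k)"
        using lie_bracket_index[OF c ik(2,3)] ik by simp
      finally show ?thesis using lax_deriv[OF X t ik(2,3)] ik(1) by simp
    qed
  qed (use that D t0 t in \<open>auto simp: I_def\<close>)
  then show ?thesis using c by (intro eq_mat_carrierI[of _ n]) (auto simp: I_def)
qed

lemma lax_block_trace:
  assumes X: "lax D y X" and D: "open D" "connected D" and ya: "\<And>t. y t \<in> alg"
    and t: "s \<in> D" "t \<in> D"
  shows "block_trace p (X s) = block_trace p (X t)"
proof -
  note c = alg_carrier[OF lax_alg[OF X]] alg_carrier[OF ya]
  have "((\<lambda>t. block_trace p (X t)) has_field_derivative 0) (at t)" if t: "t \<in> D" for t
  proof -
    have "((\<lambda>t. block_trace p (X t)) has_field_derivative block_trace p (lie_bracket (X t) (y t))) (at t)"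
      unfolding block_trace_def by (intro DERIV_sum lax_deriv[OF X t]) auto
    moreover have "block_trace p (lie_bracket (X t) (y t))
        = block_trace p (X t * y t) - block_trace p (y t * X t)"
      unfolding block_trace_def lie_bracket_def sum_subtractf[symmetric]
      by (intro sum.cong refl index_minus_mat) (auto simp: carrier_matD[OF c(1)] carrier_matD[OF c(2)])
    ultimately show ?thesis using block_trace_mult_commute[OF lax_alg[OF X] ya] by simp
  qed
  then obtain b where "\<And>x. x \<in> D \<Longrightarrow> block_trace p (X x) = b"
    using DERIV_zero_connected_constant[OF D(2,1), of "{}" "\<lambda>t. block_trace p (X t)"]
    by (metis (no_types, lifting) Diff_empty DERIV_isCont continuous_at_imp_continuous_on finite.emptyI)
  then show ?thesis using t by simp
qed

end

section \<open>Spectral projections and principal multiplicities\<close>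

definition mat_sum :: "nat \<Rightarrow> ('s \<Rightarrow> complex mat) \<Rightarrow> 's set \<Rightarrow> complex mat" where
  "mat_sum n f S = mat n n (\<lambda>q. \<Sum>s\<in>S. f s $$ q)"

lemma mat_sum_carrier [simp]: "mat_sum n f S \<in> gl n"
  by (simp add: mat_sum_def)

lemma mat_sum_index: "i < n \<Longrightarrow> k < n \<Longrightarrow> mat_sum n f S $$ (i, k) = (\<Sum>s\<in>S. f s $$ (i, k))"
  by (simp add: mat_sum_def)

lemma mat_sum_empty: "mat_sum n f {} = 0\<^sub>m n n"
  by (auto simp: mat_sum_def)

lemma mat_sum_insert:
  "finite S \<Longrightarrow> s \<notin> S \<Longrightarrow> f s \<in> gl n \<Longrightarrow> mat_sum n f (insert s S) = f s + mat_sum n f S"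
  by (rule eq_mat_carrierI[of _ n]) (auto simp: mat_sum_def)

lemma mat_sum_cong:
  "(\<And>s. s \<in> S \<Longrightarrow> f s = g s) \<Longrightarrow> mat_sum n f S = mat_sum n g S"
  by (auto simp: mat_sum_def intro!: cong_mat sum.cong)

lemma mat_sum_mult_left:
  assumes "a \<in> gl n" "\<And>s. s \<in> S \<Longrightarrow> f s \<in> gl n"
  shows "a * mat_sum n f S = mat_sum n (\<lambda>s. a * f s) S"
proof (rule eq_mat_carrierI[of _ n])
  fix i k assume ik: "i < n" "k < n"
  have "(a * mat_sum n f S) $$ (i, k) = (\<Sum>l<n. \<Sum>s\<in>S. a $$ (i, l) * f s $$ (l, k))"
    using ik by (simp add: mult_index_sum[OF assms(1) mat_sum_carrier ik] mat_sum_index sum_distrib_left del: index_mult_mat)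
  also have "\<dots> = (\<Sum>s\<in>S. (a * f s) $$ (i, k))"
    by (subst sum.swap) (simp add: mult_index_sum[OF assms(1) assms(2) ik] del: index_mult_mat)
  finally show "(a * mat_sum n f S) $$ (i, k) = mat_sum n (\<lambda>s. a * f s) S $$ (i, k)"
    using ik by (simp add: mat_sum_index)
qed (use assms in auto)

lemma mat_sum_mult_right:
  assumes "a \<in> gl n" "\<And>s. s \<in> S \<Longrightarrow> f s \<in> gl n"
  shows "mat_sum n f S * a = mat_sum n (\<lambda>s. f s * a) S"
proof (rule eq_mat_carrierI[of _ n])
  fix i k assume ik: "i < n" "k < n"
  have "(mat_sum n f S * a) $$ (i, k) = (\<Sum>l<n. \<Sum>s\<in>S. f s $$ (i, l) * a $$ (l, k))"
    using ik by (simp add: mult_index_sum[OF mat_sum_carrier assms(1) ik] mat_sum_index sum_distrib_right del: index_mult_mat)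
  also have "\<dots> = (\<Sum>s\<in>S. (f s * a) $$ (i, k))"
    by (subst sum.swap) (simp add: mult_index_sum[OF assms(2) assms(1) ik] del: index_mult_mat)
  finally show "(mat_sum n f S * a) $$ (i, k) = mat_sum n (\<lambda>s. f s * a) S $$ (i, k)"
    using ik by (simp add: mat_sum_index)
qed (use mult_carrier_mat[OF mat_sum_carrier assms(1)] in auto)

lemma mat_sum_smult:
  assumes "\<And>s. s \<in> S \<Longrightarrow> f s \<in> gl n"
  shows "mat_sum n (\<lambda>s. c \<cdot>\<^sub>m f s) S = c \<cdot>\<^sub>m mat_sum n f S"
proof (rule eq_mat_carrierI[of _ n])
  fix i k assume ik: "i < n" "k < n"
  have "(c \<cdot>\<^sub>m f s) $$ (i, k) = c * f s $$ (i, k)" if "s \<in> S" for s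
    using assms[OF that] ik by simp
  then show "mat_sum n (\<lambda>s. c \<cdot>\<^sub>m f s) S $$ (i, k) = (c \<cdot>\<^sub>m mat_sum n f S) $$ (i, k)"
    using ik carrier_matD[OF mat_sum_carrier[of n f S]] by (simp add: mat_sum_index sum_distrib_left)
qed auto

lemma mat_sum_add:
  assumes "\<And>s. s \<in> S \<Longrightarrow> f s \<in> gl n" "\<And>s. s \<in> S \<Longrightarrow> g s \<in> gl n"
  shows "mat_sum n (\<lambda>s. f s + g s) S = mat_sum n f S + mat_sum n g S"
proof (rule eq_mat_carrierI[of _ n])
  fix i k assume ik: "i < n" "k < n"
  have "(f s + g s) $$ (i, k) = f s $$ (i, k) + g s $$ (i, k)" if "s \<in> S" for s
    using assms(2)[OF that] ik by simp
  then show "mat_sum n (\<lambda>s. f s + g s) S $$ (i, k) = (mat_sum n f S + mat_sum n g S) $$ (i, k)"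
    using ik carrier_matD[OF mat_sum_carrier[of n g S]] by (simp add: mat_sum_index sum.distrib)
qed auto

text \<open>The Lagrange interpolation polynomial with nodes \<open>v\<close> and \<open>us\<close>, evaluated at the matrix \<open>X\<close>: the spectral
  projection of \<open>X\<close> for the eigenvalue \<open>v\<close> when \<open>us\<close> lists the other eigenvalues and \<open>X\<close> is diagonalizable.\<close>

primrec spectral :: "nat \<Rightarrow> complex mat \<Rightarrow> complex \<Rightarrow> complex list \<Rightarrow> complex mat" where
  "spectral n X v [] = 1\<^sub>m n"
| "spectral n X v (u # us) = (1 / (v - u)) \<cdot>\<^sub>m ((X - u \<cdot>\<^sub>m 1\<^sub>m n) * spectral n X v us)"

lemma spectral_diag:
  "spectral n (mat_diag n e) v us = mat_diag n (\<lambda>i. \<Prod>u\<leftarrow>us. (e i - u) / (v - u))"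
proof (induction us)
  case Nil
  then show ?case by simp
next
  case (Cons u us)
  have "mat_diag n e - u \<cdot>\<^sub>m 1\<^sub>m n = mat_diag n (\<lambda>i. e i - u)"
    by (rule eq_mat_carrierI[of _ n]) (auto simp: mat_diag_def)
  then show ?case using Cons
    by (auto simp: mat_diag_diag intro!: eq_mat_carrierI[of _ n]) (auto simp: mat_diag_def)
qed

lemma spectral_diag_delta:
  assumes "\<And>i. i < n \<Longrightarrow> e i = v \<or> e i \<in> set us" "v \<notin> set us"
  shows "spectral n (mat_diag n e) v us = mat_diag n (\<lambda>i. if e i = v then 1 else 0)"
proof -
  have "(\<Prod>u\<leftarrow>us. (e i - u) / (v - u)) = (if e i = v then 1 else 0)" if "i < n" for i
  proof (cases "e i = v")
    case True
    have "(\<Prod>u\<leftarrow>us. (v - u) / (v - u)) = 1" using assms(2) by (induction us) auto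
    then show ?thesis using True by simp
  next
    case False
    then have "e i \<in> set us" using assms(1)[OF that] by blast
    then have "(\<Prod>u\<leftarrow>us. (e i - u) / (v - u)) = 0" by (induction us) auto
    then show ?thesis using False by simp
  qed
  then show ?thesis unfolding spectral_diag by (auto simp: mat_diag_def intro!: cong_mat)
qed

context block_triangular begin

lemma lax_spectral:
  assumes "lax D y X" "\<And>t. y t \<in> alg"
  shows "lax D y (\<lambda>t. spectral n (X t) v us)"
proof (induction us)
  case (Cons u us)
  then show ?case
    by (auto intro!: lax_smult lax_mult lax_minus lax_one assms)
qed (simp add: lax_one assms)

lemma lax_zero_mat: "(\<And>t. y t \<in> alg) \<Longrightarrow> lax D y (\<lambda>t. 0\<^sub>m n n)"
proof -
  assume ya: "\<And>t. y t \<in> alg"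
  have "0 \<cdot>\<^sub>m 1\<^sub>m n = (0\<^sub>m n n :: complex mat)" by (rule eq_mat_carrierI[of _ n]) auto
  then show ?thesis using lax_smult[OF lax_one[OF ya] ya, where c = 0] by simp
qed

lemma lax_mat_sum:
  assumes "finite S" "\<And>s. s \<in> S \<Longrightarrow> lax D y (\<lambda>t. f s t)" "\<And>t. y t \<in> alg"
  shows "lax D y (\<lambda>t. mat_sum n (\<lambda>s. f s t) S)"
  using assms(1,2)
proof (induction S rule: finite_induct)
  case empty
  then show ?case by (simp add: mat_sum_empty lax_zero_mat assms(3))
next
  case (insert s S)
  have "f s t \<in> gl n" for t using insert.prems[of s] lax_alg alg_carrier by blast
  then have "(\<lambda>t. mat_sum n (\<lambda>s. f s t) (insert s S)) = (\<lambda>t. f s t + mat_sum n (\<lambda>s. f s t) S)"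
    using insert.hyps by (intro ext mat_sum_insert) auto
  then show ?case using insert by (simp add: lax_add assms(3))
qed

lemma principal_unique:
  assumes f: "linear_on_mats n f" and nd: "nondegenerate f"
    and H: "H \<in> salg" "\<And>x. x \<in> alg \<Longrightarrow> f (lie_bracket H x) = f x"
    and H': "H' \<in> salg" "\<And>x. x \<in> alg \<Longrightarrow> f (lie_bracket H' x) = f x"
  shows "H = H'"
proof -
  note c = alg_carrier[OF salg_alg[OF H(1)]] alg_carrier[OF salg_alg[OF H'(1)]]
  have "H - H' \<in> salg" using H(1) H'(1) c by (auto simp: salg_def tr_minus intro: alg_minus)
  moreover have "f (lie_bracket (H - H') x) = 0" if "x \<in> alg" for x
    using lie_bracket_minus_left[OF c alg_carrier[OF that]] H(2)[OF that] H'(2)[OF that]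
      linear_on_mats_minus[OF f, of "lie_bracket H x" "lie_bracket H' x"] c alg_carrier[OF that] by simp
  ultimately have z: "H - H' = 0\<^sub>m n n" using nd unfolding nondegenerate_def by blast
  show ?thesis
  proof (rule eq_mat_carrierI[OF c])
    fix i k assume ik: "i < n" "k < n"
    then have "(H - H') $$ (i, k) = 0" using z by simp
    then show "H $$ (i, k) = H' $$ (i, k)" using c ik by simp
  qed
qed

text \<open>For a diagonal principal element of \<open>f0\<close> the relations of spectral projections hold by inspection.
  Each of them says that a curve satisfying the Lax equation vanishes at the parameter of \<open>f0\<close>, so they hold at the
  parameter of \<open>f1\<close> too. In particular the principal element of \<open>f1\<close> is diagonalizable with the same
  eigenvalues.\<close>

lemma spectral_family:
  assumes lin: "linear_on_mats n f0" "linear_on_mats n f1"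
    and one: "f0 (1\<^sub>m n) = 0" "f1 (1\<^sub>m n) = 0"
    and nd: "nondegenerate f0" "nondegenerate f1"
    and H0: "mat_diag n e \<in> salg" "\<And>x. x \<in> alg \<Longrightarrow> f0 (lie_bracket (mat_diag n e) x) = f0 x"
  defines "V \<equiv> e ` {..<n}"
  obtains H P where "H \<in> salg" "\<And>x. x \<in> alg \<Longrightarrow> f1 (lie_bracket H x) = f1 x"
    "\<And>v. P v \<in> alg"
    "\<And>v. v \<in> V \<Longrightarrow> H * P v = v \<cdot>\<^sub>m P v" "\<And>v. v \<in> V \<Longrightarrow> P v * H = v \<cdot>\<^sub>m P v"
    "mat_sum n P V = 1\<^sub>m n"
    "\<And>v p. v \<in> V \<Longrightarrow> block_trace p (P v) = (\<Sum>i | i < n \<and> blk i = p. if e i = v then 1 else 0)"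
proof -
  obtain D H y where D: "open D" "connected D" "0 \<in> D" "1 \<in> D"
    and HS: "\<And>t. t \<in> D \<Longrightarrow> H t \<in> salg" and ya: "\<And>t. y t \<in> alg"
    and yh: "\<And>i k. i < n \<Longrightarrow> k < n \<Longrightarrow> (\<lambda>t. y t $$ (i, k)) holomorphic_on D"
    and p0: "\<And>x. x \<in> alg \<Longrightarrow> f0 (lie_bracket (H 0) x) = f0 x"
    and p1: "\<And>x. x \<in> alg \<Longrightarrow> f1 (lie_bracket (H 1) x) = f1 x"
    and lax: "lax D y H"
    using exists_lax_path[OF lin one nd] by metis
  have H0e: "H 0 = mat_diag n e"
    using principal_unique[OF lin(1) nd(1) HS[OF D(3)] p0 H0] .
  obtain vs where vs: "set vs = V" using finite_list[of V] by (auto simp: V_def)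
  define P where "P v t = spectral n (H t) v (removeAll v vs)" for v t
  have Pl: "lax D y (P v)" for v unfolding P_def[abs_def] by (rule lax_spectral[OF lax ya])
  have P0: "P v 0 = mat_diag n (\<lambda>i. if e i = v then 1 else 0)" for v
    unfolding P_def H0e using vs by (intro spectral_diag_delta) (auto simp: V_def)
  have at_1: "X 1 = Z 1" if "lax D y X" "lax D y Z" "X 0 = Z 0" for X Z
  proof -
    note Xc = alg_carrier[OF lax_alg[OF that(1)]] and Zc = alg_carrier[OF lax_alg[OF that(2)]]
    have z: "X 1 - Z 1 = 0\<^sub>m n n"
      using lax_zero[OF lax_minus[OF that(1,2) ya] D(1,2) ya yh D(3) _ D(4)] that(3) Zc by simp
    show ?thesis
    proof (rule eq_mat_carrierI[OF Xc Zc])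
      fix i k assume ik: "i < n" "k < n"
      have "(X 1 - Z 1) $$ (i, k) = X 1 $$ (i, k) - Z 1 $$ (i, k)"
        using ik carrier_matD[OF Zc] by (intro index_minus_mat) auto
      then show "X 1 $$ (i, k) = Z 1 $$ (i, k)" using z ik by simp
    qed
  qed
  show thesis
  proof (rule that[of "H 1" "\<lambda>v. P v 1"])
    show "H 1 \<in> salg" using HS D by blast
    show "f1 (lie_bracket (H 1) x) = f1 x" if "x \<in> alg" for x using p1 that by blast
    show "P v 1 \<in> alg" for v using lax_alg[OF Pl] .
    show "H 1 * P v 1 = v \<cdot>\<^sub>m P v 1" for v
    proof (rule at_1)
      show "H 0 * P v 0 = v \<cdot>\<^sub>m P v 0"
        unfolding P0 H0e mat_diag_diag by (rule eq_mat_carrierI[of _ n]) (auto simp: mat_diag_def)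
    qed (intro lax_mult lax_smult lax Pl ya)+
    show "P v 1 * H 1 = v \<cdot>\<^sub>m P v 1" for v
    proof (rule at_1)
      show "P v 0 * H 0 = v \<cdot>\<^sub>m P v 0"
        unfolding P0 H0e mat_diag_diag by (rule eq_mat_carrierI[of _ n]) (auto simp: mat_diag_def)
    qed (intro lax_mult lax_smult lax Pl ya)+
    have finV: "finite V" by (simp add: V_def)
    show "mat_sum n (\<lambda>v. P v 1) V = 1\<^sub>m n"
    proof (rule at_1[where Z = "\<lambda>t. 1\<^sub>m n"])
      show "mat_sum n (\<lambda>v. P v 0) V = 1\<^sub>m n"
      proof (rule eq_mat_carrierI[of _ n])
        fix i k assume ik: "i < n" "k < n"
        have "e i \<in> V" using ik by (auto simp: V_def)
        then show "mat_sum n (\<lambda>v. P v 0) V $$ (i, k) = 1\<^sub>m n $$ (i, k)"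
          using ik finV by (cases "i = k") (simp_all add: mat_sum_index P0 mat_diag_def)
      qed auto
    qed (intro lax_mat_sum lax_one Pl ya finV)+
    show "block_trace p (P v 1) = (\<Sum>i | i < n \<and> blk i = p. if e i = v then 1 else 0)" for v p
    proof -
      have "block_trace p (P v 1) = block_trace p (P v 0)"
        by (rule lax_block_trace[OF Pl D(1,2) ya D(4,3)])
      then show ?thesis by (auto simp: P0 block_trace_def mat_diag_def intro!: sum.cong)
    qed
  qed
qed

definition mask :: "complex mat \<Rightarrow> complex mat" where
  "mask x = of_coeffs (\<lambda>q. x $$ q)"

lemma mask_alg: "mask x \<in> alg"
  by (simp add: mask_def of_coeffs_alg)

lemma mask_id: "x \<in> alg \<Longrightarrow> mask x = x"
  using alg_carrier alg_zero
  by (intro eq_mat_carrierI[of _ n]) (auto simp: mask_def of_coeffs_def)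

lemma mask_add: "x \<in> gl n \<Longrightarrow> y \<in> gl n \<Longrightarrow> mask (x + y) = mask x + mask y"
  and mask_smult: "x \<in> gl n \<Longrightarrow> mask (c \<cdot>\<^sub>m x) = c \<cdot>\<^sub>m mask x"
  by (auto simp: mask_def of_coeffs_def pos_def)

lemma sum_by_block:
  "(\<Sum>i | i < n \<and> Q (blk i). a i) = (\<Sum>p\<in>{p \<in> blk ` {..<n}. Q p}. \<Sum>i | i < n \<and> blk i = p. a i :: complex)"
proof -
  have "(\<Sum>p\<in>{p \<in> blk ` {..<n}. Q p}. \<Sum>i\<in>{i \<in> {i. i < n \<and> Q (blk i)}. blk i = p}. a i)
      = (\<Sum>i | i < n \<and> Q (blk i). a i)"
    by (rule sum.group) auto
  moreover have "{i \<in> {i. i < n \<and> Q (blk i)}. blk i = p} = {i. i < n \<and> blk i = p}"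
    if "p \<in> {p \<in> blk ` {..<n}. Q p}" for p using that by auto
  ultimately show ?thesis by simp
qed

lemma sum_pos_nested: "(\<Sum>(i, k)\<in>pos. a i * b k) = (\<Sum>k<n. b k * (\<Sum>i | i < n \<and> blk k \<le> blk i. a i :: complex))"
proof -
  have "(\<Sum>(i, k)\<in>pos. a i * b k) = (\<Sum>(k, i)\<in>(SIGMA k:{..<n}. {i. i < n \<and> blk k \<le> blk i}). a i * b k)"
    by (rule sum.reindex_bij_witness[of _ "\<lambda>(k, i). (i, k)" "\<lambda>(i, k). (k, i)"]) (auto simp: pos_def)
  also have "\<dots> = (\<Sum>k<n. \<Sum>i | i < n \<and> blk k \<le> blk i. a i * b k)"
    by (rule sum.Sigma[symmetric]) auto
  finally show ?thesis by (simp add: sum_distrib_left mult.commute)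
qed

lemma sum_pos_nested': "(\<Sum>(i, k)\<in>pos. a i * b k) = (\<Sum>i<n. a i * (\<Sum>k | k < n \<and> blk k \<le> blk i. b k :: complex))"
proof -
  have "(\<Sum>(i, k)\<in>pos. a i * b k) = (\<Sum>(i, k)\<in>(SIGMA i:{..<n}. {k. k < n \<and> blk k \<le> blk i}). a i * b k)"
    by (rule sum.cong) (auto simp: pos_def)
  also have "\<dots> = (\<Sum>i<n. \<Sum>k | k < n \<and> blk k \<le> blk i. a i * b k)"
    by (rule sum.Sigma[symmetric]) auto
  finally show ?thesis by (simp add: sum_distrib_left)
qed

text \<open>Whether \<open>(i, k)\<close> is a position of the algebra depends only on the blocks of \<open>i\<close> and \<open>k\<close>, so each factor may be
  summed over its block first.\<close>

lemma sum_pos_block_cong: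
  fixes a a' b b' :: "nat \<Rightarrow> complex"
  assumes "\<And>p. (\<Sum>i | i < n \<and> blk i = p. a i) = (\<Sum>i | i < n \<and> blk i = p. a' i)"
    and "\<And>p. (\<Sum>i | i < n \<and> blk i = p. b i) = (\<Sum>i | i < n \<and> blk i = p. b' i)"
  shows "(\<Sum>(i, k)\<in>pos. a i * b k) = (\<Sum>(i, k)\<in>pos. a' i * b' k)"
proof -
  have "(\<Sum>(i, k)\<in>pos. a i * b k) = (\<Sum>(i, k)\<in>pos. a' i * b k)"
    unfolding sum_pos_nested by (simp only: sum_by_block[where Q = "\<lambda>p. _ \<le> p"] assms(1))
  also have "\<dots> = (\<Sum>(i, k)\<in>pos. a' i * b' k)"
    unfolding sum_pos_nested' by (simp only: sum_by_block[where Q = "\<lambda>p. p \<le> _"] assms(2))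
  finally show ?thesis .
qed

lemma lie_bracket_mat_sum:
  assumes "h \<in> gl n" "\<And>s. s \<in> S \<Longrightarrow> f s \<in> gl n"
  shows "lie_bracket h (mat_sum n f S) = mat_sum n (\<lambda>s. lie_bracket h (f s)) S"
proof (rule eq_mat_carrierI[of _ n])
  fix i k assume ik: "i < n" "k < n"
  have "lie_bracket h (f s) $$ (i, k) = (h * f s) $$ (i, k) - (f s * h) $$ (i, k)" if "s \<in> S" for s
    unfolding lie_bracket_def using assms(1) assms(2)[OF that] ik by (intro index_minus_mat) auto
  moreover have "lie_bracket h (mat_sum n f S) $$ (i, k) = (h * mat_sum n f S) $$ (i, k) - (mat_sum n f S * h) $$ (i, k)"
    unfolding lie_bracket_def using assms(1) ik by (intro index_minus_mat) (auto simp: mat_sum_def)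
  ultimately show "lie_bracket h (mat_sum n f S) $$ (i, k) = mat_sum n (\<lambda>s. lie_bracket h (f s)) S $$ (i, k)"
    using ik by (simp add: mat_sum_mult_left[OF assms] mat_sum_mult_right[OF assms] mat_sum_index sum_subtractf
      del: index_mult_mat)
qed (use assms in auto)

text \<open>The maps \<open>x \<mapsto> P v x P u\<close> are commuting projections that split the algebra into simultaneous eigenspaces
  of left and right multiplication by \<open>H\<close>; those with \<open>v - u = c\<close> make up the eigenspace of the bracket with \<open>H\<close> for \<open>c\<close>. As
  \<open>c \<noteq> 0\<close>, an eigenvector is a multiple of a bracket and has trace zero.\<close>

lemma dim_eigenspace:
  assumes H: "H \<in> salg" and P: "\<And>v. P v \<in> alg"
    and HP: "\<And>v. v \<in> V \<Longrightarrow> H * P v = v \<cdot>\<^sub>m P v" and PH: "\<And>v. v \<in> V \<Longrightarrow> P v * H = v \<cdot>\<^sub>m P v"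
    and total: "mat_sum n P V = 1\<^sub>m n"
    and bt: "\<And>v p. v \<in> V \<Longrightarrow> block_trace p (P v) = (\<Sum>i | i < n \<and> blk i = p. if e i = v then 1 else 0)"
    and V: "V = e ` {..<n}" and c: "c \<noteq> 0"
  shows "cdim n {x \<in> salg. lie_bracket H x = c \<cdot>\<^sub>m x} = card {(i, k) \<in> pos. e i - e k = c}"
proof -
  define J where "J = {(v, u). v \<in> V \<and> u \<in> V \<and> v - u = c}"
  have finV: "finite V" by (simp add: V)
  have finJ: "finite J" by (rule finite_subset[of _ "V \<times> V"]) (auto simp: J_def finV)
  define W where "W = {x \<in> salg. lie_bracket H x = c \<cdot>\<^sub>m x}"
  define comp where "comp z = (\<lambda>(v, u). P v * (z * P u))" for z
  define \<pi> where "\<pi> x = mat_sum n (comp (mask x)) J" for x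
  define g where "g = (\<lambda>(i, k). if (i, k) \<in> pos then \<Sum>(v, u)\<in>J. P v $$ (i, i) * P u $$ (k, k) else 0)"
  note Hc = alg_carrier[OF salg_alg[OF H]] and Pc = alg_carrier[OF P]
  have comp_alg: "comp z q \<in> alg" if "z \<in> alg" for z q
    using that by (cases q) (auto simp: comp_def intro!: alg_mult P)
  note comp_c = alg_carrier[OF comp_alg]
  have bracket_comp: "lie_bracket H (comp z (v, u)) = (v - u) \<cdot>\<^sub>m comp z (v, u)"
    if z: "z \<in> alg" and vu: "v \<in> V" "u \<in> V" for z v u
  proof -
    note zc = alg_carrier[OF z]
    have zP: "z * P u \<in> gl n" by (rule mult_carrier_mat[OF zc Pc])
    have "H * (P v * (z * P u)) = v \<cdot>\<^sub>m (P v * (z * P u))"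
      using assoc_mult_mat[OF Hc Pc zP, of v, symmetric] HP[OF vu(1)] mult_smult_assoc_mat[OF Pc zP] by metis
    moreover have "P v * (z * P u) * H = u \<cdot>\<^sub>m (P v * (z * P u))"
    proof -
      have "P v * (z * P u) * H = P v * (z * (P u * H))"
        using assoc_mult_mat[OF Pc zP Hc, of v] assoc_mult_mat[OF zc Pc Hc, of u] by metis
      also have "\<dots> = P v * (u \<cdot>\<^sub>m (z * P u))"
        using PH[OF vu(2)] mult_smult_distrib[OF zc Pc, of u u] by metis
      also have "\<dots> = u \<cdot>\<^sub>m (P v * (z * P u))" by (rule mult_smult_distrib[OF Pc zP])
      finally show ?thesis .
    qed
    moreover have "v \<cdot>\<^sub>m Z - u \<cdot>\<^sub>m Z = (v - u) \<cdot>\<^sub>m Z" if "Z \<in> gl n" for Z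
      using that by (intro eq_mat_carrierI[of _ n]) (auto simp: algebra_simps)
    ultimately show ?thesis
      using comp_c[OF z, of "(v, u)"] unfolding lie_bracket_def comp_def by simp
  qed
  have "of_nat (cdim n W) = (\<Sum>i<n. \<Sum>k<n. \<pi> (elem_mat n i k) $$ (i, k))"
  proof (rule cdim_eq_trace_projection)
    show "W \<subseteq> gl n" using salg_alg alg_carrier by (auto simp: W_def)
    show "\<pi> x \<in> W" if x: "x \<in> gl n" for x
    proof -
      have "mat_sum n f S \<in> alg" if "\<And>s. s \<in> S \<Longrightarrow> f s \<in> alg" for f :: "complex \<times> complex \<Rightarrow> complex mat" and S
        unfolding alg_def using that alg_zero by (auto simp: mat_sum_index intro!: sum.neutral)
      then have pa: "\<pi> x \<in> alg" unfolding \<pi>_def using comp_alg[OF mask_alg] by blast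
      have "lie_bracket H (\<pi> x) = mat_sum n (\<lambda>s. c \<cdot>\<^sub>m comp (mask x) s) J"
        unfolding \<pi>_def
      proof (subst lie_bracket_mat_sum[OF Hc comp_c[OF mask_alg]], rule mat_sum_cong)
        fix s assume "s \<in> J"
        then obtain v u where "s = (v, u)" "v \<in> V" "u \<in> V" "v - u = c" by (auto simp: J_def)
        then show "lie_bracket H (comp (mask x) s) = c \<cdot>\<^sub>m comp (mask x) s"
          using bracket_comp[OF mask_alg, of v u x] by simp
      qed
      also have "\<dots> = c \<cdot>\<^sub>m \<pi> x" unfolding \<pi>_def by (rule mat_sum_smult[OF comp_c[OF mask_alg]])
      finally have b: "lie_bracket H (\<pi> x) = c \<cdot>\<^sub>m \<pi> x" .
      have "tr (c \<cdot>\<^sub>m \<pi> x) = 0"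
        using bracket_salg[OF salg_alg[OF H] pa] unfolding b by (simp add: salg_def)
      then have "tr (\<pi> x) = 0" using tr_smult[of "\<pi> x" c] alg_carrier[OF pa] c by simp
      then show ?thesis using pa b by (simp add: W_def salg_def)
    qed
    show "\<pi> (x + y) = \<pi> x + \<pi> y" if "x \<in> gl n" "y \<in> gl n" for x y
    proof -
      have "comp (mask (x + y)) s = comp (mask x) s + comp (mask y) s" for s
      proof (cases s)
        case (Pair v u)
        show ?thesis unfolding mask_add[OF that] comp_def Pair prod.case
          by (simp add: add_mult_distrib_mat[OF alg_carrier[OF mask_alg] alg_carrier[OF mask_alg] Pc]
              mult_add_distrib_mat[OF Pc mult_carrier_mat[OF alg_carrier[OF mask_alg] Pc]
                mult_carrier_mat[OF alg_carrier[OF mask_alg] Pc]])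
      qed
      then have "\<pi> (x + y) = mat_sum n (\<lambda>s. comp (mask x) s + comp (mask y) s) J"
        unfolding \<pi>_def by (intro mat_sum_cong)
      also have "\<dots> = \<pi> x + \<pi> y" unfolding \<pi>_def by (rule mat_sum_add[OF comp_c[OF mask_alg] comp_c[OF mask_alg]])
      finally show ?thesis .
    qed
    show "\<pi> (a \<cdot>\<^sub>m x) = a \<cdot>\<^sub>m \<pi> x" if "x \<in> gl n" for a x
    proof -
      have "comp (mask (a \<cdot>\<^sub>m x)) s = a \<cdot>\<^sub>m comp (mask x) s" for s
      proof (cases s)
        case (Pair v u)
        show ?thesis unfolding mask_smult[OF that] comp_def Pair prod.case
          by (simp add: mult_smult_assoc_mat[OF alg_carrier[OF mask_alg] Pc]
              mult_smult_distrib[OF Pc mult_carrier_mat[OF alg_carrier[OF mask_alg] Pc]])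
      qed
      then have "\<pi> (a \<cdot>\<^sub>m x) = mat_sum n (\<lambda>s. a \<cdot>\<^sub>m comp (mask x) s) J"
        unfolding \<pi>_def by (intro mat_sum_cong)
      also have "\<dots> = a \<cdot>\<^sub>m \<pi> x" unfolding \<pi>_def by (rule mat_sum_smult[OF comp_c[OF mask_alg]])
      finally show ?thesis .
    qed
    show "\<pi> x = x" if x: "x \<in> W" for x
    proof -
      have xs: "x \<in> salg" and xH: "lie_bracket H x = c \<cdot>\<^sub>m x" using x by (auto simp: W_def)
      have xa: "x \<in> alg" using xs by (rule salg_alg)
      note xc = alg_carrier[OF xa]
      \<comment> \<open>Multiplying \<open>[H, x] = c x\<close> by \<open>P v\<close> and \<open>P u\<close> gives \<open>(v - u) P v x P u = c P v x P u\<close>.\<close>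
      have vanish: "comp x (v, u) = 0\<^sub>m n n" if vu: "v \<in> V" "u \<in> V" "v - u \<noteq> c" for v u
      proof -
        have a1: "P v * (lie_bracket H x * P u) = (v - u) \<cdot>\<^sub>m comp x (v, u)"
        proof -
          have hx: "H * x \<in> gl n" and xh: "x * H \<in> gl n"
            using mult_carrier_mat[OF Hc xc] mult_carrier_mat[OF xc Hc] by auto
          have xP: "x * P u \<in> gl n" by (rule mult_carrier_mat[OF xc Pc])
          have "P v * (lie_bracket H x * P u) = P v * (H * x * P u) - P v * (x * H * P u)"
            unfolding lie_bracket_def minus_mult_distrib_mat[OF hx xh Pc]
            by (rule mult_minus_distrib_mat[OF Pc mult_carrier_mat[OF hx Pc] mult_carrier_mat[OF xh Pc]])
          also have "P v * (H * x * P u) = v \<cdot>\<^sub>m comp x (v, u)"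
          proof -
            have "P v * (H * x * P u) = (P v * H) * (x * P u)"
              using assoc_mult_mat[OF Hc xc Pc, of u] assoc_mult_mat[OF Pc Hc xP, of v] by metis
            then show ?thesis using PH[OF vu(1)] mult_smult_assoc_mat[OF Pc xP, of v v] by (simp add: comp_def)
          qed
          also have "P v * (x * H * P u) = u \<cdot>\<^sub>m comp x (v, u)"
          proof -
            have "x * H * P u = x * (u \<cdot>\<^sub>m P u)" using assoc_mult_mat[OF xc Hc Pc, of u] HP[OF vu(2)] by metis
            also have "\<dots> = u \<cdot>\<^sub>m (x * P u)" by (rule mult_smult_distrib[OF xc Pc])
            finally show ?thesis using mult_smult_distrib[OF Pc xP, of v u] by (simp add: comp_def)
          qed
          also have "v \<cdot>\<^sub>m comp x (v, u) - u \<cdot>\<^sub>m comp x (v, u) = (v - u) \<cdot>\<^sub>m comp x (v, u)"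
            using comp_c[OF xa, of "(v, u)"] by (intro eq_mat_carrierI[of _ n]) (auto simp: algebra_simps)
          finally show ?thesis .
        qed
        have a2: "P v * (lie_bracket H x * P u) = c \<cdot>\<^sub>m comp x (v, u)"
          unfolding xH comp_def prod.case mult_smult_assoc_mat[OF xc Pc]
          by (rule mult_smult_distrib[OF Pc mult_carrier_mat[OF xc Pc]])
        show ?thesis
        proof (rule eq_mat_carrierI[OF comp_c[OF xa]])
          fix i k assume ik: "i < n" "k < n"
          have "((v - u) \<cdot>\<^sub>m comp x (v, u)) $$ (i, k) = (c \<cdot>\<^sub>m comp x (v, u)) $$ (i, k)"
            using a1 a2 by simp
          then show "comp x (v, u) $$ (i, k) = 0\<^sub>m n n $$ (i, k)"
            using ik comp_c[OF xa, of "(v, u)"] vu(3) by simp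
        qed simp
      qed
      have "x = mat_sum n P V * (x * mat_sum n P V)" using xc total by simp
      also have "x * mat_sum n P V = mat_sum n (\<lambda>u. x * P u) V" by (rule mat_sum_mult_left[OF xc Pc])
      also have "mat_sum n P V * \<dots> = mat_sum n (\<lambda>v. P v * mat_sum n (\<lambda>u. x * P u) V) V"
        by (rule mat_sum_mult_right[OF mat_sum_carrier Pc])
      also have "\<dots> = mat_sum n (\<lambda>v. mat_sum n (\<lambda>u. comp x (v, u)) V) V"
        by (rule mat_sum_cong) (simp add: comp_def mat_sum_mult_left[OF Pc mult_carrier_mat[OF xc Pc]])
      also have "\<dots> = mat_sum n (comp x) J"
      proof (rule eq_mat_carrierI[of _ n])
        fix i k assume ik: "i < n" "k < n"
        have "mat_sum n (\<lambda>v. mat_sum n (\<lambda>u. comp x (v, u)) V) V $$ (i, k)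
            = (\<Sum>q\<in>V \<times> V. comp x q $$ (i, k))"
          using ik by (simp add: mat_sum_index sum.cartesian_product)
        also have "\<dots> = (\<Sum>q\<in>J. comp x q $$ (i, k))"
        proof (rule sum.mono_neutral_right)
          show "\<forall>q\<in>V \<times> V - J. comp x q $$ (i, k) = 0"
          proof
            fix q assume "q \<in> V \<times> V - J"
            then obtain v u where "q = (v, u)" "v \<in> V" "u \<in> V" "v - u \<noteq> c" by (auto simp: J_def)
            then show "comp x q $$ (i, k) = 0" using vanish[of v u] ik by simp
          qed
        qed (use finV in \<open>auto simp: J_def\<close>)
        finally show "mat_sum n (\<lambda>v. mat_sum n (\<lambda>u. comp x (v, u)) V) V $$ (i, k) = mat_sum n (comp x) J $$ (i, k)"
          using ik by (simp add: mat_sum_index)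
      qed auto
      finally show "\<pi> x = x" by (simp add: \<pi>_def mask_id[OF xa])
    qed
  qed
  also have "\<dots> = (\<Sum>i<n. \<Sum>k<n. g (i, k))"
  proof (intro sum.cong refl)
    fix i k assume "i \<in> {..<n}" "k \<in> {..<n}"
    then have ik: "i < n" "k < n" by auto
    have me: "mask (elem_mat n i k) $$ (a, b) = (if (i, k) \<in> pos \<and> a = i \<and> b = k then 1 else 0)"
      if "a < n" "b < n" for a b using that by (auto simp: mask_def of_coeffs_def)
    have "comp (mask (elem_mat n i k)) (v, u) $$ (i, k) = (if (i, k) \<in> pos then P v $$ (i, i) * P u $$ (k, k) else 0)"
      for v u
    proof -
      note mc = alg_carrier[OF mask_alg]
      have in1: "(mask (elem_mat n i k) * P u) $$ (l, k) = (if (i, k) \<in> pos \<and> l = i then P u $$ (k, k) else 0)"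
        if "l < n" for l
        unfolding mult_index_sum[OF mc Pc that ik(2)]
        using that ik by (auto simp: me if_distrib[where f = "\<lambda>x. x * _"] cong: if_cong)
      show ?thesis unfolding comp_def prod.case mult_index_sum[OF Pc mult_carrier_mat[OF mc Pc] ik]
        using ik by (simp add: in1 if_distrib[where f = "\<lambda>x. _ * x"] cong: if_cong del: index_mult_mat)
    qed
    then have "comp (mask (elem_mat n i k)) s $$ (i, k)
        = (if (i, k) \<in> pos then (case s of (v, u) \<Rightarrow> P v $$ (i, i) * P u $$ (k, k)) else 0)" for s
      by (cases s) simp
    then show "\<pi> (elem_mat n i k) $$ (i, k) = g (i, k)"
      unfolding \<pi>_def g_def mat_sum_index[OF ik] by simp
  qed
  also have "\<dots> = (\<Sum>q\<in>pos. g q)"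
    by (rule sum_pos) (auto simp: g_def)
  also have "\<dots> = (\<Sum>(i, k)\<in>pos. \<Sum>(v, u)\<in>J. P v $$ (i, i) * P u $$ (k, k))"
    by (rule sum.cong) (auto simp: g_def)
  also have "\<dots> = (\<Sum>(v, u)\<in>J. \<Sum>(i, k)\<in>pos. P v $$ (i, i) * P u $$ (k, k))"
    unfolding case_prod_beta by (rule sum.swap)
  also have "\<dots> = (\<Sum>(v, u)\<in>J. \<Sum>(i, k)\<in>pos. (if e i = v then 1 else 0) * (if e k = u then 1 else 0))"
  proof (rule sum.cong[OF refl], clarify)
    fix v u assume "(v, u) \<in> J"
    then have vu: "v \<in> V" "u \<in> V" by (auto simp: J_def)
    show "(\<Sum>(i, k)\<in>pos. P v $$ (i, i) * P u $$ (k, k))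
       = (\<Sum>(i, k)\<in>pos. (if e i = v then 1 else 0) * (if e k = u then 1 else 0))"
      by (rule sum_pos_block_cong) (use bt[OF vu(1)] bt[OF vu(2)] in \<open>auto simp: block_trace_def\<close>)
  qed
  also have "\<dots> = (\<Sum>(i, k)\<in>pos. \<Sum>(v, u)\<in>J. (if e i = v then 1 else 0) * (if e k = u then 1 else 0))"
    unfolding case_prod_beta by (rule sum.swap)
  also have "\<dots> = (\<Sum>(i, k)\<in>pos. if e i - e k = c then 1 else 0)"
  proof (rule sum.cong[OF refl], clarify)
    fix i k assume "(i, k) \<in> pos"
    then have ik: "e i \<in> V" "e k \<in> V" by (auto simp: pos_def V)
    have "(\<Sum>(v, u)\<in>J. (if e i = v then 1 else 0) * (if e k = u then 1 else 0))
        = (\<Sum>q\<in>J. if q = (e i, e k) then 1 else 0 :: complex)"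
      by (rule sum.cong) (auto split: if_splits)
    also have "\<dots> = (if e i - e k = c then 1 else 0)"
      using finJ ik by (simp add: J_def)
    finally show "(\<Sum>(v, u)\<in>J. (if e i = v then 1 else 0) * (if e k = u then 1 else 0))
        = (if e i - e k = c then 1 else 0 :: complex)" .
  qed
  also have "\<dots> = of_nat (card {(i, k) \<in> pos. e i - e k = c})"
  proof -
    have "(\<Sum>(i, k)\<in>pos. if e i - e k = c then 1 else 0 :: complex) = (\<Sum>q\<in>{(i, k) \<in> pos. e i - e k = c}. 1)"
      by (rule sum.mono_neutral_cong_right) (auto split: if_splits)
    then show ?thesis by simp
  qed
  finally show ?thesis unfolding W_def by (simp only: of_nat_eq_iff)
qed

text \<open>The projection of all matrices onto \<open>salg\<close>. Composing with it extends a functional on \<open>salg\<close> to all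
  matrices without changing the brackets, since the identity is central.\<close>

definition proj :: "complex mat \<Rightarrow> complex mat" where
  "proj x = mask x - (tr x / of_nat n) \<cdot>\<^sub>m 1\<^sub>m n"

lemma tr_mask: "tr (mask x) = tr x"
  by (auto simp: tr_def mask_def of_coeffs_def pos_def)

lemma proj_salg: "x \<in> gl n \<Longrightarrow> proj x \<in> salg"
  using n_pos by (simp add: proj_def salg_def mask_alg alg_minus alg_smult alg_one tr_mask tr_one
      tr_minus[OF alg_carrier[OF mask_alg] smult_carrier_mat[OF one_carrier_mat]]
      tr_smult[OF one_carrier_mat])

lemma proj_id: "x \<in> salg \<Longrightarrow> proj x = x"
  using alg_carrier[OF salg_alg, of x]
  by (auto simp: proj_def salg_def mask_id intro!: eq_mat_carrierI[of _ n])

lemma proj_add: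
  assumes "x \<in> gl n" "y \<in> gl n"
  shows "proj (x + y) = proj x + proj y"
  using alg_carrier[OF mask_alg[of x]] alg_carrier[OF mask_alg[of y]]
  by (auto simp: proj_def mask_add[OF assms] tr_add[OF assms] add_divide_distrib algebra_simps
      intro!: eq_mat_carrierI[of _ n])

lemma proj_smult:
  assumes "x \<in> gl n"
  shows "proj (c \<cdot>\<^sub>m x) = c \<cdot>\<^sub>m proj x"
  using alg_carrier[OF mask_alg[of x]]
  by (auto simp: proj_def mask_smult[OF assms] tr_smult[OF assms] algebra_simps
      intro!: eq_mat_carrierI[of _ n])

lemma proj_bracket:
  assumes "h \<in> alg" "x \<in> alg"
  shows "lie_bracket h (proj x) = lie_bracket h x"
proof -
  note c = alg_carrier[OF assms(1)] alg_carrier[OF assms(2)]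
  have "x = proj x + (tr x / of_nat n) \<cdot>\<^sub>m 1\<^sub>m n"
    unfolding proj_def mask_id[OF assms(2)] using c by (intro eq_mat_carrierI[of _ n]) auto
  then have "lie_bracket h x = lie_bracket h (proj x) + lie_bracket h ((tr x / of_nat n) \<cdot>\<^sub>m 1\<^sub>m n)"
    using lie_bracket_add_right[OF c(1) alg_carrier[OF salg_alg[OF proj_salg[OF c(2)]]], of "(tr x / of_nat n) \<cdot>\<^sub>m 1\<^sub>m n"]
    by simp
  also have "lie_bracket h ((tr x / of_nat n) \<cdot>\<^sub>m 1\<^sub>m n) = 0\<^sub>m n n"
    using lie_bracket_smult_right[OF c(1) one_carrier_mat] c by simp
  finally show ?thesis using c alg_carrier[OF salg_alg[OF proj_salg[OF c(2)]]] by simp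
qed

lemma proj_one: "proj (1\<^sub>m n) = 0\<^sub>m n n"
  using n_pos by (auto simp: proj_def mask_id alg_one tr_one intro!: eq_mat_carrierI[of _ n])

lemma salg_zero: "0\<^sub>m n n \<in> salg"
  by (simp add: salg_def alg_zero_mat) (simp add: tr_def)

lemma salg_add: "x \<in> salg \<Longrightarrow> y \<in> salg \<Longrightarrow> x + y \<in> salg"
  using alg_carrier by (simp add: salg_def alg_add tr_add)

lemma salg_smult: "x \<in> salg \<Longrightarrow> c \<cdot>\<^sub>m x \<in> salg"
  using alg_carrier by (simp add: salg_def alg_smult tr_smult)

lemma lie_subalgebra_salg: "lie_subalgebra n salg"
proof -
  have "LinearCombinations.submodule class_ring salg (gl_space n)"
    using salg_zero salg_add salg_smult salg_alg alg_carrier by (intro submodule_glI) auto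
  moreover have "vectorspace class_ring (gl_space n)" by (rule matrix_vs)
  ultimately show ?thesis using bracket_salg salg_alg
    unfolding lie_subalgebra_def by (auto simp: VectorSpace.subspace_def)
qed

lemma cdim_salg: "cdim n salg = card pos - 1"
proof -
  have "of_nat (cdim n salg) = (\<Sum>i<n. \<Sum>k<n. proj (elem_mat n i k) $$ (i, k))"
    using proj_salg proj_add proj_smult proj_id salg_alg alg_carrier
    by (intro cdim_eq_trace_projection) auto
  also have "\<dots> = (\<Sum>i<n. \<Sum>k<n. (if (i, k) \<in> pos then 1 else 0) - (if i = k then 1 / of_nat n else 0))"
  proof (intro sum.cong refl)
    fix i k assume ik: "i \<in> {..<n}" "k \<in> {..<n}"
    have "tr (elem_mat n i k) = (if i = k then 1 else 0)" using ik by (simp add: tr_def)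
    then show "proj (elem_mat n i k) $$ (i, k) = (if (i, k) \<in> pos then 1 else 0) - (if i = k then 1 / of_nat n else 0)"
      using ik by (auto simp: proj_def mask_def of_coeffs_def)
  qed
  also have "\<dots> = (\<Sum>i<n. \<Sum>k<n. (\<lambda>q. if q \<in> pos then 1 else 0) (i, k)) - 1"
    using n_pos by (simp add: sum_subtractf)
  also have "(\<Sum>i<n. \<Sum>k<n. (\<lambda>q. if q \<in> pos then 1 else 0) (i, k)) = (of_nat (card pos) :: complex)"
    by (subst sum_pos) auto
  also have "of_nat (card pos) - 1 = (of_nat (card pos - 1) :: complex)"
  proof -
    have "(0, 0) \<in> pos" using n_pos by (auto simp: pos_def)
    then have "card pos \<ge> 1" by (metis One_nat_def Suc_leI card_gt_0_iff empty_iff finite_pos)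
    then show ?thesis by (simp add: of_nat_diff)
  qed
  finally show ?thesis by (simp only: of_nat_eq_iff)
qed

lemma frobenius_functional_extend:
  assumes "frobenius_functional n salg F"
  shows "linear_on_mats n (\<lambda>x. F (proj x))" "F (proj (1\<^sub>m n)) = 0" "nondegenerate (\<lambda>x. F (proj x))"
proof -
  have add: "F (x + y) = F x + F y" if "x \<in> salg" "y \<in> salg" for x y
    using assms that unfolding frobenius_functional_def functional_on_def by auto
  have sm: "F (c \<cdot>\<^sub>m x) = c * F x" if "x \<in> salg" for x c
    using assms that unfolding frobenius_functional_def functional_on_def by auto
  show "linear_on_mats n (\<lambda>x. F (proj x))"
    unfolding linear_on_mats_def using proj_add proj_smult proj_salg add sm by auto
  show "F (proj (1\<^sub>m n)) = 0" unfolding proj_one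
    using sm[OF salg_zero, of 0] by simp
  show "nondegenerate (\<lambda>x. F (proj x))"
    unfolding nondegenerate_def
  proof (intro ballI impI)
    fix x assume x: "x \<in> salg" and z: "\<forall>y\<in>alg. F (proj (lie_bracket x y)) = 0"
    have "kirillov_form F x y = 0" if "y \<in> salg" for y
      using z salg_alg[OF that] proj_id[OF bracket_salg[OF salg_alg[OF x] salg_alg[OF that]]]
      by (auto simp: kirillov_form_def)
    then show "x = 0\<^sub>m n n" using assms x unfolding frobenius_functional_def by blast
  qed
qed

lemma frobenius_functionalI:
  assumes "linear_on_mats n f" "nondegenerate f"
  shows "frobenius_functional n salg f"
proof -
  have "functional_on salg f"
    using assms(1) alg_carrier salg_alg unfolding functional_on_def linear_on_mats_def by blast
  moreover have "x = 0\<^sub>m n n" if x: "x \<in> salg" and z: "\<forall>y\<in>salg. kirillov_form f x y = 0" for x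
  proof -
    have "f (lie_bracket x y) = 0" if "y \<in> alg" for y
      using z proj_salg[OF alg_carrier[OF that]] proj_bracket[OF salg_alg[OF x] that]
      by (auto simp: kirillov_form_def)
    then show ?thesis using assms(2) x unfolding nondegenerate_def by blast
  qed
  ultimately show ?thesis unfolding frobenius_functional_def by blast
qed

text \<open>One functional with a diagonal principal element determines the multiplicities for all of them.\<close>

lemma principal_mult_eq_card:
  assumes lin: "linear_on_mats n f0" and one: "f0 (1\<^sub>m n) = 0" and nd: "nondegenerate f0"
    and H0: "mat_diag n e \<in> salg" "\<And>x. x \<in> alg \<Longrightarrow> f0 (lie_bracket (mat_diag n e) x) = f0 x"
    and F: "frobenius_functional n salg F" and j: "j \<noteq> 0"
  shows "principal_mult n salg F j = card {(i, k) \<in> pos. e i - e k = of_int j}"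
proof -
  note ext = frobenius_functional_extend[OF F]
  obtain H P where H: "H \<in> salg" "\<And>x. x \<in> alg \<Longrightarrow> F (proj (lie_bracket H x)) = F (proj x)"
    and P: "\<And>v. P v \<in> alg"
    "\<And>v. v \<in> e ` {..<n} \<Longrightarrow> H * P v = v \<cdot>\<^sub>m P v" "\<And>v. v \<in> e ` {..<n} \<Longrightarrow> P v * H = v \<cdot>\<^sub>m P v"
    "mat_sum n P (e ` {..<n}) = 1\<^sub>m n"
    "\<And>v p. v \<in> e ` {..<n} \<Longrightarrow> block_trace p (P v) = (\<Sum>i | i < n \<and> blk i = p. if e i = v then 1 else 0)"
    by (rule spectral_family[OF lin ext(1) one ext(2) nd ext(3) H0]) (assumption, rule that, assumption+)
  have "principal_element salg F = H"
    unfolding principal_element_def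
  proof (rule the_equality)
    have "F (lie_bracket H x) = F x" if "x \<in> salg" for x
      using H(2)[OF salg_alg[OF that]] proj_id[OF that]
        proj_id[OF bracket_salg[OF salg_alg[OF H(1)] salg_alg[OF that]]] by simp
    then show "H \<in> salg \<and> (\<forall>x\<in>salg. F (lie_bracket H x) = F x)" using H(1) by blast
    fix K assume K: "K \<in> salg \<and> (\<forall>x\<in>salg. F (lie_bracket K x) = F x)"
    have "F (proj (lie_bracket K x)) = F (proj x)" if "x \<in> alg" for x
    proof -
      have "F (lie_bracket K (proj x)) = F (proj x)"
        using K proj_salg[OF alg_carrier[OF that]] by blast
      then show ?thesis
        using proj_bracket[OF salg_alg that, of K] proj_id[OF bracket_salg[OF salg_alg that, of K]] K by simp
    qed
    then show "K = H" using principal_unique[OF ext(1,3) _ _ H, of K] K by blast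
  qed
  then show ?thesis
    unfolding principal_mult_def principal_component_def
    using dim_eigenspace[OF H(1) P refl, of "of_int j"] j by simp
qed

end

section \<open>Contraction of meander systems\<close>

text \<open>Intervals are cut into consecutive parts starting at the integer \<open>s\<close>. Integer indices and a variable
  starting point let a contraction delete an initial part without renumbering the rest.\<close>

fun same_part :: "int \<Rightarrow> nat list \<Rightarrow> int \<Rightarrow> int \<Rightarrow> bool" where
  "same_part s [] i k = False"
| "same_part s (a # A) i k =
     ((s \<le> i \<and> i < s + int a \<and> s \<le> k \<and> k < s + int a) \<or> same_part (s + int a) A i k)"

fun reflect :: "int \<Rightarrow> nat list \<Rightarrow> int \<Rightarrow> int" where
  "reflect s [] i = i"
| "reflect s (a # A) i = (if i < s + int a then 2 * s + int a - 1 - i else reflect (s + int a) A i)"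

definition allowed :: "int \<Rightarrow> nat list \<Rightarrow> nat list \<Rightarrow> int \<Rightarrow> int \<Rightarrow> bool" where
  "allowed s A B i k \<longleftrightarrow> k \<le> i \<and> same_part s A i k \<or> i \<le> k \<and> same_part s B i k"

text \<open>The value of the meander functional on the bracket of \<open>X\<close> with the matrix unit at position \<open>(i, k)\<close>, set equal to zero:
  arcs of \<open>A\<close> contribute their entries below the diagonal and arcs of \<open>B\<close> those above it.\<close>

definition kernel_eq :: "int \<Rightarrow> nat list \<Rightarrow> nat list \<Rightarrow> (int \<Rightarrow> int \<Rightarrow> complex) \<Rightarrow> int \<Rightarrow> int \<Rightarrow> bool" where
  "kernel_eq s A B X i k \<longleftrightarrow>
     (if k < reflect s A k then X (reflect s A k) i else 0) +
     (if reflect s B k < k then X (reflect s B k) i else 0) =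
     (if reflect s A i < i then X k (reflect s A i) else 0) +
     (if i < reflect s B i then X k (reflect s B i) else 0)"

abbreviation scalar_on :: "int \<Rightarrow> nat \<Rightarrow> (int \<Rightarrow> int \<Rightarrow> complex) \<Rightarrow> bool" where
  "scalar_on s n X \<equiv>
     (\<forall>i k. i \<noteq> k \<longrightarrow> X i k = 0) \<and> (\<exists>c. \<forall>i. s \<le> i \<and> i < s + int n \<longrightarrow> X i i = c)"

definition rigid :: "nat list \<Rightarrow> nat list \<Rightarrow> bool" where
  "rigid A B \<longleftrightarrow> sum_list A = sum_list B \<and>
     (\<forall>s X. (\<forall>i k. \<not> allowed s A B i k \<longrightarrow> X i k = 0) \<longrightarrow>
            (\<forall>i k. allowed s A B i k \<longrightarrow> kernel_eq s A B X i k) \<longrightarrow>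
            scalar_on s (sum_list A) X)"

lemma same_part_range:
  "same_part s A i k \<Longrightarrow> s \<le> i \<and> s \<le> k \<and> i < s + int (sum_list A) \<and> k < s + int (sum_list A)"
  by (induction s A i k rule: same_part.induct) auto

lemma allowed_ge: "allowed s A B i k \<Longrightarrow> s \<le> i \<and> s \<le> k"
  using same_part_range[of s A i k] same_part_range[of s B i k] by (auto simp: allowed_def)

lemma reflect_ge: "s \<le> i \<Longrightarrow> s \<le> reflect s A i"
  by (induction s A i rule: reflect.induct) force+

lemma reflect_less: "i < s + int (sum_list A) \<Longrightarrow> s \<le> i \<Longrightarrow> reflect s A i < s + int (sum_list A)"
  by (induction s A i rule: reflect.induct) (auto simp: add.assoc)

lemma same_part_commute: "same_part s A i k = same_part s A k i"
  by (induction s A i k rule: same_part.induct) auto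

lemma rigidD:
  assumes "rigid A B" "\<And>i k. \<not> allowed s A B i k \<Longrightarrow> X i k = 0"
    "\<And>i k. allowed s A B i k \<Longrightarrow> kernel_eq s A B X i k"
  shows "scalar_on s (sum_list A) X"
  using assms unfolding rigid_def by blast

lemma rigid_sum_list: "rigid A B \<Longrightarrow> sum_list A = sum_list B"
  unfolding rigid_def by (rule conjunct1)

lemma rigidI:
  assumes "sum_list A = sum_list B"
    "\<And>s X. (\<And>i k. \<not> allowed s A B i k \<Longrightarrow> X i k = 0) \<Longrightarrow>
       (\<And>i k. allowed s A B i k \<Longrightarrow> kernel_eq s A B X i k) \<Longrightarrow>
       scalar_on s (sum_list A) X"
  shows "rigid A B"
  unfolding rigid_def using assms by blast

text \<open>Transposition exchanges the two compositions.\<close>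

lemma rigid_flip: assumes "rigid A B" shows "rigid B A"
proof (rule rigidI)
  show sums: "sum_list B = sum_list A" using rigid_sum_list[OF assms] by simp
  fix s X
  assume supp: "\<And>i k. \<not> allowed s B A i k \<Longrightarrow> X i k = 0"
    and eqs: "\<And>i k. allowed s B A i k \<Longrightarrow> kernel_eq s B A X i k"
  have al: "allowed s B A p q = allowed s A B q p" for p q
    unfolding allowed_def using same_part_commute by blast
  have ke: "kernel_eq s A B (\<lambda>p q. X q p) q p" if "kernel_eq s B A X p q" for p q
    using that unfolding kernel_eq_def by (simp add: add.commute)
  show "scalar_on s (sum_list B) X"
    using rigidD[OF assms, of s "\<lambda>p q. X q p"] supp eqs al ke sums by auto
qed

text \<open>Let \<open>C\<close> and \<open>L\<close> be the first and the last \<open>b\<close> indices of the part \<open>a\<close>, exchanged by its reflection \<open>w\<close>. The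
  equations at \<open>(i, k)\<close> with \<open>k\<close> in \<open>C\<close> show that the rows in \<open>L\<close> vanish on the middle columns (\<open>step1\<close>), that the
  blocks at \<open>C\<close> and \<open>L\<close> correspond under \<open>w\<close> (\<open>step2\<close>), and that the block of rows \<open>L\<close> and columns \<open>C\<close> is given by
  the block at \<open>C\<close> (\<open>step3\<close>). Substituting this into the equations outside \<open>C\<close> gives exactly the system of the
  contracted seaweed: on the new part \<open>L\<close> the old reflection \<open>\<sigma>\<close> of the deleted part reappears, conjugated by
  \<open>w\<close>.\<close>

lemma rigid_contract:
  assumes rig: "rigid ((a - 2 * b) # b # A) B" and ab: "2 * b \<le> a"
  shows "rigid (a # A) (b # B)"
proof -
  have sums: "sum_list (a # A) = sum_list (b # B)"
  proof -
    have "sum_list ((a - 2 * b) # b # A) = sum_list B" using rig by (simp only: rigid_def)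
    then show ?thesis using ab by simp
  qed
  have scalar: "scalar_on s (sum_list (a # A)) X"
    if supp: "\<And>i k. \<not> allowed s (a # A) (b # B) i k \<Longrightarrow> X i k = 0"
      and eqs: "\<And>i k. allowed s (a # A) (b # B) i k \<Longrightarrow> kernel_eq s (a # A) (b # B) X i k"
    for s X
  proof -
    define w where "w = reflect s (a # A)"
    define \<sigma> where "\<sigma> = reflect s (b # B)"
    define A' where "A' = (a - 2 * b) # b # A"
    define s' where "s' = s + int b"
    define w' where "w' = reflect s' A'"
    have ia: "int (a - 2 * b) = int a - 2 * int b" using ab by simp
    have w1: "w i = 2 * s + int a - 1 - i" if "i < s + int a" for i using that by (simp add: w_def)
    have w2: "w i = reflect (s + int a) A i" if "i \<ge> s + int a" for i using that by (simp add: w_def)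
    have w'1: "w' i = 2 * s + int a - 1 - i" if "i < s + int a - int b" for i
      using that by (simp add: w'_def A'_def ia s'_def)
    have w'2: "w' i = 2 * s + 2 * int a - int b - 1 - i" if "i < s + int a" "i \<ge> s + int a - int b" for i
      using that by (simp add: w'_def A'_def ia s'_def)
    have w'3: "w' i = reflect (s + int a) A i" if "i \<ge> s + int a" for i
      using that by (simp add: w'_def A'_def ia s'_def)
    have sg1: "\<sigma> i = 2 * s + int b - 1 - i" if "i < s + int b" for i using that by (simp add: \<sigma>_def)
    have sg2: "\<sigma> i = reflect s' B i" if "i \<ge> s + int b" for i using that by (simp add: \<sigma>_def s'_def)
    have sgge: "\<sigma> i \<ge> s + int b" if "i \<ge> s + int b" for i
      using sg2[OF that] reflect_ge[of s' i B] that by (simp add: s'_def)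
    have sA: "same_part s (a # A) i k \<longleftrightarrow>
       (s \<le> i \<and> i < s + int a \<and> s \<le> k \<and> k < s + int a) \<or> same_part (s + int a) A i k" for i k by simp
    have sA': "same_part s' A' i k \<longleftrightarrow>
       (s + int b \<le> i \<and> i < s + int a - int b \<and> s + int b \<le> k \<and> k < s + int a - int b) \<or>
       (s + int a - int b \<le> i \<and> i < s + int a \<and> s + int a - int b \<le> k \<and> k < s + int a) \<or>
       same_part (s + int a) A i k" for i k
      by (simp add: A'_def s'_def ia)
    have sB: "same_part s (b # B) i k \<longleftrightarrow>
       (s \<le> i \<and> i < s + int b \<and> s \<le> k \<and> k < s + int b) \<or> same_part s' B i k" for i k
      by (simp add: s'_def)
    have rA: "s + int a \<le> i \<and> s + int a \<le> k" if "same_part (s + int a) A i k" for i k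
      using same_part_range[OF that] by simp
    have rB: "s + int b \<le> i \<and> s + int b \<le> k" if "same_part s' B i k" for i k
      using same_part_range[OF that] by (simp add: s'_def)
    have abi: "2 * int b \<le> int a" using ab by simp
    have eq: "(if k < w k then X (w k) i else 0) + (if \<sigma> k < k then X (\<sigma> k) i else 0)
        = (if w i < i then X k (w i) else 0) + (if i < \<sigma> i then X k (\<sigma> i) else 0)"
      if "allowed s (a # A) (b # B) i k" for i k
      using eqs[OF that] unfolding kernel_eq_def w_def \<sigma>_def .
    have z1: "X i k = 0" if "i < s + int b" "k \<ge> s + int b" for i k
      using that rA[of i k] rB[of i k] abi
      by (intro supp) (auto simp del: same_part.simps simp: allowed_def sA sB)
    have z2: "X k i = 0" if "i < s + int a" "k \<ge> s + int a" for i k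
      using that rA[of k i] by (intro supp) (auto simp del: same_part.simps simp: allowed_def sA sB dest: rB)
    have low: "allowed s (a # A) (b # B) i k" if "k \<le> i" "s \<le> k" "i < s + int a" for i k
      using that by (auto simp: allowed_def)
    \<comment> \<open>Equations at \<open>(i, w l)\<close>: every other term has its row in \<open>C\<close> and its column outside, where \<open>X\<close> vanishes.\<close>
    have step1: "X l i = 0" if "s + int a - int b \<le> l" "l < s + int a"
        "s + int b \<le> i" "i < s + int a - int b" for l i
    proof -
      define k where "k = w l"
      have k: "s \<le> k" "k < s + int b" "w k = l" using that w1[of l] w1[of k] by (auto simp: k_def w1)
      have "allowed s (a # A) (b # B) i k" using that k by (intro low) auto
      note e = eq[OF this]
      have "X (\<sigma> k) i = 0" using k that sg1[of k] by (intro z1) auto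
      moreover have "X k (w i) = 0" using k that w1[of i] by (intro z1) auto
      moreover have "X k (\<sigma> i) = 0" using k that sgge[of i] by (intro z1) auto
      ultimately show ?thesis using e k that by (auto split: if_splits)
    qed
    have step2: "X (w k) (w i) = X k i" if "s \<le> k" "k < s + int b" "s \<le> i" "i < s + int b" for k i
    proof -
      have wi: "w i = 2 * s + int a - 1 - i" "w k = 2 * s + int a - 1 - k" "w (w i) = i"
        using that abi w1[of i] w1[of k] w1[of "w i"] by auto
      have "allowed s (a # A) (b # B) (w i) k" using that wi abi by (intro low) auto
      note e = eq[OF this]
      have "X (\<sigma> k) (w i) = 0" using that wi abi sg1[of k] by (intro z1) auto
      moreover have "X k (\<sigma> (w i)) = 0" using that wi abi sgge[of "w i"] by (intro z1) auto
      moreover have "k < w k" "i < w i" using that wi abi by auto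
      ultimately show ?thesis using e wi(3) by (auto split: if_splits)
    qed
    have step3: "X (w k) i = (if i < \<sigma> i then X k (\<sigma> i) else 0) - (if \<sigma> k < k then X (\<sigma> k) i else 0)"
      if "s \<le> k" "k < s + int b" "s \<le> i" "i < s + int b" for k i
    proof -
      have wi: "k < w k" "\<not> w i < i"
        using that abi w1[of i] w1[of k] by auto
      have "allowed s (a # A) (b # B) i k" using that abi by (auto simp: allowed_def)
      from eq[OF this] wi show ?thesis by (auto simp: algebra_simps)
    qed
    define X' where "X' i k = (if s + int b \<le> i \<and> s + int b \<le> k then X i k else 0)" for i k
    have supp': "X' i k = 0" if "\<not> allowed s' A' B i k" for i k
    proof (rule ccontr)
      assume "X' i k \<noteq> 0"
      then have X: "X i k \<noteq> 0" "s + int b \<le> i" "s + int b \<le> k" by (auto simp: X'_def split: if_splits)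
      then have "allowed s (a # A) (b # B) i k" using supp by blast
      then show False using that X step1[of i k] unfolding allowed_def sA sA' sB by auto
    qed
    have eq': "kernel_eq s' A' B X' i k" if al: "allowed s' A' B i k" for i k
    proof -
      have ge: "s + int b \<le> i" "s + int b \<le> k"
        using al rA[of i k] rB[of i k] abi unfolding allowed_def sA' by auto
      have al': "allowed s (a # A) (b # B) i k"
        using al abi unfolding allowed_def sA sA' sB by auto
      note e = eq[OF al']
      have w'ge: "w' j \<ge> s + int b" if "j \<ge> s + int b" for j
        using that w'1[of j] w'2[of j] w'3[of j] reflect_ge[of "s + int a" j A] abi
        by (cases "j < s + int a"; cases "j < s + int a - int b") auto
      have t24: "reflect s' B k = \<sigma> k" "reflect s' B i = \<sigma> i" using sg2 ge by auto
      have X'X: "X' p q = X p q" if "p \<ge> s + int b" "q \<ge> s + int b" for p q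
        using that by (simp add: X'_def)
      have key: "p' + q = r' + u" if "p + q = r + u" "p - r = p' - r'" for p q r u p' r' :: complex
      proof -
        have "p' = p - r + r'" using that(2) by simp
        then have "p' + q = (p + q) - r + r'" by simp
        also have "\<dots> = r' + u" unfolding that(1) by simp
        finally show ?thesis .
      qed
      \<comment> \<open>Only the terms of the top composition change; the two reflections differ on \<open>L\<close> alone.\<close>
      have main: "(if k < w k then X (w k) i else 0) - (if w i < i then X k (w i) else 0) =
         (if k < w' k then X (w' k) i else 0) - (if w' i < i then X k (w' i) else 0)"
      proof -
        define inL where "inL j \<longleftrightarrow> s + int a - int b \<le> j \<and> j < s + int a" for j
        have same: "w' j = w j" if "s + int b \<le> j" "\<not> inL j" for j
          using that w1[of j] w2[of j] w'1[of j] w'3[of j] by (cases "j < s + int a") (auto simp: inL_def)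
        have Lw: "s \<le> w j" "w j < s + int b" "w j < j" "w (w j) = j" "w' j = w (\<sigma> (w j))"
             "\<sigma> (w j) < s + int b" "s \<le> \<sigma> (w j)" "j < w' j \<longleftrightarrow> \<sigma> (w j) < w j" "w' j < j \<longleftrightarrow> w j < \<sigma> (w j)"
             "inL (w' j)"
          if "inL j" for j
          using that abi w1[of j] w1[of "w j"] sg1[of "w j"] w1[of "\<sigma> (w j)"] w'2[of j]
          by (auto simp: inL_def)
        consider "\<not> inL i" "\<not> inL k" | "inL k" "\<not> inL i" | "inL i" "\<not> inL k" | "inL i" "inL k" by blast
        then show ?thesis
        proof cases
          case 1
          then show ?thesis using same ge by simp
        next
          case 2
          have "i < s + int a - int b"
            using 2 al rA[of i k] unfolding allowed_def sA' inL_def by auto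
          then have "X (w' k) i = 0" using Lw(10)[OF 2(1)] ge by (intro step1) (auto simp: inL_def)
          then show ?thesis using same[OF ge(1) 2(2)] Lw(3)[OF 2(1)] by simp
        next
          case 3
          have "k \<ge> s + int a"
            using 3 al rA[of i k] ge unfolding allowed_def sA' inL_def by auto
          then have "X k (w i) = 0" "X k (w' i) = 0"
            using Lw(2,10)[OF 3(1)] abi by (auto intro!: z2 simp: inL_def)
          then show ?thesis using same[OF ge(2) 3(2)] by simp
        next
          case 4
          note Li = Lw[OF 4(1)] and Lk = Lw[OF 4(2)]
          have "X k (w i) = (if w i < \<sigma> (w i) then X (w k) (\<sigma> (w i)) else 0)
              - (if \<sigma> (w k) < w k then X (\<sigma> (w k)) (w i) else 0)"
            using step3[of "w k" "w i"] Li Lk by simp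
          moreover have "X (w k) (\<sigma> (w i)) = X k (w' i)"
            using step2[of "w k" "\<sigma> (w i)"] Li Lk by simp
          moreover have "X (\<sigma> (w k)) (w i) = X (w' k) i"
            using step2[of "\<sigma> (w k)" "w i"] Li Lk by simp
          ultimately show ?thesis using Li(3,8,9) Lk(3,8,9) by simp
        qed
      qed
      show ?thesis
        unfolding kernel_eq_def t24 w'_def[symmetric]
          X'X[OF w'ge[OF ge(2)] ge(1)] X'X[OF sgge[OF ge(2)] ge(1)]
          X'X[OF ge(2) w'ge[OF ge(1)]] X'X[OF ge(2) sgge[OF ge(1)]]
        using key[OF e main] .
    qed
    obtain c where off: "\<And>i k. i \<noteq> k \<Longrightarrow> X' i k = 0"
      and diag: "\<And>i. s' \<le> i \<Longrightarrow> i < s' + int (sum_list A') \<Longrightarrow> X' i i = c"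
      using rigidD[OF rig[folded A'_def], of s' X'] supp' eq' by auto
    have off': "X i k = 0" if "i \<noteq> k" "s + int b \<le> i" "s + int b \<le> k" for i k
      using off[OF that(1)] that by (simp add: X'_def)
    have len: "s' + int (sum_list A') = s + int (sum_list (a # A))"
      by (simp add: A'_def s'_def ia)
    have diag': "X i i = c" if "s + int b \<le> i" "i < s + int (sum_list (a # A))" for i
      using diag[of i] that len by (simp add: X'_def s'_def)
    have wC: "w i = 2 * s + int a - 1 - i" "s + int b \<le> w i" "w (w i) = i" "w i < s + int a"
      if "s \<le> i" "i < s + int b" for i
      using that abi w1[of i] w1[of "w i"] by auto
    \<comment> \<open>The scalar found for the contracted system is carried back to \<open>C\<close> by \<open>step2\<close>.\<close>
    have CC: "X i k = (if i = k then c else 0)" if "s \<le> i" "i < s + int b" "s \<le> k" "k < s + int b" for i k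
      using step2[of i k] that wC[of i] wC[of k] off'[of "w i" "w k"] diag'[of "w i"] by auto
    have "X i k = 0" if "i \<noteq> k" for i k
    proof (cases "s \<le> i \<and> s \<le> k \<and> s + int b \<le> i \<and> k < s + int b")
      case False
      have "X i k = 0" if "i < s \<or> k < s"
        using that rA[of i k] rB[of i k]
        by (intro supp) (auto simp del: same_part.simps simp: allowed_def sA sB)
      then show ?thesis using False \<open>i \<noteq> k\<close> off'[of i k] CC[of i k] z1[of i k] by fastforce
    next
      case True
      consider "s + int a \<le> i" | "i < s + int a" "s + int a - int b \<le> i" | "i < s + int a - int b" by linarith
      then show ?thesis
      proof cases
        case 1
        then show ?thesis using True abi by (intro z2) auto
      next
        case 2
        define k0 where "k0 = w i"
        have k0: "w k0 = i" "s \<le> k0" "k0 < s + int b"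
          using 2 True w1[of i] w1[of k0] abi by (auto simp: k0_def w1)
        show ?thesis
          using step3[of k0 k] k0 True sg1[of k] sg1[of k0] CC[of k0 "\<sigma> k"] CC[of "\<sigma> k0" k]
          by (auto simp: split: if_splits)
      next
        case 3
        have "allowed s (a # A) (b # B) (w k) i" using True 3 wC[of k] by (intro low) auto
        note e = eq[OF this]
        have wi: "w i = 2 * s + int a - 1 - i" using 3 w1[of i] by auto
        have big: "i < w k" "k < w k" "w (w k) = k" "w k < s + int a" "s + int a - int b \<le> w k"
          using True 3 wC[of k] by auto
        have "X (w i) (w k) = 0" using wi big True 3 abi by (intro off') auto
        moreover have "X (\<sigma> i) (w k) = 0" if "\<sigma> i < i"
          using big True 3 that sgge[of i] wC[of k] by (intro off') auto
        moreover have "X i (\<sigma> (w k)) = 0" if "w k < \<sigma> (w k)"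
          using big True 3 that sgge[of "w k"] wC[of k] by (intro off') auto
        ultimately show ?thesis using e big by (auto split: if_splits)
      qed
    qed
    moreover have "X i i = c" if "s \<le> i" "i < s + int (sum_list (a # A))" for i
      using diag'[of i] CC[of i i] that by (cases "i < s + int b") auto
    ultimately show ?thesis by (intro conjI exI[of _ c] allI impI) auto
  qed
  show ?thesis by (rule rigidI[OF sums scalar])
qed

lemma same_part_append:
  "same_part s (A @ [a]) i k \<longleftrightarrow> same_part s A i k \<or>
     (s + int (sum_list A) \<le> i \<and> i < s + int (sum_list A) + int a \<and>
      s + int (sum_list A) \<le> k \<and> k < s + int (sum_list A) + int a)"
  by (induction A arbitrary: s) (auto simp: add.assoc)

lemma reflect_append:
  "s \<le> i \<Longrightarrow> reflect s (A @ [a]) i =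
     (if i < s + int (sum_list A) then reflect s A i
      else if i < s + int (sum_list A) + int a then 2 * (s + int (sum_list A)) + int a - 1 - i else i)"
  by (induction A arbitrary: s) (auto simp: add.assoc)

lemma same_part_shift: "same_part (s + x) A (i + x) (k + x) = same_part s A i k"
proof (induction A arbitrary: s)
  case (Cons a A)
  from Cons[of "s + int a"] show ?case by (simp add: algebra_simps)
qed simp

lemma reflect_shift: "reflect (s + x) A (i + x) = reflect s A i + x"
proof (induction A arbitrary: s)
  case (Cons a A)
  from Cons[of "s + int a"] show ?case by (auto simp: algebra_simps)
qed simp

lemma same_part_rev:
  "same_part s (rev A) (2 * s + int (sum_list A) - 1 - i) (2 * s + int (sum_list A) - 1 - k)
     = same_part s A i k"
proof (induction A arbitrary: s)
  case (Cons a A)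
  from Cons[of "s + int a"] same_part_shift[of s "int a" "rev A"
      "2 * s + int (a + sum_list A) - 1 - i" "2 * s + int (a + sum_list A) - 1 - k"]
  have "same_part s (rev A) (2 * s + int (a + sum_list A) - 1 - i) (2 * s + int (a + sum_list A) - 1 - k)
      = same_part (s + int a) A i k"
    by (simp add: algebra_simps)
  then show ?case by (auto simp: same_part_append)
qed simp

lemma reflect_rev:
  "s \<le> i \<Longrightarrow> i < s + int (sum_list A) \<Longrightarrow>
   reflect s (rev A) (2 * s + int (sum_list A) - 1 - i) = 2 * s + int (sum_list A) - 1 - reflect s A i"
proof (induction A arbitrary: s)
  case (Cons a A)
  show ?case
  proof (cases "i < s + int a")
    case True
    then show ?thesis using Cons.prems by (subst rev.simps, subst reflect_append) auto
  next
    case False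
    from False Cons.IH[of "s + int a"] Cons.prems reflect_shift[of s "int a" "rev A"
      "2 * s + int (a + sum_list A) - 1 - i"]
    have "reflect s (rev A) (2 * s + int (a + sum_list A) - 1 - i)
        = 2 * s + int (a + sum_list A) - 1 - reflect (s + int a) A i"
      by (simp add: algebra_simps)
    then show ?thesis using False Cons.prems by (subst rev.simps, subst reflect_append) auto
  qed
qed simp

text \<open>Reversing the interval turns lower triangular positions into upper triangular ones, hence also exchanges
  the roles of \<open>A\<close> and \<open>B\<close>.\<close>

lemma rigid_rev: assumes "rigid (rev B) (rev A)" shows "rigid A B"
proof -
  have sums: "sum_list A = sum_list B" using rigid_sum_list[OF assms] by simp
  have scalar: "scalar_on s (sum_list A) X"
    if supp: "\<And>i k. \<not> allowed s A B i k \<Longrightarrow> X i k = 0"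
      and eqs: "\<And>i k. allowed s A B i k \<Longrightarrow> kernel_eq s A B X i k" for s X
  proof -
    define t where "t = 2 * s + int (sum_list A) - 1"
    define Y where "Y i k = X (t - i) (t - k)" for i k
    have al: "allowed s (rev B) (rev A) i k \<longleftrightarrow> allowed s A B (t - i) (t - k)" for i k
      using same_part_rev[of s A "t - i" "t - k"] same_part_rev[of s B "t - i" "t - k"] sums
      unfolding allowed_def t_def by auto
    have "Y i k = 0" if "\<not> allowed s (rev B) (rev A) i k" for i k
      using that al supp by (simp add: Y_def)
    moreover have "kernel_eq s (rev B) (rev A) Y i k" if "allowed s (rev B) (rev A) i k" for i k
    proof -
      have a: "allowed s A B (t - i) (t - k)" using that al by blast
      then have rng: "s \<le> t - i" "t - i < s + int (sum_list A)" "s \<le> t - k" "t - k < s + int (sum_list A)"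
        using same_part_range[of s A "t - i" "t - k"] same_part_range[of s B "t - i" "t - k"] sums
        unfolding allowed_def by auto
      have tB: "t = 2 * s + int (sum_list B) - 1" by (simp add: t_def sums)
      have tt: "t - (t - j) = j" for j by simp
      have "reflect s (rev A) j = t - reflect s A (t - j)" "reflect s (rev B) j = t - reflect s B (t - j)"
        if "s \<le> t - j" "t - j < s + int (sum_list A)" for j
        using reflect_rev[OF that(1), of A, folded t_def, unfolded tt]
          reflect_rev[OF that(1), of B, folded tB, unfolded tt] that(2) sums by simp_all
      note r = this[OF rng(1,2)] this[OF rng(3,4)]
      show ?thesis using eqs[OF a] unfolding kernel_eq_def r Y_def tt
        by (simp add: algebra_simps split del: if_split)
    qed
    ultimately obtain c where c: "\<And>i k. i \<noteq> k \<Longrightarrow> Y i k = 0"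
      "\<And>i. s \<le> i \<Longrightarrow> i < s + int (sum_list A) \<Longrightarrow> Y i i = c"
      using rigidD[OF assms, of s Y] sums by auto
    have "X i k = Y (t - i) (t - k)" for i k by (simp add: Y_def)
    then have "X i k = 0" if "i \<noteq> k" for i k using c(1)[of "t - i" "t - k"] that by simp
    moreover have "X i i = c" if "s \<le> i" "i < s + int (sum_list A)" for i
      using c(2)[of "t - i"] that by (simp add: Y_def t_def)
    ultimately show ?thesis by (intro conjI exI[of _ c] allI impI) auto
  qed
  show ?thesis by (rule rigidI[OF sums scalar])
qed

abbreviation nonzero :: "nat list \<Rightarrow> nat list" where
  "nonzero \<equiv> filter (\<lambda>a. a \<noteq> 0)"

text \<open>A contraction with \<open>a = 2 b\<close> produces an empty part.\<close>

lemma rigid_drop_zeros: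
  assumes "rigid (nonzero A) (nonzero B)"
  shows "rigid A B"
proof -
  have sp: "same_part s (nonzero A) i k = same_part s A i k" for s i k A
  proof (induction A arbitrary: s)
    case (Cons a A)
    then show ?case by (cases "a = 0") (simp_all, arith)
  qed simp
  have rf: "s \<le> i \<Longrightarrow> reflect s (nonzero A) i = reflect s A i" for s i A
    by (induction A arbitrary: s) auto
  have sl: "sum_list (nonzero A) = sum_list A" for A
    by (induction A) auto
  have al: "allowed s (nonzero A) (nonzero B) i k = allowed s A B i k" for s i k
    by (simp only: allowed_def sp)
  have ke: "kernel_eq s (nonzero A) (nonzero B) X i k" if "allowed s A B i k" "kernel_eq s A B X i k" for s X i k
  proof -
    have "s \<le> i" "s \<le> k" using allowed_ge[OF that(1)] by auto
    then show ?thesis using that(2) unfolding kernel_eq_def by (simp only: rf)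
  qed
  show ?thesis
  proof (rule rigidI)
    show "sum_list A = sum_list B" using rigid_sum_list[OF assms] by (simp only: sl)
    fix s X
    assume supp: "\<And>i k. \<not> allowed s A B i k \<Longrightarrow> X i k = 0"
      and eqs: "\<And>i k. allowed s A B i k \<Longrightarrow> kernel_eq s A B X i k"
    show "scalar_on s (sum_list A) X"
      by (rule rigidD[OF assms, of s X, unfolded al sl]) (use supp eqs ke in blast)+
  qed
qed

lemma rigid_left_top:
  "rigid (nonzero ((a - 2 * b) # b # A)) (nonzero B) \<Longrightarrow> 2 * b \<le> a \<Longrightarrow> rigid (a # A) (b # B)"
  by (rule rigid_contract, rule rigid_drop_zeros)

lemma rigid_left_bottom:
  "rigid (nonzero A) (nonzero ((b - 2 * a) # a # B)) \<Longrightarrow> 2 * a \<le> b \<Longrightarrow> rigid (a # A) (b # B)"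
  by (rule rigid_flip, rule rigid_left_top, rule rigid_flip)

lemma rigid_right_top:
  assumes "rigid (nonzero (A @ [b, a - 2 * b])) (nonzero B)" "2 * b \<le> a"
  shows "rigid (A @ [a]) (B @ [b])"
proof (rule rigid_rev, rule rigid_flip)
  have "rigid (rev (rev (A @ [b, a - 2 * b]))) (rev (rev B))"
    using rigid_drop_zeros[OF assms(1)] by simp
  then have "rigid (rev B) (rev (A @ [b, a - 2 * b]))" by (rule rigid_rev)
  then show "rigid (rev (A @ [a])) (rev (B @ [b]))"
    using rigid_contract[of a b "rev A" "rev B"] assms(2) by (simp add: rigid_flip)
qed

lemma rigid_one: "rigid [1] [1]"
proof (rule rigidI)
  fix s and X :: "int \<Rightarrow> int \<Rightarrow> complex"
  assume "\<And>i k. \<not> allowed s [1] [1] i k \<Longrightarrow> X i k = 0"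
  then have "X i k = 0" if "i \<noteq> k" for i k using that by (auto simp: allowed_def)
  moreover have "X i i = X s s" if "s \<le> i" "i < s + int (sum_list [1])" for i using that by simp
  ultimately show "scalar_on s (sum_list [1]) X"
    by blast
qed simp

text \<open>Contractions at the left and right ends, read from the last line upwards. Working at both ends
  keeps the contracted part at most half of the part opposite to it, so no other kind of move occurs.\<close>

lemma rigid_core: "rigid [1, 5, 24] [30]"
proof -
  have r1: "rigid [1, 1] [2]"
    using rigid_left_bottom[of "[1]" 2 1 "[]"] rigid_one by simp
  have r2: "rigid [3] [2, 1]" using rigid_right_top[of "[]" 1 3 "[2]"] r1 by simp
  have r3: "rigid [1, 3] [4]" using rigid_left_bottom[of "[3]" 4 1 "[]"] r2 by simp
  have r4: "rigid [5] [4, 1]" using rigid_right_top[of "[]" 1 5 "[4]"] r3 by simp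
  have r5: "rigid [1, 5] [6]" using rigid_left_bottom[of "[5]" 6 1 "[]"] r4 by simp
  have r6: "rigid [1, 10] [6, 5]" using rigid_right_top[of "[1]" 5 10 "[6]"] r5 by simp
  have r7: "rigid [5, 1, 10] [16]" using rigid_left_bottom[of "[1, 10]" 16 5 "[]"] r6 by simp
  have r8: "rigid [5, 12] [16, 1]" using rigid_right_top[of "[5]" 1 12 "[16]"] r7 by simp
  have r9: "rigid [1, 5, 12] [18]" using rigid_left_bottom[of "[5, 12]" 18 1 "[]"] r8 by simp
  have r10: "rigid [1, 22] [18, 5]" using rigid_right_top[of "[1]" 5 22 "[18]"] r9 by simp
  have r11: "rigid [24] [18, 5, 1]" using rigid_right_top[of "[]" 1 24 "[18, 5]"] r10 by simp
  have r12: "rigid [5, 24] [28, 1]" using rigid_left_bottom[of "[24]" 28 5 "[1]"] r11 by simp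
  show ?thesis using rigid_left_bottom[of "[5, 24]" 30 1 "[]"] r12 by simp
qed

text \<open>Two contractions remove one part \<open>2\<close> from each side and restore the leading \<open>1\<close>.\<close>

lemma rigid_twos: "rigid (1 # replicate r 2 @ [5, 24]) (replicate r 2 @ [30])"
proof (induction r)
  case 0
  show ?case using rigid_core by simp
next
  case (Suc r)
  have "rigid (replicate (Suc r) 2 @ [5, 24]) (1 # replicate r 2 @ [30])"
    using rigid_left_top[of 2 1 "replicate r 2 @ [5, 24]" "replicate r 2 @ [30]"] Suc by simp
  then show ?case
    using rigid_left_bottom[of "replicate (Suc r) 2 @ [5, 24]" 2 1 "replicate r 2 @ [30]"] by simp
qed

text \<open>Contracting a leading \<open>2\<close> of the bottom composition moves it into the top one and takes \<open>4\<close> from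
  the first part; when the part \<open>1\<close> is reached, \<open>2\<close> is left of the first part.\<close>

lemma rigid_peel: 
  "rigid ((2 + 4 * k) # replicate i 2 @ [5, 24]) (replicate k 2 @ [1] @ replicate (i + k) 2 @ [30])"
proof (induction k arbitrary: i)
  case 0
  show ?case using rigid_left_top[of 2 1 "replicate i 2 @ [5, 24]" "replicate i 2 @ [30]"] rigid_twos[of i] by simp
next
  case (Suc k)
  show ?case using rigid_left_top[of "2 + 4 * Suc k" 2 "replicate i 2 @ [5, 24]"
     "replicate k 2 @ [1] @ replicate (i + Suc k) 2 @ [30]"] Suc[of "Suc i"] by simp
qed

lemma rigid_family: "rigid [60 + 4 * r] ([24, 5] @ replicate r 2 @ [1] @ replicate r 2 @ [30])"
proof -
  have "rigid [12 + 4 * r, 24] ([5] @ replicate r 2 @ [1] @ replicate r 2 @ [30])"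
    using rigid_left_top[of "12 + 4 * r" 5 "[24]" "replicate r 2 @ [1] @ replicate r 2 @ [30]"]
      rigid_peel[of r 0] by simp
  then show ?thesis
    using rigid_left_top[of "60 + 4 * r" 24 "[]" "[5] @ replicate r 2 @ [1] @ replicate r 2 @ [30]"] by simp
qed

section \<open>The meander functional of a parabolic seaweed\<close>

lemma block_Cons:
  assumes "i < sum_list (c # C)"
  shows "block (c # C) i = (if i < c then 0 else Suc (block C (i - c)))"
proof (cases "i < c")
  case True
  then show ?thesis unfolding block_def by (auto intro!: Least_equality)
next
  case False
  have "block (c # C) i = Suc (LEAST k. i < sum_list (take (Suc (Suc k)) (c # C)))"
    unfolding block_def
    by (rule Least_Suc[of _ "length C"]) (use assms False in auto)
  also have "(LEAST k. i < sum_list (take (Suc (Suc k)) (c # C))) = block C (i - c)"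
    unfolding block_def using False by (intro arg_cong[of _ _ Least] ext) auto
  finally show ?thesis using False by simp
qed

lemma block_mono:
  "i \<le> k \<Longrightarrow> k < sum_list C \<Longrightarrow> block C i \<le> block C k"
proof (induction C arbitrary: i k)
  case (Cons c C)
  have "block C (i - c) \<le> block C (k - c)" if "\<not> i < c"
    using Cons.prems that by (intro Cons.IH) auto
  then show ?case using Cons.prems by (auto simp: block_Cons)
qed simp

lemma same_part_iff_block:
  "i < sum_list C \<Longrightarrow> k < sum_list C \<Longrightarrow>
     same_part s C (s + int i) (s + int k) \<longleftrightarrow> block C i = block C k"
proof (induction C arbitrary: s i k)
  case (Cons c C)
  have ge: "s + int c \<le> s + int i \<and> s + int c \<le> s + int k"
    if "same_part (s + int c) C (s + int i) (s + int k)"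
    using same_part_range[OF that] by auto
  show ?case
  proof (cases "i < c \<or> k < c")
    case True
    then show ?thesis using Cons.prems ge by (auto simp: block_Cons)
  next
    case False
    then have "same_part (s + int c) C (s + int c + int (i - c)) (s + int c + int (k - c))
        \<longleftrightarrow> block C (i - c) = block C (k - c)"
      using Cons.prems by (intro Cons.IH) auto
    then show ?thesis using False Cons.prems by (auto simp: block_Cons)
  qed
qed simp

lemma reflect_involution:
  "s \<le> i \<Longrightarrow> i < s + int (sum_list C) \<Longrightarrow> reflect s C (reflect s C i) = i"
proof (induction C arbitrary: s i)
  case (Cons c C)
  show ?case
  proof (cases "i < s + int c")
    case False
    then have "reflect (s + int c) C i \<ge> s + int c" by (intro reflect_ge) auto
    then show ?thesis using False Cons by (auto simp: add.assoc)
  qed (use Cons.prems in auto)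
qed simp

context block_triangular begin

text \<open>With a single part on top, all positions below the diagonal are allowed, and those above it are
  allowed within a block; as blocks are numbered from left to right, this is block lower triangularity.\<close>

lemma seaweed_eq_salg:
  assumes B: "sum_list B = n" and blk: "blk = block B"
  shows "seaweed n [n] B = salg"
proof -
  interpret gl: matrix_vs n n "TYPE(complex)" .
  have top: "block [n] i = 0" if "i < n" for i using that block_Cons[of i n "[]"] by simp
  have mono: "blk i \<le> blk k" if "i \<le> k" "k < n" for i k using block_mono[of i k B] that B blk by simp
  define S where "S = cartan n \<union> {elem_mat n i j | i j. i < n \<and> j < n \<and> i > j \<and> block [n] i = block [n] j}
      \<union> {elem_mat n i j | i j. i < n \<and> j < n \<and> i < j \<and> block B i = block B j}"
  have tr_elem: "tr (elem_mat n i j) = 0" if "i \<noteq> j" for i j using that by (auto simp: tr_def intro!: sum.neutral)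
  have "cartan n \<subseteq> salg"
    by (auto simp: cartan_def sl_def salg_def alg_def tr_def diagonal_mat_def pos_def) (metis order_refl)
  then have S_salg: "S \<subseteq> salg"
    using mono tr_elem by (auto simp: S_def salg_def pos_def blk[symmetric] intro!: elem_mat_alg)
  have sub: "LinearCombinations.submodule class_ring salg (gl_space n)"
    using salg_zero salg_add salg_smult salg_alg alg_carrier by (intro submodule_glI) auto
  have Sc: "S \<subseteq> gl n" using S_salg salg_alg alg_carrier by blast
  have "seaweed n [n] B = gl.span S" by (simp add: seaweed_def S_def)
  moreover have "gl.span S \<subseteq> salg" by (rule gl.span_is_subset[OF S_salg sub])
  moreover have "salg \<subseteq> gl.span S"
  proof
    fix x assume x: "x \<in> salg"
    have xc: "x \<in> gl n" and xa: "x \<in> alg" using x salg_alg alg_carrier by blast+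
    have subS: "LinearCombinations.submodule class_ring (gl.span S) (gl_space n)"
      using gl.span_is_submodule[of S] Sc by simp
    note span_add = LinearCombinations.submodule.m_closed[OF subS, unfolded module_mat_simps]
    have sm: "c \<cdot>\<^sub>m z \<in> gl.span S" if "z \<in> gl.span S" for c z
      using LinearCombinations.submodule.smult_closed[OF subS, of c z] that by (simp add: module_mat_simps)
    have span_zero: "0\<^sub>m n n \<in> gl.span S"
      using LinearCombinations.submodule.zero_closed[OF subS] by (simp add: module_mat_simps)
    have gen: "z \<in> gl.span S" if "z \<in> S" for z using gl.in_own_span[of S] Sc that by auto
    define d where "d = mat n n (\<lambda>(i, k). if i = k then x $$ (i, k) else 0)"
    define z where "z = mat n n (\<lambda>(i, k). if i = k then 0 else x $$ (i, k))"
    have "d \<in> cartan n"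
      using x by (auto simp: d_def cartan_def sl_def salg_def tr_def diagonal_mat_def)
    then have d: "d \<in> gl.span S" by (intro gen) (simp add: S_def)
    define T where "T = pos - {(i, i) | i. True}"
    have zc: "z \<in> gl n" by (simp add: z_def)
    have zT: "\<forall>i<n. \<forall>k<n. (i, k) \<notin> T \<longrightarrow> z $$ (i, k) = 0"
      using alg_zero[OF xa] by (auto simp: z_def T_def)
    have Tn: "T \<subseteq> {..<n} \<times> {..<n}" by (auto simp: T_def pos_def)
    from zc Tn zT have "z \<in> gl.span S"
    proof (induction z rule: mat_support_induct)
      case zero
      show ?case by (rule span_zero)
    next
      case (add y c i k)
      have "elem_mat n i k \<in> S"
      proof (cases "k < i")
        case True
        then have "i < n" "k < n" "i > k" "block [n] i = block [n] k"
          using add(3) top by (auto simp: T_def pos_def)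
        then show ?thesis unfolding S_def by blast
      next
        case False
        then have ik: "i < k" "i < n" "k < n" "blk k \<le> blk i" using add(3) by (auto simp: T_def pos_def)
        then have "block B i = block B k" using mono[of i k] by (simp add: blk[symmetric])
        then show ?thesis unfolding S_def using ik by blast
      qed
      then show ?case using add(4) sm gen span_add by blast
    qed
    then have "d + z \<in> gl.span S" using d span_add by blast
    moreover have "d + z = x" using xc by (intro eq_mat_carrierI[of _ n]) (auto simp: d_def z_def)
    ultimately show "x \<in> gl.span S" by simp
  qed
  ultimately show ?thesis by simp
qed

text \<open>The first summand runs over the arcs of the top composition \<open>[n]\<close>, the second over those of \<open>B\<close>.\<close>

definition meander :: "nat list \<Rightarrow> complex mat \<Rightarrow> complex" where
  "meander B x = (\<Sum>i<n. (if n - 1 - i < i then x $$ (i, n - 1 - i) else 0) +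
     (if int i < reflect 0 B (int i) then x $$ (i, nat (reflect 0 B (int i))) else 0))"

lemma reflect_nat:
  assumes "sum_list B = n" "i < n"
  obtains j where "j < n" "reflect 0 B (int i) = int j" "reflect 0 B (int j) = int i"
proof -
  have "0 \<le> reflect 0 B (int i)" "reflect 0 B (int i) < int n"
    using reflect_ge[of 0 "int i" B] reflect_less[of "int i" 0 B] assms by auto
  then show thesis using that[of "nat (reflect 0 B (int i))"] reflect_involution[of 0 "int i" B] assms by auto
qed

lemma meander_linear:
  assumes "sum_list B = n" shows "linear_on_mats n (meander B)"
proof -
  have *: "nat (reflect 0 B (int i)) < n" if "i < n" for i
    using reflect_nat[OF assms that] by (metis nat_int)
  have n1: "n - 1 - i < n" for i using n_pos by auto
  have "meander B (x + y) = meander B x + meander B y"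
    if x: "x \<in> gl n" and y: "y \<in> gl n" for x y
    unfolding meander_def sum.distrib[symmetric]
    using carrier_matD[OF y] * n1 by (intro sum.cong refl) simp
  moreover have "meander B (c \<cdot>\<^sub>m x) = c * meander B x" if x: "x \<in> gl n" for c x
    unfolding meander_def sum_distrib_left
    using carrier_matD[OF x] * n1 by (intro sum.cong refl) (simp add: distrib_left)
  ultimately show ?thesis by (simp add: linear_on_mats_def)
qed

lemma meander_one: "sum_list B = n \<Longrightarrow> meander B (1\<^sub>m n) = 0"
  unfolding meander_def
proof (intro sum.neutral ballI)
  fix i assume B: "sum_list B = n" and i: "i \<in> {..<n}"
  then obtain j where "j < n" "reflect 0 B (int i) = int j" using reflect_nat[of B i] by blast
  then show "(if n - 1 - i < i then 1\<^sub>m n $$ (i, n - 1 - i) else 0) +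
     (if int i < reflect 0 B (int i) then 1\<^sub>m n $$ (i, nat (reflect 0 B (int i))) else 0) = (0 :: complex)"
    using i by auto
qed

text \<open>The bracket with a diagonal matrix multiplies the entry at \<open>(i, k)\<close> by \<open>e i - e k\<close>, which is \<open>1\<close> on the support
  of the functional.\<close>

lemma meander_principal:
  assumes B: "sum_list B = n" and x: "x \<in> gl n"
    and top: "\<And>i. i < n \<Longrightarrow> n - 1 - i < i \<Longrightarrow> e i - e (n - 1 - i) = 1"
    and bottom: "\<And>i j. i < j \<Longrightarrow> j < n \<Longrightarrow> reflect 0 B (int i) = int j \<Longrightarrow> e i - e j = 1"
  shows "meander B (lie_bracket (mat_diag n e) x) = meander B x"
proof -
  have br: "lie_bracket (mat_diag n e) x $$ (i, k) = (e i - e k) * x $$ (i, k)" if "i < n" "k < n" for i k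
    using that x unfolding lie_bracket_def
    by (auto simp: mat_diag_mult_left[OF x] mat_diag_mult_right[OF x] algebra_simps)
  show ?thesis unfolding meander_def
  proof (intro sum.cong refl)
    fix i assume "i \<in> {..<n}"
    then have i: "i < n" by simp
    obtain j where j: "j < n" "reflect 0 B (int i) = int j" using reflect_nat[OF B i] by blast
    show "(if n - 1 - i < i then lie_bracket (mat_diag n e) x $$ (i, n - 1 - i) else 0) +
        (if int i < reflect 0 B (int i) then lie_bracket (mat_diag n e) x $$ (i, nat (reflect 0 B (int i))) else 0)
      = (if n - 1 - i < i then x $$ (i, n - 1 - i) else 0) +
        (if int i < reflect 0 B (int i) then x $$ (i, nat (reflect 0 B (int i))) else 0)"
      using br[of i "n - 1 - i"] br[of i j] i j top[of i] bottom[of i j] by auto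
  qed
qed

lemma meander_bracket_elem:
  assumes B: "sum_list B = n" and x: "x \<in> gl n" and ik: "i < n" "k < n"
    and j: "i' < n" "reflect 0 B (int i) = int i'" "k' < n" "reflect 0 B (int k) = int k'"
  shows "meander B (lie_bracket x (elem_mat n i k)) =
     (if k < n - 1 - k then x $$ (n - 1 - k, i) else 0) + (if k' < k then x $$ (k', i) else 0)
   - (if n - 1 - i < i then x $$ (k, n - 1 - i) else 0) - (if i < i' then x $$ (k, i') else 0)"
proof -
  have br: "lie_bracket x (elem_mat n i k) $$ (a, b)
      = (if b = k then x $$ (a, i) else 0) - (if a = i then x $$ (k, b) else 0)" if "a < n" "b < n" for a b
  proof -
    have "(\<Sum>l<n. x $$ (a, l) * elem_mat n i k $$ (l, b)) = (if b = k then x $$ (a, i) else 0)"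
      using that ik by (simp add: if_distrib[where f = "\<lambda>z. _ * z"] cong: if_cong)
    moreover have "(\<Sum>l<n. elem_mat n i k $$ (a, l) * x $$ (l, b)) = (if a = i then x $$ (k, b) else 0)"
      using that ik by (simp add: if_distrib[where f = "\<lambda>z. z * _"] cong: if_cong)
    ultimately show ?thesis using lie_bracket_index[OF x elem_mat_carrier that] by simp
  qed
  have kk': "reflect 0 B (int k') = int k" using reflect_nat[OF B ik(2)] j(4) by metis
  have entry: "(if n - 1 - a < a then lie_bracket x (elem_mat n i k) $$ (a, n - 1 - a) else 0) +
     (if int a < reflect 0 B (int a) then lie_bracket x (elem_mat n i k) $$ (a, nat (reflect 0 B (int a))) else 0)
     = ((if a = n - 1 - k then (if k < n - 1 - k then x $$ (n - 1 - k, i) else 0) else 0)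
       + (if a = k' then (if k' < k then x $$ (k', i) else 0) else 0))
     - ((if a = i then (if n - 1 - i < i then x $$ (k, n - 1 - i) else 0) else 0)
       + (if a = i then (if i < i' then x $$ (k, i') else 0) else 0))" if a: "a < n" for a
  proof -
    obtain c where c: "c < n" "reflect 0 B (int a) = int c" "reflect 0 B (int c) = int a"
      using reflect_nat[OF B a] by blast
    have t1: "(if n - 1 - a < a then lie_bracket x (elem_mat n i k) $$ (a, n - 1 - a) else 0)
      = (if a = n - 1 - k then (if k < n - 1 - k then x $$ (n - 1 - k, i) else 0) else 0)
       - (if a = i then (if n - 1 - i < i then x $$ (k, n - 1 - i) else 0) else 0)"
    proof -
      have "n - 1 - a = k \<longleftrightarrow> a = n - 1 - k" using a ik by auto
      then show ?thesis using br[of a "n - 1 - a"] a by auto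
    qed
    have t2: "(if int a < reflect 0 B (int a) then lie_bracket x (elem_mat n i k) $$ (a, nat (reflect 0 B (int a))) else 0)
      = (if a = k' then (if k' < k then x $$ (k', i) else 0) else 0)
       - (if a = i then (if i < i' then x $$ (k, i') else 0) else 0)"
    proof -
      have "c = k \<longleftrightarrow> a = k'" using c j(4) kk' by auto
      moreover have "a = i \<Longrightarrow> c = i'" using c j(2) by auto
      ultimately show ?thesis using br[OF a c(1)] by (auto simp: c(2))
    qed
    show ?thesis unfolding t1 t2 by simp
  qed
  have "meander B (lie_bracket x (elem_mat n i k)) = (\<Sum>a<n.
       ((if a = n - 1 - k then (if k < n - 1 - k then x $$ (n - 1 - k, i) else 0) else 0)
       + (if a = k' then (if k' < k then x $$ (k', i) else 0) else 0))
     - ((if a = i then (if n - 1 - i < i then x $$ (k, n - 1 - i) else 0) else 0)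
       + (if a = i then (if i < i' then x $$ (k, i') else 0) else 0)))"
    unfolding meander_def by (intro sum.cong refl entry) auto
  also have "\<dots> = (if k < n - 1 - k then x $$ (n - 1 - k, i) else 0) + (if k' < k then x $$ (k', i) else 0)
   - (if n - 1 - i < i then x $$ (k, n - 1 - i) else 0) - (if i < i' then x $$ (k, i') else 0)"
  proof -
    have "n - 1 - k < n" using ik by auto
    then show ?thesis unfolding sum_subtractf sum.distrib using ik j by (simp add: sum.delta)
  qed
  finally show ?thesis .
qed

lemma meander_nondegenerate:
  assumes B: "sum_list B = n" and blk: "blk = block B" and rig: "rigid [n] B"
  shows "nondegenerate (meander B)"
  unfolding nondegenerate_def
proof (intro ballI impI)
  fix x assume x: "x \<in> salg" and fx: "\<forall>y\<in>alg. meander B (lie_bracket x y) = 0"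
  have xa: "x \<in> alg" using x by (rule salg_alg)
  note xc = alg_carrier[OF xa]
  define X where "X i k = (if 0 \<le> i \<and> i < int n \<and> 0 \<le> k \<and> k < int n then x $$ (nat i, nat k) else 0)" for i k
  have X_nat: "X (int i) (int k) = x $$ (i, k)" if "i < n" "k < n" for i k using that by (simp add: X_def)
  have allowed_iff: "allowed 0 [n] B (int i) (int k) \<longleftrightarrow> (i, k) \<in> pos" if "i < n" "k < n" for i k
  proof -
    have "same_part 0 B (int i) (int k) \<longleftrightarrow> blk i = blk k"
      using same_part_iff_block[of i B k 0] that B blk by simp
    moreover have "i \<le> k \<Longrightarrow> blk i \<le> blk k" "k \<le> i \<Longrightarrow> blk k \<le> blk i"
      using block_mono[of i k B] block_mono[of k i B] that B blk by auto
    ultimately show ?thesis using that by (cases "k \<le> i") (auto simp: allowed_def pos_def)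
  qed
  have rng: "\<exists>i' k'. i = int i' \<and> k = int k' \<and> i' < n \<and> k' < n" if al: "allowed 0 [n] B i k" for i k
  proof -
    have "same_part 0 [n] i k \<or> same_part 0 B i k" using al unfolding allowed_def by blast
    then have "0 \<le> i \<and> 0 \<le> k \<and> i < int n \<and> k < int n"
      using same_part_range[of 0 "[n]" i k] same_part_range[of 0 B i k] B
      by (elim disjE) (simp_all del: same_part.simps)
    then show ?thesis by (intro exI[of _ "nat i"] exI[of _ "nat k"]) auto
  qed
  have supp: "X i k = 0" if "\<not> allowed 0 [n] B i k" for i k
  proof (cases "0 \<le> i \<and> i < int n \<and> 0 \<le> k \<and> k < int n")
    case True
    then have "nat i < n" "nat k < n" by auto
    from allowed_iff[OF this] have "(nat i, nat k) \<notin> pos" using True that by simp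
    then show ?thesis using alg_zero[OF xa, of "nat i" "nat k"] True by (auto simp: X_def)
  qed (auto simp: X_def)
  have eqs: "kernel_eq 0 [n] B X i k" if al: "allowed 0 [n] B i k" for i k
  proof -
    obtain p q where pq: "i = int p" "k = int q" "p < n" "q < n" using rng[OF al] by blast
    obtain p' where p': "p' < n" "reflect 0 B (int p) = int p'" using reflect_nat[OF B pq(3)] by blast
    obtain q' where q': "q' < n" "reflect 0 B (int q) = int q'" using reflect_nat[OF B pq(4)] by blast
    have "(p, q) \<in> pos" using al allowed_iff pq by simp
    then have "meander B (lie_bracket x (elem_mat n p q)) = 0" using fx elem_mat_alg by blast
    note e = this[unfolded meander_bracket_elem[OF B xc pq(3,4) p' q']]
    have r: "reflect 0 [n] (int a) = int (n - 1 - a)" if "a < n" for a using that by auto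
    have lt: "n - 1 - a < n" for a using n_pos by auto
    show ?thesis
      unfolding kernel_eq_def pq(1,2) r[OF pq(3)] r[OF pq(4)] p'(2) q'(2)
        X_nat[OF lt pq(3)] X_nat[OF q'(1) pq(3)] X_nat[OF pq(4) lt] X_nat[OF pq(4) p'(1)] of_nat_less_iff
      using e by (simp only: algebra_simps diff_eq_eq add_0_left)
  qed
  obtain c where off: "\<And>i k. i \<noteq> k \<Longrightarrow> X i k = 0"
    and diag: "\<And>i. 0 \<le> i \<Longrightarrow> i < int n \<Longrightarrow> X i i = c"
    using rigidD[OF rig supp eqs] by auto
  have "tr x = of_nat n * c" unfolding tr_def using diag X_nat by (simp flip: X_nat)
  then have "c = 0" using x n_pos by (simp add: salg_def)
  then show "x = 0\<^sub>m n n"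
  proof (intro eq_mat_carrierI[OF xc])
    fix i k assume "i < n" "k < n"
    then show "x $$ (i, k) = 0\<^sub>m n n $$ (i, k)"
      using off[of "int i" "int k"] diag[of "int i"] X_nat[of i k] \<open>c = 0\<close> by (cases "i = k") auto
  qed simp
qed

end

section \<open>Weights and multiplicities of the family\<close>

definition d_left :: "int list" where
  "d_left = [0, -2, -4, -5, -3, -1, -2, -4, -6, -7, -5, -3, -4, -6, -8, -7, -5, -3, -2, -4, -6, -5, -3, -1]"

definition d_five :: "int list" where
  "d_five = [0, -2, -4, -3, -1]"

definition d_right :: "int list" where
  "d_right = [2, 0, -2, -3, -1, 1, 0, -2, -4, -5, -3, -1, -2, -4, -6, -7, -5, -3, -2, -4, -6, -5, -3, -1,
     0, -2, -4, -3, -1, 1]"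

text \<open>A labelling of the vertices of the meander graph, listed block by block. It is determined up to a constant by the
  requirement of \<open>weight_bottom\<close> and \<open>weight_top\<close> because the graph is a path; here the constant is chosen so that vertex \<open>0\<close> has
  label \<open>0\<close>.\<close>

definition weights :: "nat \<Rightarrow> int list list" where
  "weights r = [d_left, d_five] @ replicate r [1, 0] @ [[1]] @ replicate r [2, 1] @ [d_right]"

definition weight :: "nat \<Rightarrow> nat \<Rightarrow> int" where
  "weight r i = concat (weights r) ! i"

lemma map_length_weights: "map length (weights r) = bottom_parts r"
  by (simp add: weights_def bottom_parts_def d_left_def d_five_def d_right_def)

lemma length_concat_weights: "length (concat (weights r)) = 60 + 4 * r"
  by (simp add: length_concat map_length_weights composition_parts(2)[unfolded composition_def])

definition drops :: "int list \<Rightarrow> bool" where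
  "drops X \<longleftrightarrow> list_all2 (\<lambda>a b. a = b + 1) (take (length X div 2) X) (take (length X div 2) (rev X))"

lemma drops_nth: "drops X \<Longrightarrow> p < length X - 1 - p \<Longrightarrow> X ! p = X ! (length X - 1 - p) + 1"
  by (auto simp: drops_def list_all2_conv_all_nth rev_nth)

lemma drops_weights: "X \<in> set (weights r) \<Longrightarrow> drops X"
proof -
  have "drops d_left" "drops d_five" "drops d_right" "drops [1, 0]" "drops [1]" "drops [2, 1]"
    unfolding drops_def d_left_def d_five_def d_right_def by simp_all
  then show "X \<in> set (weights r) \<Longrightarrow> drops X" by (auto simp: weights_def)
qed

lemma concat_drops_along_reflect:
  assumes "\<And>X. X \<in> set Xs \<Longrightarrow> drops X"
    and "reflect s (map length Xs) (s + int i) = s + int j" "i < j" "j < length (concat Xs)"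
  shows "concat Xs ! i = concat Xs ! j + 1"
  using assms
proof (induction Xs arbitrary: s i j)
  case (Cons X Xs)
  show ?case
  proof (cases "i < length X")
    case True
    then have "j = length X - 1 - i" using Cons.prems(2) by auto
    then show ?thesis using True Cons.prems(1)[of X] Cons.prems(3) drops_nth[of X i] by (auto simp: nth_append)
  next
    case False
    have "concat Xs ! (i - length X) = concat Xs ! (j - length X) + 1"
      by (rule Cons.IH[of "s + int (length X)"]) (use Cons.prems False in auto)
    then show ?thesis using False Cons.prems(3) by (auto simp: nth_append)
  qed
qed simp

lemma weight_bottom:
  assumes "reflect 0 (bottom_parts r) (int i) = int j" "i < j" "j < 60 + 4 * r"
  shows "weight r i = weight r j + 1"
  using concat_drops_along_reflect[of "weights r" 0 i j] drops_weights assms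
  by (simp add: map_length_weights weight_def length_concat_weights)

lemma alternating_list: "a # concat (replicate r [b, a]) = concat (replicate r [a, b]) @ [a]"
  by (induction r) auto

text \<open>The labels of the right half, read backwards, are those of the left half increased by one. Across the
  parts \<open>2\<close> this holds because \<open>1, 0, 1, 0, \<dots>, 1\<close> increased by one is \<open>2, 1, 2, 1, \<dots>, 2\<close>, with the first \<open>2\<close> taken from
  \<open>d_right\<close>.\<close>

lemma weight_top:
  assumes "i < 60 + 4 * r" "60 + 4 * r - 1 - i < i"
  shows "weight r i = weight r (60 + 4 * r - 1 - i) + 1"
proof -
  define L where "L = d_left @ d_five @ concat (replicate r [1, 0]) @ [1]"
  define R where "R = concat (replicate r [2, 1]) @ d_right"
  have cat: "concat (weights r) = L @ R" by (simp add: weights_def L_def R_def)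
  have len: "length L = 30 + 2 * r" "length R = 30 + 2 * r"
    by (simp_all add: L_def R_def d_left_def d_five_def d_right_def length_concat sum_list_replicate)
  have rev_pairs: "rev (concat (replicate r [2, 1])) = concat (replicate r [1, 2 :: int])"
    by (simp add: rev_concat)
  have ends: "rev d_right = map (\<lambda>z. z + 1) (d_left @ d_five) @ [2]"
    by (simp add: d_left_def d_five_def d_right_def)
  have "rev R = map (\<lambda>z. z + 1) (d_left @ d_five) @ (2 # concat (replicate r [1, 2]))"
    by (simp add: R_def rev_pairs ends)
  also have "\<dots> = map (\<lambda>z. z + 1) L"
    by (simp add: L_def alternating_list map_concat)
  finally have revR: "rev R = map (\<lambda>z. z + 1) L" .
  define p where "p = 60 + 4 * r - 1 - i"
  have p: "p < 30 + 2 * r" "i = 60 + 4 * r - 1 - p" using assms by (auto simp: p_def)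
  have "weight r i = R ! (30 + 2 * r - 1 - p)"
  proof -
    have "\<not> i < 30 + 2 * r" "i - (30 + 2 * r) = 30 + 2 * r - 1 - p" using p by auto
    then show ?thesis by (simp only: weight_def cat nth_append len if_False)
  qed
  also have "\<dots> = rev R ! p" using p by (simp add: rev_nth len)
  also have "\<dots> = L ! p + 1" using p by (simp add: revR len)
  also have "L ! p = weight r p" using p by (simp add: weight_def cat nth_append len)
  finally show ?thesis by (simp add: p_def)
qed

abbreviation differ :: "int \<Rightarrow> int \<Rightarrow> int \<Rightarrow> bool" where
  "differ j \<equiv> \<lambda>x y. y - x = j"

definition hits :: "(int \<Rightarrow> int \<Rightarrow> bool) \<Rightarrow> int list \<Rightarrow> int list \<Rightarrow> nat" where
  "hits Q X Y = (\<Sum>x\<leftarrow>X. length (filter (Q x) Y))"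

text \<open>Pairs within one block are counted in both orders, pairs from different blocks only with the left entry
  first: these are the positions of a block lower triangular matrix.\<close>

fun block_hits :: "(int \<Rightarrow> int \<Rightarrow> bool) \<Rightarrow> int list list \<Rightarrow> nat" where
  "block_hits Q [] = 0"
| "block_hits Q (X # Xs) = hits Q X X + hits Q X (concat Xs) + block_hits Q Xs"

lemma hits_eq_card:
  "hits Q X Y = card {(i, k). i < length Y \<and> k < length X \<and> Q (X ! k) (Y ! i)}"
proof -
  have "hits Q X Y = (\<Sum>k<length X. card {i. i < length Y \<and> Q (X ! k) (Y ! i)})"
    by (simp add: hits_def sum_list_sum_nth atLeast0LessThan length_filter_conv_card)
  also have "\<dots> = card (SIGMA k:{..<length X}. {i. i < length Y \<and> Q (X ! k) (Y ! i)})"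
    by (simp add: card_SigmaI)
  also have "\<dots> = card {(i, k). i < length Y \<and> k < length X \<and> Q (X ! k) (Y ! i)}"
    by (rule bij_betw_same_card[of "\<lambda>(k, i). (i, k)"]) (auto simp: bij_betw_def inj_on_def)
  finally show ?thesis .
qed

lemma block_hits_eq_card:
  "card {(i, k). i < length (concat Xs) \<and> k < length (concat Xs) \<and>
      block (map length Xs) k \<le> block (map length Xs) i \<and> Q (concat Xs ! k) (concat Xs ! i)} = block_hits Q Xs"
proof (induction Xs)
  case (Cons X Xs)
  let ?a = "length X" and ?Y = "concat Xs"
  let ?S = "{(i, k). i < length (concat (X # Xs)) \<and> k < length (concat (X # Xs)) \<and>
      block (map length (X # Xs)) k \<le> block (map length (X # Xs)) i \<and> Q (concat (X # Xs) ! k) (concat (X # Xs) ! i)}"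
  let ?S1 = "{(i, k). i < ?a \<and> k < ?a \<and> Q (X ! k) (X ! i)}"
  let ?S2 = "{(i, k). i < length ?Y \<and> k < ?a \<and> Q (X ! k) (?Y ! i)}"
  let ?S3 = "{(i, k). i < length ?Y \<and> k < length ?Y \<and>
      block (map length Xs) k \<le> block (map length Xs) i \<and> Q (?Y ! k) (?Y ! i)}"
  let ?f2 = "\<lambda>(i, k). (i + ?a, k)" and ?f3 = "\<lambda>(i, k). (i + ?a, k + ?a)"
  have bl: "block (map length (X # Xs)) i = (if i < ?a then 0 else Suc (block (map length Xs) (i - ?a)))"
    if "i < ?a + length ?Y" for i
    using block_Cons[of i ?a "map length Xs"] that by (simp add: length_concat)
  have "?S = ?S1 \<union> ?f2 ` ?S2 \<union> ?f3 ` ?S3" (is "_ = ?U")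
  proof (intro equalityI subsetI)
    fix q assume q: "q \<in> ?S"
    obtain i k where ik: "q = (i, k)" by force
    consider "i < ?a" "k < ?a" | "i < ?a" "\<not> k < ?a" | "\<not> i < ?a" "k < ?a" | "\<not> i < ?a" "\<not> k < ?a" by blast
    then show "q \<in> ?U"
    proof cases
      case 1
      then show ?thesis using q ik by (simp add: nth_append)
    next
      case 2
      then show ?thesis using q ik bl[of i] bl[of k] by simp
    next
      case 3
      have "(i - ?a, k) \<in> ?S2" using 3 q ik by (simp add: nth_append) linarith
      then have "?f2 (i - ?a, k) \<in> ?f2 ` ?S2" by (rule imageI)
      then show ?thesis using 3 ik by simp
    next
      case 4
      have "(i - ?a, k - ?a) \<in> ?S3" using 4 q ik bl[of i] bl[of k] by (simp add: nth_append) linarith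
      then have "?f3 (i - ?a, k - ?a) \<in> ?f3 ` ?S3" by (rule imageI)
      then show ?thesis using 4 ik by simp
    qed
  next
    fix q assume "q \<in> ?U"
    then consider "q \<in> ?S1" | "q \<in> ?f2 ` ?S2" | "q \<in> ?f3 ` ?S3" by blast
    then show "q \<in> ?S"
    proof cases
      case 1
      then show ?thesis using bl by (auto simp: nth_append)
    next
      case 2
      then show ?thesis using bl by (auto simp: nth_append)
    next
      case 3
      then show ?thesis using bl by (auto simp: nth_append)
    qed
  qed
  moreover have "card (?S1 \<union> ?f2 ` ?S2 \<union> ?f3 ` ?S3) = card ?S1 + card ?S2 + card ?S3"
  proof -
    have fin: "finite ?S1" "finite ?S2" "finite ?S3"
      by (auto intro: finite_subset[of _ "{..<?a} \<times> {..<?a}"] finite_subset[of _ "{..<length ?Y} \<times> {..<?a}"]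
          finite_subset[of _ "{..<length ?Y} \<times> {..<length ?Y}"])
    have "card (?f2 ` ?S2) = card ?S2" "card (?f3 ` ?S3) = card ?S3"
      by (rule card_image, force simp: inj_on_def)+
    moreover have "?S1 \<inter> ?f2 ` ?S2 = {}" "(?S1 \<union> ?f2 ` ?S2) \<inter> ?f3 ` ?S3 = {}" by auto
    ultimately show ?thesis using fin by (simp add: card_Un_disjoint)
  qed
  ultimately show ?case using Cons.IH by (simp only: hits_eq_card block_hits.simps)
qed simp

lemma hits_append: "hits Q X (Y @ Z) = hits Q X Y + hits Q X Z"
  by (simp add: hits_def sum_list_addf)

lemma hits_Nil: "hits Q X [] = 0"
  by (simp add: hits_def)

lemma hits_replicate: "hits Q X (concat (replicate m Y)) = m * hits Q X Y"
  by (induction m) (simp_all add: hits_append hits_Nil)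

lemma block_hits_replicate:
  "2 * block_hits Q (replicate m X @ Xs) =
     m * (m + 1) * hits Q X X + 2 * m * hits Q X (concat Xs) + 2 * block_hits Q Xs"
  by (induction m) (simp_all add: hits_append hits_replicate algebra_simps)

text \<open>The counts not involving a part \<open>2\<close>, and those pairing a part \<open>2\<close> with another part.\<close>

definition hits_const :: "(int \<Rightarrow> int \<Rightarrow> bool) \<Rightarrow> nat" where
  "hits_const Q = hits Q d_left (d_left @ d_five @ [1] @ d_right) + hits Q d_five (d_five @ [1] @ d_right)
     + hits Q [1] ([1] @ d_right) + hits Q d_right d_right"

definition hits_linear :: "(int \<Rightarrow> int \<Rightarrow> bool) \<Rightarrow> nat" where
  "hits_linear Q = hits Q (d_left @ d_five) ([1, 0] @ [2, 1]) + hits Q [1, 0] ([1] @ d_right)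
     + hits Q [1] [2, 1] + hits Q [2, 1] d_right"

lemma hits_append_left: "hits Q (X @ X') Y = hits Q X Y + hits Q X' Y"
  by (simp add: hits_def)

lemma block_hits_weights:
  "2 * block_hits Q (weights r) = 2 * hits_const Q + 2 * r * hits_linear Q
     + r * (r + 1) * (hits Q [1, 0] [1, 0] + hits Q [2, 1] [2, 1]) + 2 * r ^ 2 * hits Q [1, 0] [2, 1]"
proof -
  define Z where "Z = replicate r [2, 1] @ [d_right]"
  have cZ: "hits Q X (concat Z) = r * hits Q X [2, 1] + hits Q X d_right" for X
    by (simp add: Z_def hits_append hits_replicate)
  have Z: "2 * block_hits Q Z = r * (r + 1) * hits Q [2, 1] [2, 1] + 2 * r * hits Q [2, 1] d_right + 2 * hits Q d_right d_right"
    unfolding Z_def block_hits_replicate by (simp add: hits_Nil)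
  define Y where "Y = replicate r [1, 0] @ [1] # Z"
  have cY: "hits Q X (concat Y) = r * hits Q X [1, 0] + hits Q X [1] + hits Q X (concat Z)" for X
    using hits_append[of Q X "[1]" "concat Z"] by (simp add: Y_def hits_append hits_replicate)
  have Y: "2 * block_hits Q Y = r * (r + 1) * hits Q [1, 0] [1, 0] + 2 * r * (hits Q [1, 0] [1] + hits Q [1, 0] (concat Z))
      + 2 * (hits Q [1] [1] + hits Q [1] (concat Z) + block_hits Q Z)"
    unfolding Y_def block_hits_replicate using hits_append[of Q "[1, 0]" "[1]" "concat Z"] by simp
  have W: "weights r = d_left # d_five # Y" by (simp add: weights_def Y_def Z_def)
  show ?thesis
    unfolding W block_hits.simps distrib_left[of 2] Y Z cY cZ concat.simps hits_append hits_append_left hits_const_def hits_linear_def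
    by (simp add: algebra_simps power2_eq_square)
qed

lemmas eval_hits = hits_const_def hits_linear_def hits_def d_left_def d_five_def d_right_def

lemma hits_const_values:
  shows "hits_const (differ 1) = 310"
  and "hits_const (differ 2) = 283"
  and "hits_const (differ 3) = 237"
  and "hits_const (differ 4) = 181"
  and "hits_const (differ 5) = 124"
  and "hits_const (differ 6) = 75"
  and "hits_const (differ 7) = 40"
  and "hits_const (differ 8) = 18"
  and "hits_const (differ 9) = 6"
  and "hits_const (differ 10) = 1"
  unfolding eval_hits by code_simp+

lemma hits_linear_values:
  shows "hits_linear (differ 1) = 13"
  and "hits_linear (differ 2) = 13"
  and "hits_linear (differ 3) = 16"
  and "hits_linear (differ 4) = 19"
  and "hits_linear (differ 5) = 19"
  and "hits_linear (differ 6) = 16"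
  and "hits_linear (differ 7) = 12"
  and "hits_linear (differ 8) = 8"
  and "hits_linear (differ 9) = 4"
  and "hits_linear (differ 10) = 1"
  unfolding eval_hits by code_simp+

lemma hits_total_values:
  shows "hits_const (\<lambda>x y. True) = 2551" and "hits_linear (\<lambda>x y. True) = 240"
  unfolding eval_hits by code_simp+

lemma weight_counts:
  shows "block_hits (differ 1) (weights r) = 3 * r ^ 2 + 14 * r + 310"
    and "block_hits (differ 2) (weights r) = r ^ 2 + 13 * r + 283"
    and "block_hits (differ 3) (weights r) = 16 * r + 237"
    and "block_hits (differ 4) (weights r) = 19 * r + 181"
    and "block_hits (differ 5) (weights r) = 19 * r + 124"
    and "block_hits (differ 6) (weights r) = 16 * r + 75"
    and "block_hits (differ 7) (weights r) = 12 * r + 40"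
    and "block_hits (differ 8) (weights r) = 8 * r + 18"
    and "block_hits (differ 9) (weights r) = 4 * r + 6"
    and "block_hits (differ 10) (weights r) = r + 1"
    and "block_hits (\<lambda>x y. True) (weights r) = 8 * r ^ 2 + 244 * r + 2551"
  using block_hits_weights[of "differ 1" r] block_hits_weights[of "differ 2" r]
    block_hits_weights[of "differ 3" r] block_hits_weights[of "differ 4" r]
    block_hits_weights[of "differ 5" r] block_hits_weights[of "differ 6" r]
    block_hits_weights[of "differ 7" r] block_hits_weights[of "differ 8" r]
    block_hits_weights[of "differ 9" r] block_hits_weights[of "differ 10" r]
    block_hits_weights[of "\<lambda>x y. True" r]
  unfolding hits_const_values hits_linear_values hits_total_values
  by (simp_all add: hits_def power2_eq_square algebra_simps)

lemma weight_range: "i < 60 + 4 * r \<Longrightarrow> weight r i \<in> {-8..2}"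
proof -
  assume "i < 60 + 4 * r"
  then have "weight r i \<in> set (concat (weights r))"
    by (simp add: weight_def length_concat_weights del: set_concat)
  moreover have "set (concat (weights r)) \<subseteq> {-8..2}"
    by (auto simp: weights_def d_left_def d_five_def d_right_def)
  ultimately show ?thesis by blast
qed

text \<open>Subtracting the mean label puts the diagonal matrix with these entries into the trace-zero algebra and
  keeps all differences.\<close>

definition eigen :: "nat \<Rightarrow> nat \<Rightarrow> complex" where
  "eigen r i = of_int (weight r i) - (\<Sum>k<60 + 4 * r. of_int (weight r k)) / of_nat (60 + 4 * r)"

context
  fixes r :: nat
begin

interpretation p: block_triangular "60 + 4 * r" "block (bottom_parts r)"
  by unfold_locales simp

lemma sum_bottom: "sum_list (bottom_parts r) = 60 + 4 * r"
  using composition_parts(2)[of r] by (simp add: composition_def)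

lemma p_alg_eq: "p_alg r = p.salg"
  unfolding p_alg_def top_parts_def by (rule p.seaweed_eq_salg[OF sum_bottom refl])

lemma p_alg_sl: "p_alg r \<subseteq> sl (60 + 4 * r)"
  unfolding p_alg_eq by (auto simp: p.salg_def p.alg_def p.tr_def sl_def)

lemma card_pos_weights:
  "card {(i, k) \<in> p.pos. Q (weight r k) (weight r i)} = block_hits Q (weights r)"
proof -
  have "{(i, k) \<in> p.pos. Q (weight r k) (weight r i)} =
    {(i, k). i < length (concat (weights r)) \<and> k < length (concat (weights r)) \<and>
      block (map length (weights r)) k \<le> block (map length (weights r)) i \<and>
      Q (concat (weights r) ! k) (concat (weights r) ! i)}"
    by (auto simp: p.pos_def length_concat_weights map_length_weights weight_def)
  then show ?thesis by (simp only: block_hits_eq_card)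
qed

lemma cdim_p_alg: "cdim (60 + 4 * r) (p_alg r) = 8 * r ^ 2 + 244 * r + 2550"
  using card_pos_weights[of "\<lambda>x y. True"] unfolding p_alg_eq p.cdim_salg weight_counts
  by (simp add: case_prod_beta)

lemma meander_frobenius:
  shows "p.nondegenerate (p.meander (bottom_parts r))"
    and "mat_diag (60 + 4 * r) (eigen r) \<in> p.salg"
    and "x \<in> p.alg \<Longrightarrow> p.meander (bottom_parts r) (lie_bracket (mat_diag (60 + 4 * r) (eigen r)) x)
           = p.meander (bottom_parts r) x"
proof -
  show "p.nondegenerate (p.meander (bottom_parts r))"
    using rigid_family[of r] by (intro p.meander_nondegenerate sum_bottom refl) (simp add: bottom_parts_def)
  have "(\<Sum>i<60 + 4 * r. eigen r i) = 0"
    unfolding eigen_def sum_subtractf by (simp add: field_simps flip: of_nat_add of_nat_mult)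
  then show "mat_diag (60 + 4 * r) (eigen r) \<in> p.salg"
    by (auto simp: p.salg_def p.alg_def p.tr_def p.pos_def mat_diag_def)
  show "p.meander (bottom_parts r) (lie_bracket (mat_diag (60 + 4 * r) (eigen r)) x)
           = p.meander (bottom_parts r) x" if "x \<in> p.alg"
  proof (rule p.meander_principal[OF sum_bottom p.alg_carrier[OF that]])
    show "eigen r i - eigen r (60 + 4 * r - 1 - i) = 1" if "i < 60 + 4 * r" "60 + 4 * r - 1 - i < i" for i
      using weight_top[OF that] by (simp add: eigen_def)
    show "eigen r i - eigen r j = 1"
      if "i < j" "j < 60 + 4 * r" "reflect 0 (bottom_parts r) (int i) = int j" for i j
      using weight_bottom[OF that(3,1,2)] by (simp add: eigen_def)
  qed
qed

lemma frobenius_p_alg: "frobenius (60 + 4 * r) (p_alg r)"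
  unfolding frobenius_def p_alg_eq
  using p.lie_subalgebra_salg p.frobenius_functionalI[OF p.meander_linear[OF sum_bottom] meander_frobenius(1)] by blast

lemma principal_mult_p_alg:
  assumes "frobenius_functional (60 + 4 * r) (p_alg r) F" "j \<noteq> 0"
  shows "principal_mult (60 + 4 * r) (p_alg r) F j = block_hits (differ j) (weights r)"
proof -
  have "principal_mult (60 + 4 * r) (p_alg r) F j = card {(i, k) \<in> p.pos. eigen r i - eigen r k = of_int j}"
    using p.principal_mult_eq_card[OF p.meander_linear[OF sum_bottom] p.meander_one[OF sum_bottom]
        meander_frobenius] assms unfolding p_alg_eq by blast
  also have "{(i, k) \<in> p.pos. eigen r i - eigen r k = of_int j} = {(i, k) \<in> p.pos. weight r i - weight r k = j}"
  proof -
    have "eigen r i - eigen r k = of_int (weight r i - weight r k)" for i k by (simp add: eigen_def)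
    then show ?thesis by (simp only: of_int_eq_iff)
  qed
  finally show ?thesis using card_pos_weights[of "differ j"] by simp
qed

lemma principal_mult_large:
  assumes "frobenius_functional (60 + 4 * r) (p_alg r) F" "j > 10"
  shows "principal_mult (60 + 4 * r) (p_alg r) F j = 0"
proof -
  have "weight r i - weight r k \<noteq> j" if "(i, k) \<in> p.pos" for i k
    using weight_range[of i r] weight_range[of k r] that assms(2) by (auto simp: p.pos_def)
  then have empty: "{(i, k) \<in> p.pos. weight r i - weight r k = j} = {}" by auto
  have "principal_mult (60 + 4 * r) (p_alg r) F j = block_hits (differ j) (weights r)"
    using assms by (intro principal_mult_p_alg) auto
  also have "\<dots> = 0" by (simp only: card_pos_weights[symmetric] empty card.empty)
  finally show ?thesis .
qed

end

lemma principal_mults: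
  assumes F: "frobenius_functional (60 + 4 * r) (p_alg r) F"
  defines "h \<equiv> principal_mult (60 + 4 * r) (p_alg r) F"
  shows "h 1 = 3 * r ^ 2 + 14 * r + 310" "h 2 = r ^ 2 + 13 * r + 283" "h 3 = 16 * r + 237"
    "h 4 = 19 * r + 181" "h 5 = 19 * r + 124" "h 6 = 16 * r + 75" "h 7 = 12 * r + 40"
    "h 8 = 8 * r + 18" "h 9 = 4 * r + 6" "h 10 = r + 1" "j > 10 \<Longrightarrow> h j = 0"
  unfolding h_def
  by (simp_all add: principal_mult_p_alg[OF F] weight_counts)
    (simp add: principal_mult_large[OF F] flip: principal_mult_p_alg[OF F])

lemma strictly_unimodal_p_alg:
  assumes F: "frobenius_functional (60 + 4 * r) (p_alg r) F" and r: "r \<le> 18"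
  shows "strictly_unimodal (principal_mult (60 + 4 * r) (p_alg r) F)"
proof -
  define h where "h = principal_mult (60 + 4 * r) (p_alg r) F"
  note vals = principal_mults[OF F, folded h_def]
  have "h (j + 1) < h j" if "1 \<le> j" "j < 10" for j
  proof -
    have "16 * r + 237 < r ^ 2 + 13 * r + 283"
    proof (cases "r \<ge> 3")
      case True
      then have "3 * r \<le> r ^ 2" by (simp add: power2_eq_square)
      then show ?thesis by simp
    qed simp
    moreover have "j \<in> {1, 2, 3, 4, 5, 6, 7, 8, 9}" using that by auto
    ultimately show ?thesis using vals r by auto
  qed
  moreover have "h 10 > 0" "\<forall>j>10. h j = 0" using vals by auto
  ultimately show ?thesis unfolding strictly_unimodal_def h_def[symmetric]
    by (intro exI[of _ 10]) auto
qed

theorem theoremB: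
  shows "(\<forall>r::nat.
            p_alg r \<subseteq> sl (60 + 4 * r) \<and>
            frobenius (60 + 4 * r) (p_alg r) \<and>
            cdim (60 + 4 * r) (p_alg r) = 8 * r ^ 2 + 244 * r + 2550 \<and>
            (\<forall>F. frobenius_functional (60 + 4 * r) (p_alg r) F \<longrightarrow>
               (let h = principal_mult (60 + 4 * r) (p_alg r) F in
                  h 3 = 237 + 16 * r \<and>
                  h 4 = 181 + 19 * r \<and>
                  int (h 3) - int (h 4) = 56 - 3 * int r \<and>
                  (r \<le> 18 \<longrightarrow> strictly_unimodal h) \<and>
                  (r \<ge> 19 \<longrightarrow> \<not> unimodal h))))
       \<and> p_alg 19 \<subseteq> sl 136
       \<and> cdim 136 (p_alg 19) = 10074
       \<and> (\<forall>F. frobenius_functional 136 (p_alg 19) F \<longrightarrow>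
             (let h = principal_mult 136 (p_alg 19) F in
                map h [1..10] = [1659, 891, 541, 542, 485, 379, 268, 170, 82, 20] \<and>
                (\<forall>j>10. h j = 0)))"
proof (intro conjI allI impI)
  fix r :: nat
  show "p_alg r \<subseteq> sl (60 + 4 * r)" by (rule p_alg_sl)
  show "frobenius (60 + 4 * r) (p_alg r)" by (rule frobenius_p_alg)
  show "cdim (60 + 4 * r) (p_alg r) = 8 * r ^ 2 + 244 * r + 2550" by (rule cdim_p_alg)
  fix F assume F: "frobenius_functional (60 + 4 * r) (p_alg r) F"
  define h where "h = principal_mult (60 + 4 * r) (p_alg r) F"
  note vals = principal_mults[OF F, folded h_def]
  have "\<not> unimodal h" if "r \<ge> 19"
  proof
    assume "unimodal h"
    then have "h (3 + 1) \<le> h 3" unfolding unimodal_def by (metis one_le_numeral)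
    then show False using vals that by simp
  qed
  then show "let h = principal_mult (60 + 4 * r) (p_alg r) F in
      h 3 = 237 + 16 * r \<and> h 4 = 181 + 19 * r \<and> int (h 3) - int (h 4) = 56 - 3 * int r \<and>
      (r \<le> 18 \<longrightarrow> strictly_unimodal h) \<and> (r \<ge> 19 \<longrightarrow> \<not> unimodal h)"
    using vals strictly_unimodal_p_alg[OF F] unfolding Let_def h_def[symmetric] by simp
next
  show "p_alg 19 \<subseteq> sl 136" using p_alg_sl[of 19] by simp
  show "cdim 136 (p_alg 19) = 10074" using cdim_p_alg[of 19] by simp
  fix F assume "frobenius_functional 136 (p_alg 19) F"
  then have F: "frobenius_functional (60 + 4 * 19) (p_alg 19) F" by simp
  have n: "60 + 4 * 19 = (136 :: nat)" by simp
  note vals = principal_mults[OF F, unfolded n]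
  show "let h = principal_mult 136 (p_alg 19) F in
      map h [1..10] = [1659, 891, 541, 542, 485, 379, 268, 170, 82, 20] \<and> (\<forall>j>10. h j = 0)"
  proof -
    have "[1..10 :: int] = [1, 2, 3, 4, 5, 6, 7, 8, 9, 10]" by code_simp
    then show ?thesis using vals by (simp add: Let_def)
  qed
qed

end
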